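(* Assume that $K$ is injective with dense range, that $\hat y\in\mathcal{D}(K^+)$, and that $(\delta_m^{disc})$, $(c_m)$, $(C_m)$ are sequences of positive numbers such that, for all $m$ large enough, $\|\hat y-P_m^+P_m\hat y\|\le\delta_m^{disc}$ and $0<c_m\le\sigma_j^{(m)}\le C_m$ for $j=1,\dots,m$, and such that $\delta_m^{disc}\to0$ as $m\to\infty$ and $\limsup_{m\to\infty}C_m/c_m<\infty$. Assume that the errors satisfy one of the following: (1) the random variables $(\delta_{ij}^{(m)})_{i,j,m\in\mathbb{N}}$ are i.i.d. with zero mean and finite variance; or (2) there are $C_d\in\mathbb{R}$ and $p\ge2$ such that for all $m\in\mathbb{N}$ the random variables $(\delta_{ij}^{(m)})_{i,j\in\mathbb{N}}$ are i.i.d. with zero mean and $\mathbb{E}|\delta^{(m)}_{ij}|^{2p}\big/\big(\mathbb{E}(\delta_{ij}^{(m)})^2\big)^p\le C_d$. Let $(F_\alpha)_{\alpha>0}$ be a regularising filter as defined in the context with qualification $\nu_0>1$. For $\tau>C_0$, let $n(m,\delta_m^{disc})$ and $\alpha_m$ be determined by the discrepancy principle described in the context. Then for all $\varepsilon>0$ $$\lim_{m\to\infty}\mathbb{P}\left(\left\|R_{\alpha_m}P_m^+\bar Y^{(m)}_{n(m,\delta_m^{disc})}-K^+\hat y\right\|\ge\varepsilon\right)=0 .$$ If moreover there exist $0<\nu\le\nu_0-1$ and $\rho>0$ such that $K^+\hat y=(K^*K)^{\nu/2}w$ for some $w\in\mathcal{X}$ with $\|w\|\le\rho$, then $$\lim_{m\to\infty}\mathbb{P}\left(\left\|R_{\alpha_m}P_m^+\bar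 Y^{(m)}_{n(m,\delta_m^{disc})}-K^+\hat y\right\|\le L'\rho^{\frac1{\nu+1}}\left(\delta_m^{disc}\right)^{\frac\nu{\nu+1}}\right)=1$$ for some constant $L'$ (not depending on $m$).
   Context: $\mathcal{X},\mathcal{Y}$ are infinite-dimensional real Hilbert spaces, $K:\mathcal{X}\to\mathcal{Y}$ is a compact linear operator, and $K^+$ is its Moore-Penrose inverse with domain $\mathcal{D}(K^+)=\mathcal{R}(K)\oplus\mathcal{R}(K)^\perp$. Discretisation: for each $m\in\mathbb{N}$, $l^{(m)}_1,\dots,l_m^{(m)}$ are continuous linear functionals on $\mathcal{Y}$ with $\|l_1^{(m)}\|=\dots=\|l_m^{(m)}\|$, and $P_m:\mathcal{Y}\to\mathbb{R}^m$, $P_my=(l_1^{(m)}(y),\dots,l_m^{(m)}(y))^T$, with $P_mP_m^*$ bijective. $P_m^+$ is the Moore-Penrose inverse of $P_m$ and $\sigma_1^{(m)},\dots,\sigma_m^{(m)}$ are the singular values of $P_m$. Measurements: $Y^{(m)}_{ij}=l_j^{(m)}(\hat y)+\delta_{ij}^{(m)}$, $\bar Y_n^{(m)}=\frac1n\sum_{i=1}^n(Y^{(m)}_{i1},\dots,Y^{(m)}_{im})^T$, and $s^2_{m,n}=\frac1m\sum_{j=1}^m\frac1{n-1}\sum_{i=1}^n\big(Y^{(m)}_{ij}-\frac1n\sum_{l=1}^nY^{(m)}_{lj}\big)^2$. Filter: $(F_\alpha)_{\alpha>0}$ are piecewise continuous real-valued functions on $[0,\|K\|^2]$ such that: (i)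 $\lim_{\alpha\to0}\sup_{\varepsilon\le\lambda\le\|K\|^2}|F_\alpha(\lambda)-1/\lambda|=0$ for all $\varepsilon>0$; (ii) there is $C_R\in\mathbb{R}$ with $\lambda|F_\alpha(\lambda)|\le C_R$ for all $\lambda\in(0,\|K\|^2]$, $\alpha>0$; (iii) it has qualification $\nu_0\ge0$, i.e. $\nu_0$ (possibly $\infty$) is maximal such that for all $0\le\nu\le\nu_0$ (with $\nu<\infty$) there is $C_\nu\in\mathbb{R}$ with $\sup_{\lambda\in(0,\|K\|^2]}\lambda^{\nu/2}|1-F_\alpha(\lambda)\lambda|\le C_\nu\alpha^{\nu/2}$ for all $\alpha>0$ (the constant $C_0$ for $\nu=0$ is assumed known); (iv) there is $C_F\in\mathbb{R}$ with $|F_\alpha(\lambda)|\le C_F/\alpha$ for all $\alpha>0$, $\lambda\in(0,\|K\|^2]$. Regularisation: $R_\alpha:=F_\alpha(K^*K)K^*:\mathcal{Y}\to\mathcal{X}$. Discrepancy principle: fix $\tau>C_0$ and $q\in(0,1)$. The number of repetitions is $n(m,\delta_m^{disc}):=\min\{n\ge2:\ \frac{m s_{m,n}^2}{n c_m^2}\le(\delta_m^{disc})^2\}$ (almost surely finite). Then $\alpha_m=q^k$, where $k\in\{0,1,2,\dots\}$ is the smallest index with $\|KR_{q^k}P_m^+\bar Y^{(m)}_{n(m,\delta^{disc}_m)}-P_m^+\bar Y^{(m)}_{n(m,\delta^{disc}_m)}\|\le2\tau\delta_m^{disc}$. *)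

theory Defs
  imports "HOL-Probability.Probability" "HOL-Library.Function_Algebras"
begin

section \<open>Operators\<close>

definition infinite_dimensional :: "'a::real_vector set \<Rightarrow> bool" where
  "infinite_dimensional S \<longleftrightarrow> \<not> (\<exists>B. finite B \<and> S \<subseteq> span B)"

definition compact_operator :: "('a::real_normed_vector \<Rightarrow> 'b::real_normed_vector) \<Rightarrow> bool" where
  "compact_operator T \<longleftrightarrow> bounded_linear T \<and> compact (closure (T ` cball 0 1))"

definition orth_proj :: "'a::real_inner set \<Rightarrow> 'a \<Rightarrow> 'a" where
  "orth_proj S x = (THE p. p \<in> S \<and> x - p \<in> orthogonal_comp S)"

text \<open>
  Functional calculus of a compact self-adjoint operator \<open>A\<close>: by the spectral theorem,
  \<open>f(A) x\<close> is the sum over the eigenvalues \<open>\<mu>\<close> of \<open>A\<close> of \<open>f(\<mu>) E\<^sub>\<mu> x\<close>, where \<open>E\<^sub>\<mu>\<close> is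
  the orthogonal projection onto the eigenspace of \<open>\<mu>\<close> (including \<open>\<mu> = 0\<close> if \<open>A\<close> is not injective).
\<close>

definition eigenspace :: "('a::real_vector \<Rightarrow> 'a) \<Rightarrow> real \<Rightarrow> 'a set" where
  "eigenspace A \<mu> = {v. A v = \<mu> *\<^sub>R v}"

definition eigenvalues :: "('a::real_vector \<Rightarrow> 'a) \<Rightarrow> real set" where
  "eigenvalues A = {\<mu>. \<exists>v. v \<noteq> 0 \<and> A v = \<mu> *\<^sub>R v}"

definition fun_calc :: "(real \<Rightarrow> real) \<Rightarrow> ('a::real_inner \<Rightarrow> 'a) \<Rightarrow> 'a \<Rightarrow> 'a" where
  "fun_calc f A x = (\<Sum>\<^sub>\<infinity>\<mu>\<in>eigenvalues A. f \<mu> *\<^sub>R orth_proj (eigenspace A \<mu>) x)"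

text \<open>
  The Euclidean space of dimension \<open>m\<close>, with \<open>m\<close> a term and not a type, is the set \<open>Rn m\<close> of
  functions on \<open>nat\<close> supported on \<open>{1..m}\<close> with the scalar product \<open>dot m\<close>. So that one
  definition serves for operators into it and into a Hilbert space, the notions below take the scalar
  product \<open>ip\<close> of the codomain as an argument; for a Hilbert space it is \<open>inner\<close>.
\<close>

definition Rn :: "nat \<Rightarrow> (nat \<Rightarrow> real) set" where
  "Rn m = {v. \<forall>j. j \<notin> {1..m} \<longrightarrow> v j = 0}"

definition dot :: "nat \<Rightarrow> (nat \<Rightarrow> real) \<Rightarrow> (nat \<Rightarrow> real) \<Rightarrow> real" where
  "dot m u v = (\<Sum>j=1..m. u j * v j)"

definition adjoint_ip :: "('b \<Rightarrow> 'b \<Rightarrow> real) \<Rightarrow> ('a::real_inner \<Rightarrow> 'b) \<Rightarrow> 'b \<Rightarrow> 'a" where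
  "adjoint_ip ip T = (SOME T'. \<forall>x v. ip (T x) v = x \<bullet> T' v)"

text \<open>
  For \<open>y\<close> in the domain \<open>R(T) \<oplus> R(T)\<^sup>\<bottom>\<close>, the value of the Moore-Penrose inverse is the unique
  \<open>x \<in> N(T)\<^sup>\<bottom>\<close> for which \<open>T x\<close> is the \<open>R(T)\<close>-component of \<open>y\<close>, i.e. \<open>y - T x \<in> R(T)\<^sup>\<bottom>\<close>.
\<close>

definition mp_domain :: "('b \<Rightarrow> 'b \<Rightarrow> real) \<Rightarrow> ('a::real_inner \<Rightarrow> 'b::{plus}) \<Rightarrow> 'b set" where
  "mp_domain ip T = {u + v | u v. u \<in> range T \<and> (\<forall>z. ip v (T z) = 0)}"

definition mp_inverse ::
    "('b \<Rightarrow> 'b \<Rightarrow> real) \<Rightarrow> ('a::real_inner \<Rightarrow> 'b::{minus,zero}) \<Rightarrow> 'b \<Rightarrow> 'a" where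
  "mp_inverse ip T y =
     (THE x. x \<in> orthogonal_comp {z. T z = 0} \<and> (\<forall>z. ip (y - T x) (T z) = 0))"

text \<open>
  The nonzero singular values. For \<open>T\<close> onto \<open>Rn m\<close> these are all \<open>m\<close> singular values, as a set, that is,
  without multiplicities.
\<close>

definition singular_values :: "('b \<Rightarrow> 'b \<Rightarrow> real) \<Rightarrow> ('a::real_inner \<Rightarrow> 'b) \<Rightarrow> real set" where
  "singular_values ip T =
     {\<sigma>. \<sigma> > 0 \<and> (\<exists>x. x \<noteq> 0 \<and> adjoint_ip ip T (T x) = \<sigma>\<^sup>2 *\<^sub>R x)}"

section \<open>Discretisation and measurements\<close>

definition discr :: "nat \<Rightarrow> (nat \<Rightarrow> 'a \<Rightarrow> real) \<Rightarrow> 'a \<Rightarrow> nat \<Rightarrow> real" where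
  "discr m l y = (\<lambda>j. if j \<in> {1..m} then l j y else 0)"

text \<open>Below, \<open>Y i j\<close> is the \<open>i\<close>-th repetition of the measurement in channel \<open>j\<close>.\<close>

definition sample_mean :: "nat \<Rightarrow> nat \<Rightarrow> (nat \<Rightarrow> nat \<Rightarrow> real) \<Rightarrow> nat \<Rightarrow> real" where
  "sample_mean m n Y = (\<lambda>j. if j \<in> {1..m} then (1 / real n) * (\<Sum>i=1..n. Y i j) else 0)"

definition sample_var :: "nat \<Rightarrow> nat \<Rightarrow> (nat \<Rightarrow> nat \<Rightarrow> real) \<Rightarrow> real" where
  "sample_var m n Y = (1 / real m) * (\<Sum>j=1..m. (1 / (real n - 1)) *
     (\<Sum>i=1..n. (Y i j - (1 / real n) * (\<Sum>l=1..n. Y l j))\<^sup>2))"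

definition iid :: "'w measure \<Rightarrow> ('i \<Rightarrow> 'w \<Rightarrow> real) \<Rightarrow> 'i set \<Rightarrow> bool" where
  "iid M X I \<longleftrightarrow> prob_space.indep_vars M (\<lambda>_. borel) X I \<and>
     (\<forall>i\<in>I. \<forall>j\<in>I. distr M borel (X i) = distr M borel (X j))"

section \<open>Filters\<close>

definition piecewise_continuous_on :: "real \<Rightarrow> real \<Rightarrow> (real \<Rightarrow> real) \<Rightarrow> bool" where
  "piecewise_continuous_on a b f \<longleftrightarrow> (\<exists>S. finite S \<and> continuous_on ({a..b} - S) f \<and>
     (\<forall>x\<in>S \<inter> {a..b}. (\<exists>L. (f \<longlongrightarrow> L) (at x within {a..<x})) \<and>
                      (\<exists>L. (f \<longlongrightarrow> L) (at x within {x<..b}))))"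

definition rate_const :: "real \<Rightarrow> (real \<Rightarrow> real \<Rightarrow> real) \<Rightarrow> real \<Rightarrow> real \<Rightarrow> bool" where
  "rate_const b F \<nu> C \<longleftrightarrow> (\<forall>\<alpha>>0. \<forall>t\<in>{0<..b}.
     t powr (\<nu> / 2) * \<bar>1 - F \<alpha> t * t\<bar> \<le> C * \<alpha> powr (\<nu> / 2))"

definition rates_upto :: "real \<Rightarrow> (real \<Rightarrow> real \<Rightarrow> real) \<Rightarrow> ereal \<Rightarrow> bool" where
  "rates_upto b F \<mu> \<longleftrightarrow> (\<forall>\<nu>::real. 0 \<le> \<nu> \<and> ereal \<nu> \<le> \<mu> \<longrightarrow> (\<exists>C. rate_const b F \<nu> C))"

definition qualification :: "real \<Rightarrow> (real \<Rightarrow> real \<Rightarrow> real) \<Rightarrow> ereal \<Rightarrow> bool" where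
  "qualification b F \<nu>0 \<longleftrightarrow>
     0 \<le> \<nu>0 \<and> rates_upto b F \<nu>0 \<and> (\<forall>\<mu>. rates_upto b F \<mu> \<longrightarrow> \<mu> \<le> \<nu>0)"

definition regularising_filter :: "real \<Rightarrow> (real \<Rightarrow> real \<Rightarrow> real) \<Rightarrow> ereal \<Rightarrow> bool" where
  "regularising_filter b F \<nu>0 \<longleftrightarrow>
     (\<forall>\<alpha>>0. piecewise_continuous_on 0 b (F \<alpha>)) \<and>
     (\<forall>\<epsilon>>0. uniform_limit {\<epsilon>..b} F (\<lambda>t. 1 / t) (at_right 0)) \<and>
     (\<exists>C\<^sub>R. \<forall>\<alpha>>0. \<forall>t\<in>{0<..b}. t * \<bar>F \<alpha> t\<bar> \<le> C\<^sub>R) \<and>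
     qualification b F \<nu>0 \<and>
     (\<exists>C\<^sub>F. \<forall>\<alpha>>0. \<forall>t\<in>{0<..b}. \<bar>F \<alpha> t\<bar> \<le> C\<^sub>F / \<alpha>)"

section \<open>Regularisation and the discrepancy principle\<close>

definition regop :: "('x::real_inner \<Rightarrow> 'y::real_inner) \<Rightarrow> (real \<Rightarrow> real) \<Rightarrow> 'y \<Rightarrow> 'x" where
  "regop K f y = fun_calc f (adjoint K \<circ> K) (adjoint K y)"

text \<open>
  In both minima, \<open>LEAST\<close> is unspecified if no index qualifies. In \<open>num_reps\<close>, \<open>c\<close> is the lower
  bound for the singular values and \<open>d\<close> is the discretisation error level.
\<close>

definition num_reps :: "nat \<Rightarrow> real \<Rightarrow> real \<Rightarrow> (nat \<Rightarrow> nat \<Rightarrow> real) \<Rightarrow> nat" where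
  "num_reps m c d Y =
     (LEAST n. 2 \<le> n \<and> real m * sample_var m n Y / (real n * c\<^sup>2) \<le> d\<^sup>2)"

definition discrepancy_param ::
    "('x::real_inner \<Rightarrow> 'y::real_inner) \<Rightarrow> (real \<Rightarrow> real \<Rightarrow> real) \<Rightarrow> real \<Rightarrow> real \<Rightarrow> real \<Rightarrow> 'y \<Rightarrow> real" where
  "discrepancy_param K F q \<tau> d z =
     q ^ (LEAST k. norm (K (regop K (F (q ^ k)) z) - z) \<le> 2 * \<tau> * d)"

text \<open>The back-projected averaged data, with the number of repetitions chosen by \<open>num_reps\<close>.\<close>

definition backproj_data ::
    "nat \<Rightarrow> (nat \<Rightarrow> 'y::real_inner \<Rightarrow> real) \<Rightarrow> real \<Rightarrow> real \<Rightarrow> (nat \<Rightarrow> nat \<Rightarrow> real) \<Rightarrow> 'y" where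
  "backproj_data m l c d Y =
     mp_inverse (dot m) (discr m l) (sample_mean m (num_reps m c d Y) Y)"

definition discrepancy_estimate ::
    "('x::real_inner \<Rightarrow> 'y::real_inner) \<Rightarrow> (real \<Rightarrow> real \<Rightarrow> real) \<Rightarrow> real \<Rightarrow> real \<Rightarrow> real \<Rightarrow> 'y \<Rightarrow> 'x" where
  "discrepancy_estimate K F q \<tau> d z = regop K (F (discrepancy_param K F q \<tau> d z)) z"

end

theory Submission
  imports Defs
begin

text \<open>
  On Hilbert space everything is read off from the spectral decomposition of \<open>A = K\<^sup>* K\<close>. As the range of
  \<open>K\<close> is dense, the bounds \<open>\<parallel>y - K R\<^sub>\<alpha> y\<parallel> \<le> C0 \<parallel>y\<parallel>\<close> and \<open>\<parallel>R\<^sub>\<alpha> y\<parallel> \<le> sqrt (C\<^sub>R C\<^sub>F / \<alpha>) \<parallel>y\<parallel>\<close> need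
  only be checked on the range of \<open>K\<close>. If the data \<open>z\<close> satisfy \<open>\<parallel>z - K x\<parallel> \<le> (1 + \<kappa>) d\<close> with \<open>C0 (1 + \<kappa>) < 2 \<tau>\<close>,
  then the discrepancy principle bounds the residual of the exact data from above at the chosen \<open>\<alpha>\<close>
  and from below at \<open>\<alpha> / q\<close>; the former controls the approximation error and the latter the
  propagated noise. Splitting the spectrum at a suitable threshold replaces interpolation inequalities.

  It remains to see that \<open>\<parallel>z - K x\<parallel> \<le> (1 + \<kappa>) d\<close> has probability tending to 1 for each \<open>\<kappa> > 1\<close>, although
  the number of repetitions is random. In \<open>n\<close>, sample mean and sample variance are reverse
  martingales, so Doob's inequality bounds the norm of the mean uniformly over all \<open>n \<ge> a\<close> by what happens at
  \<open>n = a\<close>, and the variance uniformly over \<open>n \<ge> 2\<close> by what happens at \<open>n = 2\<close>; a lower bound for the variance is a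
  lower bound for the number of repetitions. At a fixed \<open>n\<close> truncated errors obey a weak law of
  large numbers as \<open>m\<close> grows, and under both assumptions on the errors the truncation costs little,
  uniformly in \<open>m\<close>.
\<close>

section \<open>Orthogonal projections and adjoints in Hilbert spaces\<close>

text \<open>Since \<open>\<tau>\<close> may be arbitrarily close to \<open>C0\<close>, of the data
  error of about 2 d that the rule tolerates one d is taken by the discretisation, and the noise has
  to fit into barely more than the other. Heuristically it fits: if the sample variance is near the
  variance v of the errors, the criterion makes m v / n, the mean square of the norm of the averaged
  errors, at most (c d)^2, and the pseudoinverse of P_m has norm at most 1/c. Doob's inequality for
  the norm itself would leave a bound near one at levels close to the typical size sqrt (m v / n).
  It is therefore applied to the excess of the norm over this size, which is of smaller order in the
  mean because the squares of m independent channels average out. Averaging of squares asks for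
  fourth moments, which may be infinite; hence the truncation. It is done relative to the standard
  deviation, since the scale of the errors may vary with m. In the deterministic part the
  qualification beyond 1 makes the noise term vanish: one unit of it is used up by the factor K in
  the residual, and what remains forces d^2 / \<alpha> to tend to 0 for the chosen \<alpha>.\<close>

lemma closed_subspace_projection_exists:
  fixes S :: "'a::{real_inner, complete_space} set"
  assumes S: "subspace S" and cl: "closed S"
  obtains p where "p \<in> S" "x - p \<in> orthogonal_comp S"
proof -
  define D where "D = (INF y\<in>S. (norm (x - y))\<^sup>2)"
  have ne: "S \<noteq> {}"
    using S subspace_0 by blast
  have bdd: "bdd_below ((\<lambda>y. (norm (x - y))\<^sup>2) ` S)"
    by (rule bdd_belowI[where m = 0]) auto
  have D_le: "D \<le> (norm (x - y))\<^sup>2" if "y \<in> S" for y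
    unfolding D_def by (rule cINF_lower[OF bdd that])
  have "\<exists>y\<in>S. (norm (x - y))\<^sup>2 < D + 1 / real (Suc n)" for n
  proof -
    have "D < D + 1 / real (Suc n)"
      by simp
    then show ?thesis
      unfolding D_def cINF_less_iff[OF ne bdd] .
  qed
  then obtain y where y: "\<And>n. y n \<in> S" "\<And>n. (norm (x - y n))\<^sup>2 < D + 1 / real (Suc n)"
    by metis
  have dist_y: "(norm (y n - y k))\<^sup>2 \<le> 2 / real (Suc n) + 2 / real (Suc k)" for n k
  proof -
    \<comment> \<open>The midpoint competes for the infimum \<open>D\<close>, so by the
      parallelogram law two near-minimisers are close to each other.\<close>
    have "(1/2) *\<^sub>R (y n + y k) \<in> S"
      using S y by (simp add: subspace_add subspace_scale)
    then have "D \<le> (norm (x - (1/2) *\<^sub>R (y n + y k)))\<^sup>2"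
      by (rule D_le)
    moreover have "(norm (y n - y k))\<^sup>2
        = 2 * (norm (x - y n))\<^sup>2 + 2 * (norm (x - y k))\<^sup>2 - 4 * (norm (x - (1/2) *\<^sub>R (y n + y k)))\<^sup>2"
      by (simp add: power2_norm_eq_inner inner_diff_left inner_diff_right inner_add_left
          inner_add_right inner_commute algebra_simps)
    ultimately show ?thesis
      using y(2)[of n] y(2)[of k] by simp
  qed
  have "Cauchy y"
  proof (rule metric_CauchyI)
    fix e :: real assume e: "e > 0"
    obtain N where N: "4 / e\<^sup>2 < real N"
      using reals_Archimedean2 by blast
    have "dist (y n) (y k) < e" if "n \<ge> N" "k \<ge> N" for n k
    proof -
      have N0: "real N > 0"
        using N e by (smt (verit) divide_pos_pos zero_less_power)
      have "2 / real (Suc n) < 2 / real N \<or> 2 / real (Suc n) = 2 / real N"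
        using that N0 by (intro disjI1 divide_strict_left_mono) auto
      moreover have "2 / real (Suc k) < 2 / real N"
        using that N0 by (intro divide_strict_left_mono) auto
      moreover have "4 / real N < e\<^sup>2"
        using N N0 e by (simp add: field_simps)
      ultimately have "(norm (y n - y k))\<^sup>2 < e\<^sup>2"
        using dist_y[of n k] by auto
      then show ?thesis
        using e by (simp add: dist_norm power_less_imp_less_base)
    qed
    then show "\<exists>M. \<forall>m\<ge>M. \<forall>n\<ge>M. dist (y m) (y n) < e"
      by blast
  qed
  then obtain p where p: "y \<longlonglongrightarrow> p"
    using Cauchy_convergent convergent_def by blast
  have pS: "p \<in> S"
    using closed_sequentially[OF cl] y(1) p by blast
  have "(\<lambda>n. (norm (x - y n))\<^sup>2) \<longlonglongrightarrow> (norm (x - p))\<^sup>2"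
    by (intro tendsto_intros p)
  moreover have "(\<lambda>n. D + 1 / real (Suc n)) \<longlonglongrightarrow> D + 0"
    by (intro tendsto_intros LIMSEQ_Suc lim_1_over_n)
  ultimately have pD: "(norm (x - p))\<^sup>2 \<le> D"
    using y(2) by (intro LIMSEQ_le) (auto intro: less_imp_le)
  have "y \<bullet> (x - p) = 0" if "y \<in> S" for y
  proof (cases "y = 0")
    case False
    \<comment> \<open>The minimiser over t of the squared distance from \<open>x\<close> to
      \<open>p + t *\<^sub>R y\<close>; that even this does not beat \<open>p\<close> forces the
      inner product to vanish.\<close>
    define t where "t = (y \<bullet> (x - p)) / (y \<bullet> y)"
    have "p + t *\<^sub>R y \<in> S"
      using S pS that by (simp add: subspace_add subspace_scale)
    then have "(norm (x - p))\<^sup>2 \<le> (norm (x - (p + t *\<^sub>R y)))\<^sup>2"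
      using order_trans[OF pD D_le] by blast
    also have "\<dots> = (norm (x - p))\<^sup>2 - 2 * t * (y \<bullet> (x - p)) + t\<^sup>2 * (y \<bullet> y)"
      unfolding power2_norm_eq_inner
      by (simp add: inner_diff_left inner_diff_right inner_add_left
          inner_add_right inner_commute algebra_simps power2_eq_square)
    also have "\<dots> = (norm (x - p))\<^sup>2 - (y \<bullet> (x - p))\<^sup>2 / (y \<bullet> y)"
      using False by (simp add: t_def power2_eq_square field_simps)
    finally have "(y \<bullet> (x - p))\<^sup>2 / (y \<bullet> y) \<le> 0"
      by simp
    then show ?thesis
      using False by (simp add: divide_le_0_iff) (smt (verit) inner_gt_zero_iff zero_less_power2)
  qed simp
  then have "x - p \<in> orthogonal_comp S"
    by (simp add: orthogonal_comp_def orthogonal_def)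
  with pS that show thesis
    by blast
qed

lemma orth_proj_eqI:
  assumes S: "subspace S" and p: "p \<in> S" "x - p \<in> orthogonal_comp S"
  shows "orth_proj S x = p"
  unfolding orth_proj_def
proof (rule the_equality)
  fix p' assume p': "p' \<in> S \<and> x - p' \<in> orthogonal_comp S"
  have "p - p' \<in> S"
    using S p p' by (simp add: subspace_diff)
  then have "(p - p') \<bullet> (x - p') = 0" "(p - p') \<bullet> (x - p) = 0"
    using p p' by (auto simp: orthogonal_comp_def orthogonal_def)
  then have "(p - p') \<bullet> (p - p') = 0"
    by (simp add: inner_diff_right)
  then show "p' = p"
    by simp
qed (use p in simp)

lemma orth_proj_props:
  fixes S :: "'a::{real_inner, complete_space} set"
  assumes "subspace S" "closed S"
  shows "orth_proj S x \<in> S" and "x - orth_proj S x \<in> orthogonal_comp S"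
proof -
  obtain p where p: "p \<in> S" "x - p \<in> orthogonal_comp S"
    using closed_subspace_projection_exists[OF assms] by blast
  then show "orth_proj S x \<in> S" "x - orth_proj S x \<in> orthogonal_comp S"
    using orth_proj_eqI[OF assms(1) p] by auto
qed

lemma inner_orth_proj:
  fixes S :: "'a::{real_inner, complete_space} set"
  assumes "subspace S" "closed S" "v \<in> S"
  shows "orth_proj S x \<bullet> v = x \<bullet> v"
  using orth_proj_props(2)[OF assms(1,2), of x] assms(3)
  by (auto simp: orthogonal_comp_def orthogonal_def inner_diff_right inner_commute)

lemma orth_proj_eqI_inner:
  fixes S :: "'a::{real_inner, complete_space} set"
  assumes "subspace S" "p \<in> S" "\<And>v. v \<in> S \<Longrightarrow> p \<bullet> v = x \<bullet> v"
  shows "orth_proj S x = p"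
  using assms by (intro orth_proj_eqI)
    (auto simp: orthogonal_comp_def orthogonal_def inner_diff_right inner_commute)

section \<open>Riesz representation and adjoints\<close>

theorem riesz_representation:
  fixes f :: "'a::{real_inner, complete_space} \<Rightarrow> real"
  assumes "bounded_linear f"
  obtains e where "\<And>x. f x = x \<bullet> e"
proof -
  interpret bounded_linear f by fact
  show thesis
  proof (cases "\<forall>x. f x = 0")
    case True
    then show thesis
      using that[of 0] by simp
  next
    case False
    then obtain x0 where x0: "f x0 \<noteq> 0" by blast
    define S where "S = {x. f x = 0}"
    have S: "subspace S"
      by (auto simp: S_def subspace_def add scaleR zero)
    have "closed S"
      unfolding S_def by (intro closed_Collect_eq continuous_on_const linear_continuous_on assms)
    then obtain p where p: "p \<in> S" "x0 - p \<in> orthogonal_comp S"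
      using closed_subspace_projection_exists[OF S] by blast
    define u where "u = x0 - p"
    have fu: "f u \<noteq> 0"
      using x0 p by (simp add: u_def diff S_def)
    then have u0: "u \<noteq> 0"
      using zero by blast
    have "f x = x \<bullet> ((f u / (u \<bullet> u)) *\<^sub>R u)" for x
    proof -
      have "x - (f x / f u) *\<^sub>R u \<in> S"
        using fu by (simp add: S_def diff scaleR)
      then have "(x - (f x / f u) *\<^sub>R u) \<bullet> u = 0"
        using p(2) by (auto simp: orthogonal_comp_def orthogonal_def u_def)
      then show ?thesis
        using fu u0 by (simp add: inner_diff_left field_simps)
    qed
    then show thesis
      using that by blast
  qed
qed

text \<open>The constant \<open>adjoint\<close> is a choice operator, so this identity rests on the
  existence of some adjoint; Riesz representation, applied for each y, supplies one.\<close>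

lemma inner_adjoint:
  fixes T :: "'a::{real_inner, complete_space} \<Rightarrow> 'b::real_inner"
  assumes "bounded_linear T"
  shows "T x \<bullet> y = x \<bullet> adjoint T y"
proof -
  have "\<exists>e. \<forall>x. T x \<bullet> y = x \<bullet> e" for y
    using riesz_representation[OF bounded_linear_compose[OF bounded_linear_inner_left assms], of y]
    by metis
  then have "\<exists>T'. \<forall>x y. T x \<bullet> y = x \<bullet> T' y"
    by metis
  then have "\<forall>x y. T x \<bullet> y = x \<bullet> adjoint T y"
    unfolding adjoint_def by (rule someI_ex)
  then show ?thesis
    by blast
qed

lemma inner_ext:
  fixes x y :: "'a::real_inner"
  assumes "\<And>z. z \<bullet> x = z \<bullet> y"
  shows "x = y"
  using assms[of "x - y"] by (metis eq_iff_diff_eq_0 inner_diff_right inner_eq_zero_iff)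

lemma norm_adjoint_le:
  fixes T :: "'a::{real_inner, complete_space} \<Rightarrow> 'b::real_inner"
  assumes "bounded_linear T"
  shows "norm (adjoint T y) \<le> onorm T * norm y"
proof (cases "adjoint T y = 0")
  case True
  then show ?thesis
    by (simp add: onorm_pos_le[OF assms])
next
  case False
  have "(norm (adjoint T y))\<^sup>2 = T (adjoint T y) \<bullet> y"
    by (simp add: inner_adjoint[OF assms] power2_norm_eq_inner)
  also have "\<dots> \<le> norm (T (adjoint T y)) * norm y"
    by (rule norm_cauchy_schwarz)
  also have "\<dots> \<le> (onorm T * norm (adjoint T y)) * norm y"
    by (intro mult_right_mono onorm assms) auto
  finally show ?thesis
    using False by (simp add: power2_eq_square mult.assoc mult.left_commute)
qed

lemma bounded_linear_adjoint:
  fixes T :: "'a::{real_inner, complete_space} \<Rightarrow> 'b::real_inner"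
  assumes "bounded_linear T"
  shows "bounded_linear (adjoint T)"
proof (rule bounded_linear_intro[where K = "onorm T"])
  note * = inner_adjoint[OF assms, symmetric]
  show "adjoint T (x + y) = adjoint T x + adjoint T y" for x y
    by (rule inner_ext) (simp add: inner_add_right *)
  show "adjoint T (r *\<^sub>R x) = r *\<^sub>R adjoint T x" for r x
    by (rule inner_ext) (simp add: *)
  show "norm (adjoint T x) \<le> norm x * onorm T" for x
    using norm_adjoint_le[OF assms, of x] by (simp add: mult.commute)
qed

section \<open>Orthogonal series\<close>

text \<open>By Pythagoras, the squared distance of two nested finite partial sums is the
  corresponding difference for the scalar series; the net of finite sums is therefore
  Cauchy.\<close>

lemma summable_on_orthogonal:
  fixes v :: "'i \<Rightarrow> 'a::{real_inner, complete_space}"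
  assumes orth: "\<And>i j. i \<in> I \<Longrightarrow> j \<in> I \<Longrightarrow> i \<noteq> j \<Longrightarrow> v i \<bullet> v j = 0"
    and sm: "(\<lambda>i. (norm (v i))\<^sup>2) summable_on I"
  shows "v summable_on I"
proof -
  define g where "g i = (norm (v i))\<^sup>2" for i
  obtain s where s: "(sum g \<longlongrightarrow> s) (finite_subsets_at_top I)"
    using sm by (auto simp: summable_on_def has_sum_def g_def[abs_def])
  have cauchy: "\<exists>P. eventually P (finite_subsets_at_top I) \<and>
          (\<forall>F1 F2. P F1 \<and> P F2 \<longrightarrow> dist (sum v F1) (sum v F2) < e)" if e: "e > 0" for e
  proof -
    \<comment> \<open>Two deviations of \<open>e\<^sup>2 / 8\<close> add up to the square of
      \<open>e / 2\<close>, and two distances below \<open>e / 2\<close> to less than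
      \<open>e\<close>.\<close>
    have "eventually (\<lambda>F. dist (sum g F) s < e\<^sup>2 / 8) (finite_subsets_at_top I)"
      using s e by (intro tendstoD) auto
    then obtain F0 where F0: "finite F0" "F0 \<subseteq> I"
      and close: "\<And>F. finite F \<Longrightarrow> F0 \<subseteq> F \<Longrightarrow> F \<subseteq> I \<Longrightarrow> dist (sum g F) s < e\<^sup>2 / 8"
      by (auto simp: eventually_finite_subsets_at_top)
    have near: "dist (sum v F) (sum v F0) < e / 2" if F: "finite F" "F0 \<subseteq> F" "F \<subseteq> I" for F
    proof -
      have "(dist (sum v F) (sum v F0))\<^sup>2 = (norm (sum v (F - F0)))\<^sup>2"
        using F by (simp add: dist_norm sum_diff)
      also have "\<dots> = sum g (F - F0)"
        unfolding g_def using F orth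
        by (intro norm_sum_Pythagorean) (auto simp: pairwise_def orthogonal_def subset_iff)
      also have "\<dots> = sum g F - sum g F0"
        using F by (simp add: sum_diff)
      also have "\<dots> < e\<^sup>2 / 4"
        using close[OF F] close[OF F0(1) order_refl F0(2)] unfolding dist_real_def by linarith
      also have "\<dots> = (e / 2)\<^sup>2"
        by (simp add: power2_eq_square)
      finally show ?thesis
        by (rule power_less_imp_less_base) (use e in simp)
    qed
    have "eventually (\<lambda>F. finite F \<and> F0 \<subseteq> F \<and> F \<subseteq> I) (finite_subsets_at_top I)"
      using F0 by (auto simp: eventually_finite_subsets_at_top)
    moreover have "dist (sum v F1) (sum v F2) < e"
      if "finite F1 \<and> F0 \<subseteq> F1 \<and> F1 \<subseteq> I" "finite F2 \<and> F0 \<subseteq> F2 \<and> F2 \<subseteq> I" for F1 F2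
      using near[of F1] near[of F2] that dist_triangle2[of "sum v F1" "sum v F2" "sum v F0"] by auto
    ultimately show ?thesis
      by (intro exI[of _ "\<lambda>F. finite F \<and> F0 \<subseteq> F \<and> F \<subseteq> I"]) auto
  qed
  have "cauchy_filter (filtermap (sum v) (finite_subsets_at_top I))"
    unfolding cauchy_filter_metric_filtermap by (intro allI impI cauchy)
  then have "convergent_filter (filtermap (sum v) (finite_subsets_at_top I))"
    by (rule cauchy_filter_convergent)
  then show ?thesis
    by (auto simp: convergent_filter_iff summable_on_def has_sum_def filterlim_def)
qed

lemma has_sum_orthogonal_norm:
  fixes v :: "'i \<Rightarrow> 'a::real_inner"
  assumes orth: "\<And>i j. i \<in> I \<Longrightarrow> j \<in> I \<Longrightarrow> i \<noteq> j \<Longrightarrow> v i \<bullet> v j = 0"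
    and s: "(v has_sum s) I"
  shows "((\<lambda>i. (norm (v i))\<^sup>2) has_sum (norm s)\<^sup>2) I"
proof -
  have "((\<lambda>F. (norm (sum v F))\<^sup>2) \<longlongrightarrow> (norm s)\<^sup>2) (finite_subsets_at_top I)"
    using s unfolding has_sum_def by (intro tendsto_intros)
  moreover have "eventually (\<lambda>F. (norm (sum v F))\<^sup>2 = (\<Sum>i\<in>F. (norm (v i))\<^sup>2)) (finite_subsets_at_top I)"
    using orth by (intro eventually_finite_subsets_at_top_weakI norm_sum_Pythagorean)
      (auto simp: pairwise_def orthogonal_def subset_iff)
  ultimately show ?thesis
    unfolding has_sum_def using tendsto_cong by force
qed

section \<open>The spectral theorem for compact positive operators\<close>

lemma nonneg_form_Cauchy_Schwarz:
  fixes A :: "'a::real_inner \<Rightarrow> 'a"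
  assumes lin: "linear A" and sym: "\<And>x y. A x \<bullet> y = x \<bullet> A y" and pos: "\<And>x. 0 \<le> A x \<bullet> x"
  shows "(A x \<bullet> y)\<^sup>2 \<le> (A x \<bullet> x) * (A y \<bullet> y)"
proof -
  interpret linear A by fact
  have quad: "0 \<le> A x \<bullet> x + 2 * t * (A x \<bullet> y) + t\<^sup>2 * (A y \<bullet> y)" for t
  proof -
    have "A (x + t *\<^sub>R y) \<bullet> (x + t *\<^sub>R y) = A x \<bullet> x + 2 * t * (A x \<bullet> y) + t\<^sup>2 * (A y \<bullet> y)"
      using sym[of y x]
      by (simp add: add scale inner_add_left inner_add_right inner_commute power2_eq_square algebra_simps)
    then show ?thesis
      by (metis pos)
  qed
  show ?thesis
  proof (cases "A y \<bullet> y = 0")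
    case True
    have "A x \<bullet> y = 0"
    proof (rule ccontr)
      assume ne: "A x \<bullet> y \<noteq> 0"
      \<comment> \<open>With vanishing quadratic coefficient the form is affine in t; at the t
        inserted here it takes the value -1.\<close>
      show False
        using quad[of "- (A x \<bullet> x + 1) / (2 * (A x \<bullet> y))"] True ne pos[of x] by (simp add: field_simps)
    qed
    then show ?thesis
      using True by simp
  next
    case False
    then have yy: "A y \<bullet> y > 0"
      using pos[of y] by simp
    have "0 \<le> A x \<bullet> x - (A x \<bullet> y)\<^sup>2 / (A y \<bullet> y)"
      using quad[of "- (A x \<bullet> y) / (A y \<bullet> y)"] yy by (simp add: power2_eq_square field_simps)
    then show ?thesis
      using yy by (simp add: field_simps)
  qed
qed

text \<open>Compactness enters through a compact superset \<open>Q\<close> of the image of the unit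
  ball. Both for K^* K and for the finite-rank operator P^* P such a set is at hand, without a
  description of the closure of the image.\<close>

locale compact_positive_operator =
  fixes A :: "'a::{real_inner, complete_space} \<Rightarrow> 'a" and Q :: "'a set"
  assumes bounded_linear_A: "bounded_linear A"
    and symmetric: "A x \<bullet> y = x \<bullet> A y"
    and nonneg: "0 \<le> A x \<bullet> x"
    and compact_Q: "compact Q" and image_Q: "A ` cball 0 1 \<subseteq> Q"
begin

sublocale bounded_linear A
  by (rule bounded_linear_A)

lemma subspace_eigenspace: "subspace (eigenspace A \<mu>)"
  by (auto simp: eigenspace_def subspace_def add scaleR zero scaleR_add_right)

lemma closed_eigenspace: "closed (eigenspace A \<mu>)"
  unfolding eigenspace_def
  by (intro closed_Collect_eq continuous_on_id continuous_on_scaleR continuous_on_const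
      linear_continuous_on bounded_linear_axioms)

lemma eigenspace_orthogonal:
  assumes "x \<in> eigenspace A \<mu>" "y \<in> eigenspace A \<nu>" "\<mu> \<noteq> \<nu>"
  shows "x \<bullet> y = 0"
  using symmetric[of x y] assms by (simp add: eigenspace_def)

lemma eigenvalue_nonneg: "\<mu> \<in> eigenvalues A \<Longrightarrow> 0 \<le> \<mu>"
proof -
  assume "\<mu> \<in> eigenvalues A"
  then obtain v where v: "v \<noteq> 0" "A v = \<mu> *\<^sub>R v"
    by (auto simp: eigenvalues_def)
  then have "0 \<le> \<mu> * (v \<bullet> v)" "v \<bullet> v > 0"
    using nonneg[of v] by auto
  then show ?thesis
    by (simp add: zero_le_mult_iff)
qed

text \<open>A maximising sequence for the quadratic form on the orthogonal complement of all
  eigenvectors would converge to a further eigenvector.\<close>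

lemma eigenvectors_total:
  assumes x: "\<And>\<mu> v. v \<in> eigenspace A \<mu> \<Longrightarrow> x \<bullet> v = 0"
  shows "x = 0"
proof -
  define W where "W = {x. \<forall>\<mu>. \<forall>v\<in>eigenspace A \<mu>. x \<bullet> v = 0}"
  have W: "subspace W"
    by (auto simp: W_def subspace_def inner_add_left)
  have closed_W: "closed W"
  proof -
    have "W = (\<Inter>\<mu>. \<Inter>v\<in>eigenspace A \<mu>. {x. x \<bullet> v = 0})"
      by (auto simp: W_def)
    then show ?thesis
      by (auto intro!: closed_INT closed_Collect_eq continuous_intros)
  qed
  have A_W: "A w \<in> W" if "w \<in> W" for w
    using that by (auto simp: W_def symmetric) (auto simp: eigenspace_def)
  have no_eigen: "v = 0" if "v \<in> W" "A v = \<mu> *\<^sub>R v" for v \<mu>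
  proof -
    have "v \<in> eigenspace A \<mu>"
      using that by (simp add: eigenspace_def)
    then have "v \<bullet> v = 0"
      using that(1) by (auto simp: W_def)
    then show ?thesis
      by simp
  qed
  define B where "B = {w \<in> W. norm w \<le> 1}"
  \<comment> \<open>The supremum of the quadratic form over the unit ball of the orthogonal
    complement \<open>W\<close>. It turns out to be 0, so that A vanishes on \<open>W\<close> and a
    unit vector of \<open>W\<close> would be an eigenvector for 0.\<close>
  define s where "s = (SUP w\<in>B. A w \<bullet> w)"
  have "0 \<in> B"
    using W by (simp add: B_def subspace_0)
  obtain k where k: "\<And>x. norm (A x) \<le> norm x * k" and "k > 0"
    using pos_bounded by blast
  have bdd: "bdd_above ((\<lambda>w. A w \<bullet> w) ` B)"
  proof (rule bdd_aboveI2)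
    fix w assume w: "w \<in> B"
    have "A w \<bullet> w \<le> norm (A w) * norm w"
      by (rule norm_cauchy_schwarz)
    also have "\<dots> \<le> (1 * k) * 1"
      using w k[of w] \<open>k > 0\<close> unfolding B_def
      by (intro mult_mono order_trans[OF k] mult_right_mono) auto
    finally show "A w \<bullet> w \<le> k"
      by simp
  qed
  have s_upper: "A w \<bullet> w \<le> s" if "w \<in> B" for w
    unfolding s_def by (rule cSUP_upper[OF that bdd])
  have s0: "0 \<le> s"
    using s_upper[OF \<open>0 \<in> B\<close>] by simp
  \<comment> \<open>Cauchy-Schwarz for the form, tested with the unit vector along A w, bounds the
    norm of A on the ball by the supremum of the form.\<close>
  have norm_A: "norm (A w) \<le> s" if w: "w \<in> B" for w
  proof (cases "A w = 0")
    case False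
    define u where "u = (1 / norm (A w)) *\<^sub>R A w"
    have u: "u \<in> B"
      using False w W A_W by (simp add: B_def u_def subspace_scale)
    have "norm (A w) = A w \<bullet> u"
      using False by (simp add: u_def power2_norm_eq_inner[symmetric] power2_eq_square)
    also have "\<dots> \<le> s"
    proof (rule power2_le_imp_le)
      have "(A w \<bullet> u)\<^sup>2 \<le> (A w \<bullet> w) * (A u \<bullet> u)"
        by (intro nonneg_form_Cauchy_Schwarz linear_axioms symmetric nonneg)
      also have "\<dots> \<le> s * s"
        using s0 by (intro mult_mono s_upper w u nonneg)
      finally show "(A w \<bullet> u)\<^sup>2 \<le> s\<^sup>2"
        by (simp add: power2_eq_square)
    qed (rule s0)
    finally show ?thesis .
  qed (simp add: s0)
  have "s = 0"
  proof (rule ccontr)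
    assume "s \<noteq> 0"
    with s0 have s_pos: "s > 0"
      by simp
    have "\<exists>w\<in>B. s - 1 / real (Suc n) < A w \<bullet> w" for n
    proof -
      have "s - 1 / real (Suc n) < s"
        by simp
      then show ?thesis
        using less_cSUP_iff[OF _ bdd] \<open>0 \<in> B\<close> unfolding s_def by blast
    qed
    then obtain w where w: "\<And>n. w n \<in> B" "\<And>n. s - 1 / real (Suc n) < A (w n) \<bullet> w n"
      by metis
    have AQ: "A (w n) \<in> Q" for n
      using image_Q w(1)[of n] by (auto simp: B_def)
    then obtain y r where r: "strict_mono r" and y: "(\<lambda>n. A (w (r n))) \<longlonglongrightarrow> y"
      using compact_Q[unfolded compact_def, rule_format, of "\<lambda>n. A (w n)"] AQ
      by (auto simp: comp_def)
    have form_lim: "(\<lambda>n. A (w (r n)) \<bullet> w (r n)) \<longlonglongrightarrow> s"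
    proof (rule LIMSEQ_subseq_LIMSEQ[OF _ r, unfolded comp_def])
      show "(\<lambda>n. A (w n) \<bullet> w n) \<longlonglongrightarrow> s"
      proof (rule tendsto_sandwich)
        show "(\<lambda>n. s - 1 / real (Suc n)) \<longlonglongrightarrow> s"
          using tendsto_diff[OF tendsto_const LIMSEQ_Suc[OF lim_1_over_n], of s] by simp
        show "(\<lambda>n. s) \<longlonglongrightarrow> s" by simp
      qed (use w s_upper in \<open>auto intro!: always_eventually less_imp_le simp del: of_nat_Suc\<close>)
    qed
    \<comment> \<open>As A w and w have norms at most s and 1, near-maximisers of the form are
      near-eigenvectors for s. Hence convergence of A w along the subsequence carries over to
      w.\<close>
    have "(\<lambda>n. (norm (A (w (r n)) - s *\<^sub>R w (r n)))\<^sup>2) \<longlonglongrightarrow> 0"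
    proof (rule tendsto_sandwich[where f = "\<lambda>_. 0"])
      show "\<forall>\<^sub>F n in sequentially. (norm (A (w (r n)) - s *\<^sub>R w (r n)))\<^sup>2
              \<le> 2 * s * (s - A (w (r n)) \<bullet> w (r n))"
      proof (intro always_eventually allI)
        fix n
        let ?w = "w (r n)"
        have "(norm (A ?w - s *\<^sub>R ?w))\<^sup>2 = (norm (A ?w))\<^sup>2 - 2 * s * (A ?w \<bullet> ?w) + s\<^sup>2 * (norm ?w)\<^sup>2"
          unfolding power2_norm_eq_inner
          by (simp add: inner_diff_left inner_diff_right inner_commute algebra_simps power2_eq_square)
        also have "\<dots> \<le> s\<^sup>2 - 2 * s * (A ?w \<bullet> ?w) + s\<^sup>2 * 1"
          using norm_A[OF w(1)] w(1)[of "r n"] s0 unfolding B_def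
          by (intro add_mono diff_mono mult_left_mono power_mono power_le_one order_refl) auto
        finally show "(norm (A ?w - s *\<^sub>R ?w))\<^sup>2 \<le> 2 * s * (s - A ?w \<bullet> ?w)"
          by (simp add: algebra_simps power2_eq_square)
      qed
      have "(\<lambda>n. 2 * s * (s - A (w (r n)) \<bullet> w (r n))) \<longlonglongrightarrow> 2 * s * (s - s)"
        by (intro tendsto_intros form_lim)
      then show "(\<lambda>n. 2 * s * (s - A (w (r n)) \<bullet> w (r n))) \<longlonglongrightarrow> 0"
        by simp
    qed auto
    then have "(\<lambda>n. A (w (r n)) - s *\<^sub>R w (r n)) \<longlonglongrightarrow> 0"
      using tendsto_norm_zero_cancel tendsto_real_sqrt[of "\<lambda>n. (norm (A (w (r n)) - s *\<^sub>R w (r n)))\<^sup>2" 0]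
      by fastforce
    from tendsto_diff[OF y this] have "(\<lambda>n. s *\<^sub>R w (r n)) \<longlonglongrightarrow> y"
      by simp
    from tendsto_scaleR[OF tendsto_const this, of "1 / s"]
    have lim: "(\<lambda>n. w (r n)) \<longlonglongrightarrow> (1 / s) *\<^sub>R y"
      using s_pos by simp
    define v where "v = (1 / s) *\<^sub>R y"
    have "(\<lambda>n. A (w (r n))) \<longlonglongrightarrow> A v"
      unfolding v_def by (rule tendsto[OF lim])
    then have "A v = y"
      using y LIMSEQ_unique by blast
    then have Av: "A v = s *\<^sub>R v"
      using s_pos by (simp add: v_def)
    have vW: "v \<in> W"
      unfolding v_def using closed_sequentially[OF closed_W _ lim] w(1) by (auto simp: B_def)
    have "(\<lambda>n. A (w (r n)) \<bullet> w (r n)) \<longlonglongrightarrow> y \<bullet> v"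
      unfolding v_def by (intro tendsto_inner y lim)
    then have "y \<bullet> v = s"
      using form_lim LIMSEQ_unique by blast
    moreover have "v = 0"
      using no_eigen vW Av by blast
    ultimately show False
      using s_pos by simp
  qed
  have xW: "x \<in> W"
    using x by (auto simp: W_def)
  show "x = 0"
  proof (cases "x = 0")
    case False
    define u where "u = (1 / norm x) *\<^sub>R x"
    have "u \<in> B"
      using False W xW by (simp add: u_def B_def subspace_scale)
    then have "A u = 0 *\<^sub>R u" "u \<in> W"
      using norm_A[of u] \<open>s = 0\<close> by (auto simp: B_def)
    then have "u = 0"
      using no_eigen by blast
    then show ?thesis
      using False by (simp add: u_def)
  qed
qed

section \<open>Spectral components and the functional calculus\<close>

abbreviation E :: "real \<Rightarrow> 'a \<Rightarrow> 'a" where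
  "E \<mu> \<equiv> orth_proj (eigenspace A \<mu>)"

lemma E_mem: "E \<mu> x \<in> eigenspace A \<mu>"
  by (intro orth_proj_props subspace_eigenspace closed_eigenspace)

lemma inner_E: "v \<in> eigenspace A \<mu> \<Longrightarrow> E \<mu> x \<bullet> v = x \<bullet> v"
  by (intro inner_orth_proj subspace_eigenspace closed_eigenspace)

lemma E_eqI: "p \<in> eigenspace A \<mu> \<Longrightarrow> (\<And>v. v \<in> eigenspace A \<mu> \<Longrightarrow> p \<bullet> v = x \<bullet> v) \<Longrightarrow> E \<mu> x = p"
  by (intro orth_proj_eqI_inner subspace_eigenspace)

lemma E_orthogonal: "\<mu> \<noteq> \<nu> \<Longrightarrow> E \<mu> x \<bullet> E \<nu> y = 0"
  by (rule eigenspace_orthogonal[OF E_mem E_mem])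

lemma E_add: "E \<mu> (x + y) = E \<mu> x + E \<mu> y"
  by (rule E_eqI) (simp_all add: subspace_add[OF subspace_eigenspace] E_mem inner_add_left inner_E)

lemma E_scaleR: "E \<mu> (r *\<^sub>R x) = r *\<^sub>R E \<mu> x"
  by (rule E_eqI) (simp_all add: subspace_scale[OF subspace_eigenspace] E_mem inner_E)

lemma E_A: "E \<mu> (A x) = \<mu> *\<^sub>R E \<mu> x"
  by (rule E_eqI)
    (simp_all add: subspace_scale[OF subspace_eigenspace] E_mem inner_E symmetric, simp add: eigenspace_def)

lemma bessel:
  assumes "finite G"
  shows "(\<Sum>\<mu>\<in>G. (norm (E \<mu> x))\<^sup>2) \<le> (norm x)\<^sup>2"
proof -
  define p where "p = (\<Sum>\<mu>\<in>G. E \<mu> x)"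
  have p: "(norm p)\<^sup>2 = (\<Sum>\<mu>\<in>G. (norm (E \<mu> x))\<^sup>2)"
    unfolding p_def using assms
    by (intro norm_sum_Pythagorean) (auto simp: pairwise_def orthogonal_def E_orthogonal)
  have "x \<bullet> p = (\<Sum>\<mu>\<in>G. (norm (E \<mu> x))\<^sup>2)"
    unfolding p_def inner_sum_right power2_norm_eq_inner
    by (rule sum.cong) (simp_all add: inner_E[OF E_mem])
  then have "(norm (x - p))\<^sup>2 = (norm x)\<^sup>2 - (norm p)\<^sup>2"
    using p by (simp add: power2_norm_eq_inner inner_diff_left inner_diff_right inner_commute)
  then show ?thesis
    using p by (smt (verit) zero_le_power2)
qed

lemma summable_E_norm: "(\<lambda>\<mu>. (norm (E \<mu> x))\<^sup>2) summable_on I"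
  by (intro nonneg_bdd_above_summable_on bdd_aboveI2[where M = "(norm x)\<^sup>2"] bessel) auto

lemma summable_fun_calc:
  assumes f: "\<And>\<mu>. \<mu> \<in> eigenvalues A \<Longrightarrow> \<bar>f \<mu>\<bar> \<le> k"
  shows "(\<lambda>\<mu>. f \<mu> *\<^sub>R E \<mu> x) summable_on eigenvalues A"
proof (rule summable_on_orthogonal)
  have sm: "(\<lambda>\<mu>. k\<^sup>2 * (norm (E \<mu> x))\<^sup>2) summable_on eigenvalues A"
    by (intro summable_on_cmult_right summable_E_norm)
  show "(\<lambda>\<mu>. (norm (f \<mu> *\<^sub>R E \<mu> x))\<^sup>2) summable_on eigenvalues A"
  proof (rule summable_on_comparison_test[OF sm])
    fix \<mu> assume "\<mu> \<in> eigenvalues A"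
    then have "(f \<mu>)\<^sup>2 \<le> k\<^sup>2"
      using f power_mono[of "\<bar>f \<mu>\<bar>" k 2] by simp
    then show "(norm (f \<mu> *\<^sub>R E \<mu> x))\<^sup>2 \<le> k\<^sup>2 * (norm (E \<mu> x))\<^sup>2"
      by (simp add: power_mult_distrib mult_right_mono)
  qed auto
qed (simp add: E_orthogonal)

lemma has_sum_fun_calc:
  assumes f: "\<And>\<mu>. \<mu> \<in> eigenvalues A \<Longrightarrow> \<bar>f \<mu>\<bar> \<le> k"
  shows "((\<lambda>\<mu>. f \<mu> *\<^sub>R E \<mu> x) has_sum fun_calc f A x) (eigenvalues A)"
  unfolding fun_calc_def using summable_fun_calc[OF f] by simp

lemma has_sum_norm_fun_calc:
  assumes f: "\<And>\<mu>. \<mu> \<in> eigenvalues A \<Longrightarrow> \<bar>f \<mu>\<bar> \<le> k"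
  shows "((\<lambda>\<mu>. (f \<mu>)\<^sup>2 * (norm (E \<mu> x))\<^sup>2) has_sum (norm (fun_calc f A x))\<^sup>2) (eigenvalues A)"
  using has_sum_orthogonal_norm[OF _ has_sum_fun_calc[OF f]]
  by (simp add: E_orthogonal power_mult_distrib)

lemma E_not_eigenvalue: "\<mu> \<notin> eigenvalues A \<Longrightarrow> E \<mu> x = 0"
  using E_mem[of \<mu> x] by (auto simp: eigenvalues_def eigenspace_def)

text \<open>Pairing the series with an eigenvector for \<nu> kills every term but that of \<nu>. If
  \<nu> is no eigenvalue, its eigenspace is trivial and both sides vanish.\<close>

lemma E_fun_calc:
  assumes f: "\<And>\<mu>. \<mu> \<in> eigenvalues A \<Longrightarrow> \<bar>f \<mu>\<bar> \<le> k"
  shows "E \<nu> (fun_calc f A x) = f \<nu> *\<^sub>R E \<nu> x"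
proof (rule E_eqI)
  show "f \<nu> *\<^sub>R E \<nu> x \<in> eigenspace A \<nu>"
    by (intro subspace_scale subspace_eigenspace E_mem)
  fix v assume v: "v \<in> eigenspace A \<nu>"
  show "f \<nu> *\<^sub>R E \<nu> x \<bullet> v = fun_calc f A x \<bullet> v"
  proof (cases "\<nu> \<in> eigenvalues A")
    case False
    then have "v = 0"
      using v by (auto simp: eigenvalues_def eigenspace_def)
    then show ?thesis
      by simp
  next
    case True
    have "((\<lambda>\<mu>. (f \<mu> *\<^sub>R E \<mu> x) \<bullet> v) has_sum fun_calc f A x \<bullet> v) (eigenvalues A)"
      by (rule has_sum_bounded_linear[OF bounded_linear_inner_left has_sum_fun_calc[OF f]])
    moreover have "((\<lambda>\<mu>. (f \<mu> *\<^sub>R E \<mu> x) \<bullet> v) has_sum (f \<nu> *\<^sub>R E \<nu> x) \<bullet> v) (eigenvalues A)"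
      using True eigenspace_orthogonal[OF E_mem v]
      by (intro has_sum_finite_neutralI[of "{\<nu>}"]) auto
    ultimately show ?thesis
      using has_sum_unique by blast
  qed
qed

text \<open>Totality of the eigenvectors in the form used below: identities between functions of
  \<open>A\<close> reduce to scalar identities on the spectrum.\<close>

lemma eq_if_E_eq:
  assumes "\<And>\<mu>. \<mu> \<in> eigenvalues A \<Longrightarrow> E \<mu> x = E \<mu> y"
  shows "x = y"
proof -
  have "x - y = 0"
  proof (rule eigenvectors_total)
    fix \<mu> v assume v: "v \<in> eigenspace A \<mu>"
    have "E \<mu> x = E \<mu> y"
      using assms E_not_eigenvalue by metis
    then show "(x - y) \<bullet> v = 0"
      by (metis inner_E[OF v] inner_diff_left right_minus_eq)
  qed
  then show ?thesis
    by simp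
qed

lemma fun_calc_add:
  assumes f: "\<And>\<mu>. \<mu> \<in> eigenvalues A \<Longrightarrow> \<bar>f \<mu>\<bar> \<le> k"
  shows "fun_calc f A (x + y) = fun_calc f A x + fun_calc f A y"
  by (rule eq_if_E_eq) (simp add: E_fun_calc[OF f] E_add scaleR_add_right)

lemma fun_calc_scaleR:
  assumes f: "\<And>\<mu>. \<mu> \<in> eigenvalues A \<Longrightarrow> \<bar>f \<mu>\<bar> \<le> k"
  shows "fun_calc f A (r *\<^sub>R x) = r *\<^sub>R fun_calc f A x"
  by (rule eq_if_E_eq) (simp add: E_fun_calc[OF f] E_scaleR)

lemma fun_calc_one: "fun_calc (\<lambda>_. 1) A x = x"
  by (rule eq_if_E_eq) (simp add: E_fun_calc[where k = 1])

text \<open>Parseval's identity, obtained from the calculus of the constant function 1. Together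
  with the series for the form it turns the norm estimates below into termwise comparisons.\<close>

lemma has_sum_norm: "((\<lambda>\<mu>. (norm (E \<mu> x))\<^sup>2) has_sum (norm x)\<^sup>2) (eigenvalues A)"
  using has_sum_norm_fun_calc[of "\<lambda>_. 1" 1 x] by (simp add: fun_calc_one)

lemma has_sum_form: "((\<lambda>\<mu>. \<mu> * (norm (E \<mu> x))\<^sup>2) has_sum A x \<bullet> x) (eigenvalues A)"
proof -
  have "((\<lambda>\<mu>. 1 *\<^sub>R E \<mu> x) has_sum x) (eigenvalues A)"
    using has_sum_fun_calc[of "\<lambda>_. 1" 1 x] by (simp add: fun_calc_one)
  from has_sum_bounded_linear[OF bounded_linear_inner_right[of "A x"] this]
  have "((\<lambda>\<mu>. A x \<bullet> E \<mu> x) has_sum A x \<bullet> x) (eigenvalues A)"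
    by simp
  moreover have "A x \<bullet> E \<mu> x = \<mu> * (norm (E \<mu> x))\<^sup>2" for \<mu>
  proof -
    have "A x \<bullet> E \<mu> x = E \<mu> (A x) \<bullet> E \<mu> x"
      by (rule inner_E[OF E_mem, symmetric])
    then show ?thesis
      by (simp add: E_A power2_norm_eq_inner)
  qed
  ultimately show ?thesis
    by simp
qed

lemma norm_fun_calc_le:
  assumes f: "\<And>\<mu>. \<mu> \<in> eigenvalues A \<Longrightarrow> \<bar>f \<mu>\<bar> \<le> k"
  shows "norm (fun_calc f A x) \<le> \<bar>k\<bar> * norm x"
proof -
  have "(norm (fun_calc f A x))\<^sup>2 \<le> k\<^sup>2 * (norm x)\<^sup>2"
  proof (rule has_sum_mono[OF has_sum_norm_fun_calc[OF f] has_sum_cmult_right[OF has_sum_norm]])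
    fix \<mu> assume "\<mu> \<in> eigenvalues A"
    then show "(f \<mu>)\<^sup>2 * (norm (E \<mu> x))\<^sup>2 \<le> k\<^sup>2 * (norm (E \<mu> x))\<^sup>2"
      using f[of \<mu>] power_mono[of "\<bar>f \<mu>\<bar>" k 2] by (auto intro: mult_right_mono)
  qed
  then show ?thesis
    by (simp add: power_mult_distrib[symmetric] abs_le_square_iff[symmetric] abs_mult)
qed

lemma bounded_linear_fun_calc:
  assumes f: "\<And>\<mu>. \<mu> \<in> eigenvalues A \<Longrightarrow> \<bar>f \<mu>\<bar> \<le> k"
  shows "bounded_linear (fun_calc f A)"
  by (rule bounded_linear_intro[where K = "\<bar>k\<bar>"])
    (simp_all add: fun_calc_add[OF f] fun_calc_scaleR[OF f] norm_fun_calc_le[OF f] mult.commute)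

end

section \<open>Filter regularisation with the discrepancy principle\<close>

text \<open>Estimates for general data y are reduced to y = K x, where both sides expand in
  eigenvectors of K^* K; a decomposition of K K^* is thereby avoided.\<close>

lemma le_on_closure_of_range:
  fixes f g :: "'b::topological_space \<Rightarrow> real"
  assumes "closure (range K) = UNIV" "continuous_on UNIV f" "continuous_on UNIV g"
    and "\<And>x. f (K x) \<le> g (K x)"
  shows "f y \<le> g y"
proof -
  have "closure (range K) \<subseteq> {y. f y \<le> g y}"
    using assms by (intro closure_minimal closed_Collect_le) auto
  then show ?thesis
    using assms(1) by blast
qed

locale injective_compact_operator =
  fixes K :: "'x::{real_inner, complete_space} \<Rightarrow> 'y::{real_inner, complete_space}"
  assumes compact_K: "compact_operator K" and inj_K: "inj K"
    and dense_range: "closure (range K) = UNIV"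
begin

abbreviation A :: "'x \<Rightarrow> 'x" where
  "A \<equiv> adjoint K \<circ> K"

lemma bounded_linear_K: "bounded_linear K"
  using compact_K by (simp add: compact_operator_def)

lemma form_A: "A x \<bullet> x = (norm (K x))\<^sup>2"
  by (simp add: inner_adjoint[OF bounded_linear_K, symmetric] inner_commute power2_norm_eq_inner)

sublocale compact_positive_operator A "adjoint K ` closure (K ` cball 0 1)"
proof (rule compact_positive_operator.intro)
  note bl = bounded_linear_adjoint[OF bounded_linear_K]
  show "bounded_linear A"
    using bounded_linear_compose[OF bl bounded_linear_K] by (simp add: comp_def)
  show "A x \<bullet> y = x \<bullet> A y" for x y
    by (metis comp_apply inner_adjoint[OF bounded_linear_K] inner_commute)
  show "0 \<le> A x \<bullet> x" for x
    by (simp only: form_A zero_le_power2)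
  show "compact (adjoint K ` closure (K ` cball 0 1))"
    using compact_K
    by (intro compact_continuous_image linear_continuous_on bl) (simp add: compact_operator_def)
  show "A ` cball 0 1 \<subseteq> adjoint K ` closure (K ` cball 0 1)"
    unfolding image_comp[symmetric] by (intro image_mono closure_subset)
qed

text \<open>Injectivity of K excludes 0. The spectrum thus lies in the half-open interval on which
  the filter estimates are stated.\<close>

lemma eigenvalue_bounds:
  assumes "\<mu> \<in> eigenvalues A"
  shows "0 < \<mu>" "\<mu> \<le> (onorm K)\<^sup>2"
proof -
  obtain v where v: "v \<noteq> 0" "A v = \<mu> *\<^sub>R v"
    using assms by (auto simp: eigenvalues_def)
  have eq: "\<mu> * (norm v)\<^sup>2 = (norm (K v))\<^sup>2"
    using form_A[of v] v by (simp add: power2_norm_eq_inner)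
  have "K v \<noteq> 0"
    using inj_K v bounded_linear_K by (metis injD linear_simps(3))
  then show "0 < \<mu>"
    using eq v by (metis norm_eq_zero zero_less_mult_pos2 zero_less_power2)
  have "\<mu> * (norm v)\<^sup>2 \<le> (onorm K * norm v)\<^sup>2"
    unfolding eq by (intro power_mono onorm bounded_linear_K) auto
  then show "\<mu> \<le> (onorm K)\<^sup>2"
    using v by (simp add: power_mult_distrib)
qed

lemma eigenvalue_interval: "\<mu> \<in> eigenvalues A \<Longrightarrow> \<mu> \<in> {0<..(onorm K)\<^sup>2}"
  using eigenvalue_bounds by simp

lemma has_sum_norm_K: "((\<lambda>\<mu>. \<mu> * (norm (E \<mu> x))\<^sup>2) has_sum (norm (K x))\<^sup>2) (eigenvalues A)"
  using has_sum_form[of x] by (simp only: form_A)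

text \<open>Zero is not an eigenvalue of \<open>A\<close>, so the spectral mass near zero can be made small.\<close>

lemma small_spectral_tail:
  assumes "\<epsilon> > 0"
  obtains s T where "s > 0" "T \<le> \<epsilon>"
    "((\<lambda>\<mu>. if \<mu> < s then (norm (E \<mu> x))\<^sup>2 else 0) has_sum T) (eigenvalues A)"
proof -
  define a where "a \<mu> = (norm (E \<mu> x))\<^sup>2" for \<mu>
  have a: "(a has_sum (norm x)\<^sup>2) (eigenvalues A)"
    using has_sum_norm[of x] by (simp add: a_def[abs_def])
  have "eventually (\<lambda>G. dist (sum a G) ((norm x)\<^sup>2) < \<epsilon>) (finite_subsets_at_top (eigenvalues A))"
    using a assms unfolding has_sum_def by (intro tendstoD)
  then obtain G where G: "finite G" "G \<subseteq> eigenvalues A" "dist (sum a G) ((norm x)\<^sup>2) < \<epsilon>"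
    by (auto simp: eventually_finite_subsets_at_top)
  \<comment> \<open>The finite set \<open>G\<close> carries all but \<epsilon> of the mass and has
    no element below \<open>s\<close>, so the mass below \<open>s\<close> lies outside
    \<open>G\<close>. The 1 covers empty \<open>G\<close>.\<close>
  define s where "s = Min (insert 1 G)"
  have s: "s > 0" "\<And>\<mu>. \<mu> \<in> G \<Longrightarrow> s \<le> \<mu>"
    using G eigenvalue_bounds(1) by (auto simp: s_def)
  have le: "0 \<le> (if \<mu> < s then a \<mu> else 0)" "(if \<mu> < s then a \<mu> else 0) \<le> a \<mu> - (if \<mu> \<in> G then a \<mu> else 0)" for \<mu>
    using s(2)[of \<mu>] by (auto simp: a_def)
  have diff: "((\<lambda>\<mu>. a \<mu> - (if \<mu> \<in> G then a \<mu> else 0)) has_sum (norm x)\<^sup>2 - sum a G) (eigenvalues A)"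
  proof -
    have "((\<lambda>\<mu>. if \<mu> \<in> G then a \<mu> else 0) has_sum sum a G) (eigenvalues A)"
      using G by (intro has_sum_finite_neutralI[of G]) auto
    from has_sum_add[OF a has_sum_uminusI[OF this]] show ?thesis
      by simp
  qed
  have sm: "(\<lambda>\<mu>. if \<mu> < s then a \<mu> else 0) summable_on eigenvalues A"
    by (rule summable_on_comparison_test[OF has_sum_imp_summable[OF a]]) (use le in \<open>auto simp: a_def\<close>)
  then obtain T where T: "((\<lambda>\<mu>. if \<mu> < s then a \<mu> else 0) has_sum T) (eigenvalues A)"
    by (auto simp: summable_on_def)
  have "T \<le> (norm x)\<^sup>2 - sum a G"
    by (rule has_sum_mono[OF T diff le(2)])
  then have "T \<le> \<epsilon>"
    using G(3) by (simp add: dist_real_def)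
  then show thesis
    using that[of s T] s(1) T unfolding a_def by blast
qed

end

text \<open>Here \<open>\<kappa>\<close> is the level of the whole data error in units of \<delta>,
  discretisation included; the final proof puts 1 + \<kappa> in its place. The condition on it
  leaves a gap between the threshold and the data error amplified by \<open>C0\<close>.\<close>

locale discrepancy_regularisation = injective_compact_operator K
  for K :: "'x::{real_inner, complete_space} \<Rightarrow> 'y::{real_inner, complete_space}" +
  fixes F :: "real \<Rightarrow> real \<Rightarrow> real" and C0 C\<^sub>R C\<^sub>F q \<tau> \<kappa> :: real
  assumes rate0: "rate_const ((onorm K)\<^sup>2) F 0 C0" and C0_nonneg: "0 \<le> C0"
    and C\<^sub>R: "\<And>\<alpha> t. 0 < \<alpha> \<Longrightarrow> t \<in> {0<..(onorm K)\<^sup>2} \<Longrightarrow> t * \<bar>F \<alpha> t\<bar> \<le> C\<^sub>R" and C\<^sub>R_nonneg: "0 \<le> C\<^sub>R"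
    and C\<^sub>F: "\<And>\<alpha> t. 0 < \<alpha> \<Longrightarrow> t \<in> {0<..(onorm K)\<^sup>2} \<Longrightarrow> \<bar>F \<alpha> t\<bar> \<le> C\<^sub>F / \<alpha>" and C\<^sub>F_nonneg: "0 \<le> C\<^sub>F"
    and q: "0 < q" "q < 1" and \<kappa>: "0 < \<kappa>" "C0 * \<kappa> < 2 * \<tau>"
begin

section \<open>Residuals and norm bounds of the filter\<close>

abbreviation R :: "real \<Rightarrow> 'y \<Rightarrow> 'x" where
  "R \<alpha> \<equiv> regop K (F \<alpha>)"

abbreviation res :: "real \<Rightarrow> 'x \<Rightarrow> 'x" where
  "res \<alpha> \<equiv> fun_calc (\<lambda>t. 1 - F \<alpha> t * t) A"

lemma F_bound: "0 < \<alpha> \<Longrightarrow> \<mu> \<in> eigenvalues A \<Longrightarrow> \<bar>F \<alpha> \<mu>\<bar> \<le> C\<^sub>F / \<alpha>"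
  using C\<^sub>F eigenvalue_interval by blast

lemma res_bound: "0 < \<alpha> \<Longrightarrow> \<mu> \<in> eigenvalues A \<Longrightarrow> \<bar>1 - F \<alpha> \<mu> * \<mu>\<bar> \<le> C0"
  using rate0 eigenvalue_bounds[of \<mu>] by (auto simp: rate_const_def)

lemma res_bound_squared:
  assumes "0 < \<alpha>" "\<mu> \<in> eigenvalues A"
  shows "(1 - F \<alpha> \<mu> * \<mu>)\<^sup>2 \<le> C0\<^sup>2"
  using power_mono[OF res_bound[OF assms], of 2] by simp

lemma rate_squared:
  assumes "rate_const ((onorm K)\<^sup>2) F \<nu> C" "0 < \<alpha>" "\<mu> \<in> eigenvalues A"
  shows "\<mu> powr \<nu> * (1 - F \<alpha> \<mu> * \<mu>)\<^sup>2 \<le> C\<^sup>2 * \<alpha> powr \<nu>"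
proof -
  have half: "(t powr (\<nu> / 2))\<^sup>2 = t powr \<nu>" for t :: real
    by (simp add: power2_eq_square powr_add[symmetric])
  have "\<mu> powr (\<nu> / 2) * \<bar>1 - F \<alpha> \<mu> * \<mu>\<bar> \<le> C * \<alpha> powr (\<nu> / 2)"
    using assms eigenvalue_interval unfolding rate_const_def by blast
  then have "(\<mu> powr (\<nu> / 2) * \<bar>1 - F \<alpha> \<mu> * \<mu>\<bar>)\<^sup>2 \<le> (C * \<alpha> powr (\<nu> / 2))\<^sup>2"
    by (intro power_mono) auto
  then show ?thesis
    by (simp add: power_mult_distrib half)
qed

lemma bounded_linear_R: "0 < \<alpha> \<Longrightarrow> bounded_linear (R \<alpha>)"
  unfolding regop_def
  by (intro bounded_linear_compose[OF bounded_linear_fun_calc bounded_linear_adjoint[OF bounded_linear_K]])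
    (rule F_bound)

lemma R_K: "0 < \<alpha> \<Longrightarrow> R \<alpha> (K x) = x - res \<alpha> x"
proof -
  assume \<alpha>: "0 < \<alpha>"
  have eq: "R \<alpha> (K x) + res \<alpha> x = x"
  proof (rule eq_if_E_eq)
    fix \<mu> assume "\<mu> \<in> eigenvalues A"
    have "E \<mu> (R \<alpha> (K x)) = F \<alpha> \<mu> *\<^sub>R E \<mu> (A x)"
      unfolding regop_def using E_fun_calc[OF F_bound[OF \<alpha>]] by simp
    also have "\<dots> = (F \<alpha> \<mu> * \<mu>) *\<^sub>R E \<mu> x"
      unfolding E_A by simp
    moreover have "E \<mu> (res \<alpha> x) = (1 - F \<alpha> \<mu> * \<mu>) *\<^sub>R E \<mu> x"
      by (rule E_fun_calc[OF res_bound[OF \<alpha>]])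
    ultimately show "E \<mu> (R \<alpha> (K x) + res \<alpha> x) = E \<mu> x"
      by (simp add: E_add scaleR_diff_left)
  qed
  then show ?thesis
    by (metis add_diff_cancel_right')
qed

lemma has_sum_norm_res:
  "0 < \<alpha> \<Longrightarrow> ((\<lambda>\<mu>. (1 - F \<alpha> \<mu> * \<mu>)\<^sup>2 * (norm (E \<mu> x))\<^sup>2) has_sum (norm (res \<alpha> x))\<^sup>2) (eigenvalues A)"
  by (rule has_sum_norm_fun_calc[OF res_bound])

lemma has_sum_norm_K_res:
  assumes "0 < \<alpha>"
  shows "((\<lambda>\<mu>. \<mu> * (1 - F \<alpha> \<mu> * \<mu>)\<^sup>2 * (norm (E \<mu> x))\<^sup>2) has_sum (norm (K (res \<alpha> x)))\<^sup>2) (eigenvalues A)"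
  using has_sum_norm_K[of "res \<alpha> x"]
  by (simp add: E_fun_calc[OF res_bound[OF assms]] power_mult_distrib mult.assoc)

lemma norm_residual_le:
  assumes \<alpha>: "0 < \<alpha>"
  shows "norm (y - K (R \<alpha> y)) \<le> C0 * norm y"
proof (rule le_on_closure_of_range[OF dense_range])
  note bl = bounded_linear_compose[OF bounded_linear_K bounded_linear_R[OF \<alpha>]]
  show "continuous_on UNIV (\<lambda>y. norm (y - K (R \<alpha> y)))"
    by (intro continuous_intros linear_continuous_on bl)
  show "continuous_on UNIV (\<lambda>y::'y. C0 * norm y)"
    by (intro continuous_intros)
  fix x
  have "K x - K (R \<alpha> (K x)) = K (res \<alpha> x)"
    by (simp add: R_K[OF \<alpha>] linear_simps[OF bounded_linear_K])
  moreover have "(norm (K (res \<alpha> x)))\<^sup>2 \<le> C0\<^sup>2 * (norm (K x))\<^sup>2"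
  proof (rule has_sum_mono[OF has_sum_norm_K_res[OF \<alpha>] has_sum_cmult_right[OF has_sum_norm_K]])
    fix \<mu> assume \<mu>: "\<mu> \<in> eigenvalues A"
    have "(1 - F \<alpha> \<mu> * \<mu>)\<^sup>2 * (\<mu> * (norm (E \<mu> x))\<^sup>2) \<le> C0\<^sup>2 * (\<mu> * (norm (E \<mu> x))\<^sup>2)"
      using eigenvalue_bounds(1)[OF \<mu>] by (intro mult_right_mono res_bound_squared \<alpha> \<mu>) auto
    then show "\<mu> * (1 - F \<alpha> \<mu> * \<mu>)\<^sup>2 * (norm (E \<mu> x))\<^sup>2 \<le> C0\<^sup>2 * (\<mu> * (norm (E \<mu> x))\<^sup>2)"
      by (simp add: mult_ac)
  qed
  ultimately show "norm (K x - K (R \<alpha> (K x))) \<le> C0 * norm (K x)"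
    by - (rule power2_le_imp_le, simp_all add: power_mult_distrib C0_nonneg)
qed

lemma norm_R_le:
  assumes \<alpha>: "0 < \<alpha>"
  shows "norm (R \<alpha> y) \<le> sqrt (C\<^sub>R * C\<^sub>F / \<alpha>) * norm y"
proof (rule le_on_closure_of_range[OF dense_range])
  show "continuous_on UNIV (\<lambda>y. norm (R \<alpha> y))"
    by (intro continuous_intros linear_continuous_on bounded_linear_R[OF \<alpha>])
  show "continuous_on UNIV (\<lambda>y::'y. sqrt (C\<^sub>R * C\<^sub>F / \<alpha>) * norm y)"
    by (intro continuous_intros)
  fix x
  have nn: "0 \<le> C\<^sub>R * C\<^sub>F / \<alpha>"
    using C\<^sub>R_nonneg C\<^sub>F_nonneg \<alpha> by simp
  have "(norm (R \<alpha> (K x)))\<^sup>2 \<le> (C\<^sub>R * C\<^sub>F / \<alpha>) * (norm (K x))\<^sup>2"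
    unfolding regop_def
  proof (rule has_sum_mono[OF has_sum_norm_fun_calc[OF F_bound[OF \<alpha>]] has_sum_cmult_right[OF has_sum_norm_K]])
    fix \<mu> assume \<mu>: "\<mu> \<in> eigenvalues A"
    note \<mu>' = eigenvalue_bounds(1)[OF \<mu>]
    \<comment> \<open>One factor F is bounded through \<open>C\<^sub>R\<close> and the other through
      \<open>C\<^sub>F\<close>; hence the growth of order 1 / sqrt \<alpha> instead of 1 /
      \<alpha>.\<close>
    have "(\<mu> * \<bar>F \<alpha> \<mu>\<bar>) * \<bar>F \<alpha> \<mu>\<bar> \<le> C\<^sub>R * (C\<^sub>F / \<alpha>)"
      using \<mu>' C\<^sub>R_nonneg by (intro mult_mono C\<^sub>R F_bound \<alpha> \<mu> eigenvalue_interval) auto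
    then have "(F \<alpha> \<mu>)\<^sup>2 * \<mu> \<le> C\<^sub>R * C\<^sub>F / \<alpha>"
      by (simp add: power2_eq_square mult_ac abs_mult_self_eq flip: abs_mult)
    then have "((F \<alpha> \<mu>)\<^sup>2 * \<mu>) * (\<mu> * (norm (E \<mu> x))\<^sup>2) \<le> (C\<^sub>R * C\<^sub>F / \<alpha>) * (\<mu> * (norm (E \<mu> x))\<^sup>2)"
      using \<mu>' by (intro mult_right_mono) auto
    moreover have "E \<mu> (adjoint K (K x)) = \<mu> *\<^sub>R E \<mu> x"
      using E_A[of \<mu> x] by simp
    ultimately show "(F \<alpha> \<mu>)\<^sup>2 * (norm (E \<mu> (adjoint K (K x))))\<^sup>2 \<le> (C\<^sub>R * C\<^sub>F / \<alpha>) * (\<mu> * (norm (E \<mu> x))\<^sup>2)"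
      by (simp add: power_mult_distrib power2_eq_square mult_ac)
  qed
  then show "norm (R \<alpha> (K x)) \<le> sqrt (C\<^sub>R * C\<^sub>F / \<alpha>) * norm (K x)"
    using nn by - (rule power2_le_imp_le, simp_all add: power_mult_distrib)
qed

abbreviation est :: "real \<Rightarrow> 'y \<Rightarrow> 'x" where
  "est \<equiv> discrepancy_estimate K F q \<tau>"

text \<open>The squared noise bound \<open>C\<^sub>R * C\<^sub>F / \<alpha> * (\<kappa> *
  \<delta>)\<^sup>2\<close> equals this constant times \<delta>^2 / \<beta> with \<beta> = \<alpha>
  / q. The factor 1 / q refers it to the last rejected parameter \<beta>, where the residual is
  bounded below.\<close>

definition noise_const :: real where
  "noise_const = C\<^sub>R * C\<^sub>F * \<kappa>\<^sup>2 / q"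

lemma noise_const_nonneg: "0 \<le> noise_const"
  using C\<^sub>R_nonneg C\<^sub>F_nonneg q by (simp add: noise_const_def)

text \<open>All that is used of the stopping rule. The discrepancy of z differs from that of the
  exact data by at most C0 \<kappa> \<delta>, so acceptance at \<alpha> and rejection at \<alpha> /
  q become an upper and a lower bound for the exact residual. The case \<alpha> = 1 is k = 0, before
  which nothing was rejected.\<close>

lemma discrepancy_step:
  assumes rate1: "rate_const ((onorm K)\<^sup>2) F 1 C1"
    and \<delta>: "0 < \<delta>" and z: "norm (z - K x) \<le> \<kappa> * \<delta>"
  obtains \<alpha> where "0 < \<alpha>"
    "norm (K (res \<alpha> x)) \<le> (2 * \<tau> + C0 * \<kappa>) * \<delta>"
    "norm (est \<delta> z - x) \<le> norm (res \<alpha> x) + sqrt (noise_const * (q * (\<delta>\<^sup>2 / \<alpha>)))"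
    "\<alpha> = 1 \<or> (2 * \<tau> - C0 * \<kappa>) * \<delta> \<le> norm (K (res (\<alpha> / q) x))"
proof -
  define k where "k = (LEAST k. norm (K (R (q ^ k) z) - z) \<le> 2 * \<tau> * \<delta>)"
  have res_z: "norm (K (R \<alpha> z) - z - (- K (res \<alpha> x))) \<le> C0 * \<kappa> * \<delta>" if \<alpha>: "0 < \<alpha>" for \<alpha>
  proof -
    have "K (R \<alpha> z) - z - (- K (res \<alpha> x)) = - ((z - K x) - K (R \<alpha> (z - K x)))"
      by (simp add: linear_simps[OF bounded_linear_K] linear_simps[OF bounded_linear_R[OF \<alpha>]] R_K[OF \<alpha>])
    then have "norm (K (R \<alpha> z) - z - (- K (res \<alpha> x))) \<le> C0 * norm (z - K x)"
      using norm_residual_le[OF \<alpha>, of "z - K x"] by (simp only: norm_minus_cancel)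
    also have "\<dots> \<le> C0 * (\<kappa> * \<delta>)"
      by (intro mult_left_mono z C0_nonneg)
    finally show ?thesis
      by simp
  qed
  have upper: "norm (K (R \<alpha> z) - z) \<le> C0 * \<kappa> * \<delta> + norm (K (res \<alpha> x))" if \<alpha>: "0 < \<alpha>" for \<alpha>
    using res_z[OF \<alpha>] norm_triangle_ineq2[of "K (R \<alpha> z) - z" "- K (res \<alpha> x)"] by simp
  have lower: "norm (K (res \<alpha> x)) \<le> C0 * \<kappa> * \<delta> + norm (K (R \<alpha> z) - z)" if \<alpha>: "0 < \<alpha>" for \<alpha>
    using res_z[OF \<alpha>] norm_triangle_ineq3[of "K (R \<alpha> z) - z" "- K (res \<alpha> x)"] by simp
  \<comment> \<open>The factor K contributes the weight \<mu> that the rate with exponent 1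
    requires; so the exact residual tends to 0 with \<alpha>, without any smoothness of x.\<close>
  have K_res: "norm (K (res \<alpha> x)) \<le> \<bar>C1\<bar> * sqrt \<alpha> * norm x" if \<alpha>: "0 < \<alpha>" for \<alpha>
  proof (rule power2_le_imp_le)
    have "(norm (K (res \<alpha> x)))\<^sup>2 \<le> (C1\<^sup>2 * \<alpha>) * (norm x)\<^sup>2"
    proof (rule has_sum_mono[OF has_sum_norm_K_res[OF \<alpha>] has_sum_cmult_right[OF has_sum_norm]])
      fix \<mu> assume \<mu>: "\<mu> \<in> eigenvalues A"
      show "\<mu> * (1 - F \<alpha> \<mu> * \<mu>)\<^sup>2 * (norm (E \<mu> x))\<^sup>2 \<le> C1\<^sup>2 * \<alpha> * (norm (E \<mu> x))\<^sup>2"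
        using rate_squared[OF rate1 \<alpha> \<mu>] eigenvalue_bounds(1)[OF \<mu>] \<alpha>
        by (intro mult_right_mono) auto
    qed
    then show "(norm (K (res \<alpha> x)))\<^sup>2 \<le> (\<bar>C1\<bar> * sqrt \<alpha> * norm x)\<^sup>2"
      using \<alpha> by (simp add: power_mult_distrib)
  qed (use \<alpha> in auto)
  \<comment> \<open>Some index is accepted, so \<open>LEAST\<close> is meaningful: the exact
    residual eventually falls below the gap between 2 \<tau> \<delta> and C0 \<kappa>
    \<delta>.\<close>
  have "\<exists>k. norm (K (R (q ^ k) z) - z) \<le> 2 * \<tau> * \<delta>"
  proof -
    have "(\<lambda>k. \<bar>C1\<bar> * sqrt (q ^ k) * norm x) \<longlonglongrightarrow> \<bar>C1\<bar> * sqrt 0 * norm x"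
      using q by (intro tendsto_intros LIMSEQ_realpow_zero) auto
    moreover have "0 < (2 * \<tau> - C0 * \<kappa>) * \<delta>"
      using \<kappa> \<delta> by simp
    ultimately have "\<forall>\<^sub>F k in sequentially. \<bar>C1\<bar> * sqrt (q ^ k) * norm x < (2 * \<tau> - C0 * \<kappa>) * \<delta>"
      by (intro order_tendstoD) auto
    then obtain k where "\<bar>C1\<bar> * sqrt (q ^ k) * norm x < (2 * \<tau> - C0 * \<kappa>) * \<delta>"
      by (auto simp: eventually_sequentially)
    then show ?thesis
      using upper[of "q ^ k"] K_res[of "q ^ k"] q by (intro exI[of _ k]) (simp add: algebra_simps)
  qed
  then have k: "norm (K (R (q ^ k) z) - z) \<le> 2 * \<tau> * \<delta>"
    unfolding k_def by (rule LeastI_ex)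
  have \<alpha>: "0 < q ^ k"
    using q by simp
  show thesis
  proof (rule that[OF \<alpha>])
    show "norm (K (res (q ^ k) x)) \<le> (2 * \<tau> + C0 * \<kappa>) * \<delta>"
      using lower[OF \<alpha>] k by (simp add: algebra_simps)
    have "est \<delta> z = R (q ^ k) z"
      by (simp add: discrepancy_estimate_def discrepancy_param_def k_def)
    then have "est \<delta> z - x = R (q ^ k) (z - K x) - res (q ^ k) x"
      by (simp add: linear_simps[OF bounded_linear_R[OF \<alpha>]] R_K[OF \<alpha>])
    then have "norm (est \<delta> z - x) \<le> norm (R (q ^ k) (z - K x)) + norm (res (q ^ k) x)"
      using norm_triangle_ineq4 by metis
    also have "norm (R (q ^ k) (z - K x)) \<le> sqrt (C\<^sub>R * C\<^sub>F / q ^ k) * (\<kappa> * \<delta>)"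
      using C\<^sub>R_nonneg C\<^sub>F_nonneg q
      by (intro order_trans[OF norm_R_le[OF \<alpha>]] mult_left_mono z) auto
    also have "\<dots> = sqrt (noise_const * (q * (\<delta>\<^sup>2 / q ^ k)))"
      using q \<kappa> \<delta> by (simp add: noise_const_def real_sqrt_mult real_sqrt_divide)
    finally show "norm (est \<delta> z - x) \<le> norm (res (q ^ k) x) + sqrt (noise_const * (q * (\<delta>\<^sup>2 / q ^ k)))"
      by (simp only: add.commute)
    show "q ^ k = 1 \<or> (2 * \<tau> - C0 * \<kappa>) * \<delta> \<le> norm (K (res (q ^ k / q) x))"
    proof (cases k)
      case (Suc k')
      then have "\<not> norm (K (R (q ^ k') z) - z) \<le> 2 * \<tau> * \<delta>"
        using not_less_Least[of k' "\<lambda>k. norm (K (R (q ^ k) z) - z) \<le> 2 * \<tau> * \<delta>"] unfolding k_def by simp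
      then show ?thesis
        using upper[of "q ^ k'"] q Suc by (auto simp: algebra_simps)
    qed simp
  qed
qed

text \<open>Without smoothness of x, the spectral mass T below a threshold s is the small quantity.
  For the approximation error, components above s are recovered from the K-residual at the cost of 1
  / s. For the noise, the lower bound on the residual at \<beta> bounds \<delta>^2 / \<beta> by a
  multiple of T plus a multiple of \<beta>^\<nu>, which is small for small \<beta>; for other
  \<beta> it is small because \<delta> is. The threshold s is fixed before \<delta>.\<close>

theorem discrepancy_convergence:
  assumes rate1: "rate_const ((onorm K)\<^sup>2) F 1 C1"
    and rate2: "rate_const ((onorm K)\<^sup>2) F (1 + \<nu>) C2" and \<nu>: "0 < \<nu>" and \<epsilon>: "0 < \<epsilon>"
  obtains \<delta>0 where "0 < \<delta>0"
    "\<And>\<delta> z. 0 < \<delta> \<Longrightarrow> \<delta> \<le> \<delta>0 \<Longrightarrow> norm (z - K x) \<le> \<kappa> * \<delta> \<Longrightarrow> norm (est \<delta> z - x) < \<epsilon>"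
proof -
  define H \<theta> where "H = 2 * \<tau> + C0 * \<kappa>" and "\<theta> = 2 * \<tau> - C0 * \<kappa>"
  have \<theta>: "\<theta> > 0"
    using \<kappa> by (simp add: \<theta>_def)
  \<comment> \<open>The square of \<epsilon> / 4: approximation error and noise are each at most
    \<epsilon> / 4, which leaves room for a strict inequality.\<close>
  define e where "e = \<epsilon>\<^sup>2 / 16"
  have e: "e > 0"
    using \<epsilon> by (simp add: e_def)
  define N where "N = noise_const"
  have N: "N \<ge> 0"
    by (simp add: N_def noise_const_nonneg)
  \<comment> \<open>Dominates both coefficients with which T will enter, C0^2 in the approximation
    error and the other one in the noise, so that each product is at most e / 2.\<close>
  define c where "c = C0\<^sup>2 + N * C1\<^sup>2 / \<theta>\<^sup>2 + 1"
  have c: "c > 0"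
    using N by (auto simp: c_def intro!: add_nonneg_pos add_nonneg_nonneg)
  obtain s T where s: "s > 0" and T: "T \<le> e / (2 * c)"
    and tail: "((\<lambda>\<mu>. if \<mu> < s then (norm (E \<mu> x))\<^sup>2 else 0) has_sum T) (eigenvalues A)"
    using small_spectral_tail[of "e / (2 * c)" x] e c by auto
  have T0: "0 \<le> T"
    by (rule has_sum_nonneg[OF tail]) auto
  have cT: "c * T \<le> e / 2"
    using T c by (simp add: field_simps)
  have C0T: "C0\<^sup>2 * T \<le> e / 2" and C1T: "N * C1\<^sup>2 / \<theta>\<^sup>2 * T \<le> e / 2"
  proof -
    have "0 \<le> N * C1\<^sup>2 / \<theta>\<^sup>2"
      using N by simp
    then have "C0\<^sup>2 * T \<le> c * T" "N * C1\<^sup>2 / \<theta>\<^sup>2 * T \<le> c * T"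
      unfolding c_def using T0 by (intro mult_right_mono; simp)+
    then show "C0\<^sup>2 * T \<le> e / 2" "N * C1\<^sup>2 / \<theta>\<^sup>2 * T \<le> e / 2"
      using cT by linarith+
  qed
  define B where "B = N * (C2\<^sup>2 * s powr (- \<nu>) * (norm x)\<^sup>2) / \<theta>\<^sup>2"
  have B: "B \<ge> 0"
    using N by (simp add: B_def)
  \<comment> \<open>The threshold below which the term B \<beta>^\<nu> of the noise is at most e /
    2; B + 1 avoids division by zero.\<close>
  define a where "a = (e / (2 * (B + 1))) powr (1 / \<nu>)"
  have a: "a > 0"
    using e B by (simp add: a_def)
  have a_powr: "B * \<alpha> powr \<nu> \<le> e / 2" if "0 < \<alpha>" "\<alpha> \<le> a" for \<alpha>
  proof -
    have "\<alpha> powr \<nu> \<le> a powr \<nu>"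
      using that \<nu> by (intro powr_mono2) auto
    also have "a powr \<nu> = e / (2 * (B + 1))"
      using e B \<nu> by (simp add: a_def powr_powr)
    finally have "B * \<alpha> powr \<nu> \<le> B * (e / (2 * (B + 1)))"
      using B by (rule mult_left_mono)
    also have "\<dots> \<le> e / 2"
      using B e by (simp add: field_simps)
    finally show ?thesis .
  qed
  \<comment> \<open>A real constant, not a dimension: it dominates the three coefficients of
    \<delta>^2 below, one for the approximation error and two for the noise, at \<alpha> = 1 and at
    \<beta> > a.\<close>
  define m where "m = H\<^sup>2 / s + N + N / a + 1"
  have m: "m > 0"
    using s N a by (auto simp: m_def intro!: add_nonneg_pos add_nonneg_nonneg)
  define \<delta>0 where "\<delta>0 = sqrt (e / (2 * m))"
  have \<delta>0: "\<delta>0 > 0"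
    using e m by (simp add: \<delta>0_def)
  show thesis
  proof (rule that[OF \<delta>0])
    fix \<delta> z assume \<delta>: "0 < \<delta>" "\<delta> \<le> \<delta>0" and z: "norm (z - K x) \<le> \<kappa> * \<delta>"
    have "\<delta>\<^sup>2 \<le> \<delta>0\<^sup>2"
      using \<delta> by (intro power_mono) auto
    then have m\<delta>: "m * \<delta>\<^sup>2 \<le> e / 2"
      using e m by (simp add: \<delta>0_def field_simps)
    have "H\<^sup>2 / s * \<delta>\<^sup>2 \<le> m * \<delta>\<^sup>2" "N * \<delta>\<^sup>2 \<le> m * \<delta>\<^sup>2" "N / a * \<delta>\<^sup>2 \<le> m * \<delta>\<^sup>2"
    proof -
      have "0 \<le> H\<^sup>2 / s" "0 \<le> N / a"
        using s N a by simp_all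
      then show "H\<^sup>2 / s * \<delta>\<^sup>2 \<le> m * \<delta>\<^sup>2" "N * \<delta>\<^sup>2 \<le> m * \<delta>\<^sup>2" "N / a * \<delta>\<^sup>2 \<le> m * \<delta>\<^sup>2"
        unfolding m_def using N by (intro mult_right_mono; simp)+
    qed
    then have H\<delta>: "H\<^sup>2 / s * \<delta>\<^sup>2 \<le> e / 2" and N\<delta>: "N * \<delta>\<^sup>2 \<le> e / 2" and Na\<delta>: "N / a * \<delta>\<^sup>2 \<le> e / 2"
      using m\<delta> by linarith+
    obtain \<alpha> where \<alpha>: "0 < \<alpha>"
      and K_upper: "norm (K (res \<alpha> x)) \<le> H * \<delta>"
      and est: "norm (est \<delta> z - x) \<le> norm (res \<alpha> x) + sqrt (N * (q * (\<delta>\<^sup>2 / \<alpha>)))"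
      and K_lower: "\<alpha> = 1 \<or> \<theta> * \<delta> \<le> norm (K (res (\<alpha> / q) x))"
      using discrepancy_step[OF rate1 \<delta>(1) z] unfolding H_def \<theta>_def N_def by blast
    have "(norm (res \<alpha> x))\<^sup>2 \<le> (1 / s) * (norm (K (res \<alpha> x)))\<^sup>2 + C0\<^sup>2 * T"
    proof (rule has_sum_mono[OF has_sum_norm_res[OF \<alpha>]
          has_sum_add[OF has_sum_cmult_right[OF has_sum_norm_K_res[OF \<alpha>]] has_sum_cmult_right[OF tail]]])
      fix \<mu> assume \<mu>: "\<mu> \<in> eigenvalues A"
      note \<mu>0 = eigenvalue_bounds(1)[OF \<mu>]
      define r w where "r = (1 - F \<alpha> \<mu> * \<mu>)\<^sup>2" and "w = (norm (E \<mu> x))\<^sup>2"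
      have r: "0 \<le> r" "r \<le> C0\<^sup>2" and w: "0 \<le> w"
        using res_bound_squared[OF \<alpha> \<mu>] by (auto simp: r_def w_def)
      have "r * w \<le> (1 / s) * (\<mu> * r * w) + C0\<^sup>2 * (if \<mu> < s then w else 0)"
      proof (cases "\<mu> < s")
        case True
        then show ?thesis
          using r w \<mu>0 s by (auto intro!: add_increasing mult_right_mono)
      next
        case False
        then have "1 * (r * w) \<le> (\<mu> / s) * (r * w)"
          using r w s by (intro mult_right_mono) auto
        then show ?thesis
          using False by (simp add: mult_ac)
      qed
      then show "(1 - F \<alpha> \<mu> * \<mu>)\<^sup>2 * (norm (E \<mu> x))\<^sup>2
          \<le> 1 / s * (\<mu> * (1 - F \<alpha> \<mu> * \<mu>)\<^sup>2 * (norm (E \<mu> x))\<^sup>2)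
            + C0\<^sup>2 * (if \<mu> < s then (norm (E \<mu> x))\<^sup>2 else 0)"
        unfolding r_def w_def .
    qed
    also have "(1 / s) * (norm (K (res \<alpha> x)))\<^sup>2 \<le> (1 / s) * (H * \<delta>)\<^sup>2"
      using s K_upper by (intro mult_left_mono power_mono) auto
    also have "\<dots> = H\<^sup>2 / s * \<delta>\<^sup>2"
      by (simp add: power_mult_distrib)
    finally have "(norm (res \<alpha> x))\<^sup>2 \<le> e"
      using H\<delta> C0T by linarith
    then have res_le: "norm (res \<alpha> x) \<le> \<epsilon> / 4"
      using \<epsilon> by - (rule power2_le_imp_le, simp_all add: e_def power2_eq_square)
    have "N * (q * (\<delta>\<^sup>2 / \<alpha>)) \<le> e"
    proof (cases "\<alpha> = 1")
      case True
      have "N * (q * \<delta>\<^sup>2) \<le> N * (1 * \<delta>\<^sup>2)"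
        using N q by (intro mult_left_mono mult_right_mono) auto
      then show ?thesis
        using True N\<delta> e by simp
    next
      case False
      define \<beta> where "\<beta> = \<alpha> / q"
      have \<beta>: "\<beta> > 0" "q * (\<delta>\<^sup>2 / \<alpha>) = \<delta>\<^sup>2 / \<beta>"
        using \<alpha> q by (auto simp: \<beta>_def)
      have lower: "\<theta> * \<delta> \<le> norm (K (res \<beta> x))"
        using K_lower False by (simp add: \<beta>_def)
      show ?thesis
      proof (cases "\<beta> \<le> a")
        case True
        have "(\<theta> * \<delta>)\<^sup>2 \<le> (norm (K (res \<beta> x)))\<^sup>2"
          using lower \<theta> \<delta> by (intro power_mono) auto
        \<comment> \<open>Below s the rate with exponent 1 is applied, and from s on the rate with
          exponent 1 + \<nu>, where the surplus factor \<mu>^(-\<nu>) is at most s^(-\<nu>).\<close>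
        also have "\<dots> \<le> (C1\<^sup>2 * \<beta>) * T + (C2\<^sup>2 * \<beta> powr (1 + \<nu>) * s powr (- \<nu>)) * (norm x)\<^sup>2"
        proof (rule has_sum_mono[OF has_sum_norm_K_res[OF \<beta>(1)]
              has_sum_add[OF has_sum_cmult_right[OF tail] has_sum_cmult_right[OF has_sum_norm]]])
          fix \<mu> assume \<mu>: "\<mu> \<in> eigenvalues A"
          note \<mu>0 = eigenvalue_bounds(1)[OF \<mu>]
          define r w where "r = (1 - F \<beta> \<mu> * \<mu>)\<^sup>2" and "w = (norm (E \<mu> x))\<^sup>2"
          have w: "0 \<le> w" and r: "0 \<le> r"
            by (auto simp: w_def r_def)
          have r1: "\<mu> * r \<le> C1\<^sup>2 * \<beta>"
            using rate_squared[OF rate1 \<beta>(1) \<mu>] \<mu>0 \<beta>(1) by (simp add: r_def)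
          have r2: "\<mu> powr (1 + \<nu>) * r \<le> C2\<^sup>2 * \<beta> powr (1 + \<nu>)"
            using rate_squared[OF rate2 \<beta>(1) \<mu>] by (simp add: r_def)
          have "\<mu> * r * w \<le> (C1\<^sup>2 * \<beta>) * (if \<mu> < s then w else 0)
              + (C2\<^sup>2 * \<beta> powr (1 + \<nu>) * s powr (- \<nu>)) * w"
          proof (cases "\<mu> < s")
            case True
            then show ?thesis
              using r1 w by (auto intro!: add_increasing2 mult_right_mono)
          next
            case False
            have "\<mu> * r = \<mu> powr (1 + \<nu>) * r * \<mu> powr (- \<nu>)"
              using \<mu>0 by (simp add: powr_add powr_minus)
            also have "\<dots> \<le> (C2\<^sup>2 * \<beta> powr (1 + \<nu>)) * s powr (- \<nu>)"
              using False s \<nu> by (intro mult_mono[OF r2] powr_mono2') auto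
            finally show ?thesis
              using False w by (auto intro!: mult_right_mono)
          qed
          then show "\<mu> * (1 - F \<beta> \<mu> * \<mu>)\<^sup>2 * (norm (E \<mu> x))\<^sup>2
              \<le> C1\<^sup>2 * \<beta> * (if \<mu> < s then (norm (E \<mu> x))\<^sup>2 else 0)
                + C2\<^sup>2 * \<beta> powr (1 + \<nu>) * s powr (- \<nu>) * (norm (E \<mu> x))\<^sup>2"
            unfolding r_def w_def .
        qed
        also have "\<dots> = \<beta> * (C1\<^sup>2 * T + C2\<^sup>2 * s powr (- \<nu>) * (norm x)\<^sup>2 * \<beta> powr \<nu>)"
          using \<beta> by (simp add: powr_add algebra_simps)
        finally have "\<delta>\<^sup>2 / \<beta> \<le> (C1\<^sup>2 * T + C2\<^sup>2 * s powr (- \<nu>) * (norm x)\<^sup>2 * \<beta> powr \<nu>) / \<theta>\<^sup>2"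
          using \<beta>(1) \<theta> by (simp add: power_mult_distrib field_simps)
        then have "N * (\<delta>\<^sup>2 / \<beta>) \<le> N * ((C1\<^sup>2 * T + C2\<^sup>2 * s powr (- \<nu>) * (norm x)\<^sup>2 * \<beta> powr \<nu>) / \<theta>\<^sup>2)"
          using N by (rule mult_left_mono)
        also have "\<dots> = N * C1\<^sup>2 / \<theta>\<^sup>2 * T + B * \<beta> powr \<nu>"
          by (simp add: B_def add_divide_distrib algebra_simps)
        also have "\<dots> \<le> e / 2 + e / 2"
          by (intro add_mono C1T a_powr \<beta> True)
        finally show ?thesis
          using \<beta>(2) by simp
      next
        case False
        then have "\<delta>\<^sup>2 / \<beta> \<le> \<delta>\<^sup>2 / a"
          using a by (intro divide_left_mono) auto
        then have "N * (\<delta>\<^sup>2 / \<beta>) \<le> N * (\<delta>\<^sup>2 / a)"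
          using N by (rule mult_left_mono)
        also have "\<dots> = N / a * \<delta>\<^sup>2"
          by simp
        finally show ?thesis
          unfolding \<beta>(2) using Na\<delta> e by linarith
      qed
    qed
    then have "sqrt (N * (q * (\<delta>\<^sup>2 / \<alpha>))) \<le> sqrt e"
      by simp
    also have "sqrt e = \<epsilon> / 4"
      using \<epsilon> by (simp add: e_def real_sqrt_divide)
    finally show "norm (est \<delta> z - x) < \<epsilon>"
      using est res_le \<epsilon> by linarith
  qed
qed

text \<open>The target is B = \<rho>^p \<delta>^(1-p) with p = 1/(\<nu>+1). Under the source
  condition the squared components of x carry the weight \<mu>^\<nu>: this makes the part of the
  squared approximation error below s of order s^\<nu> \<rho>^2, and bounds the K-residual at
  \<beta> by a multiple of \<beta>^((1+\<nu>)/2) \<rho>.\<close>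

theorem discrepancy_rate:
  assumes rate1: "rate_const ((onorm K)\<^sup>2) F 1 C1"
    and rate2: "rate_const ((onorm K)\<^sup>2) F (1 + \<nu>) C2" and \<nu>: "0 < \<nu>"
    and \<rho>: "0 < \<rho>" and w: "norm w \<le> \<rho>" and x: "x = fun_calc (\<lambda>t. t powr (\<nu> / 2)) A w"
  obtains L where
    "\<And>\<delta> z. 0 < \<delta> \<Longrightarrow> \<delta> \<le> 1 \<Longrightarrow> norm (z - K x) \<le> \<kappa> * \<delta> \<Longrightarrow>
       norm (est \<delta> z - x) \<le> L * \<rho> powr (1 / (\<nu> + 1)) * \<delta> powr (\<nu> / (\<nu> + 1))"
proof -
  define H \<theta> N where "H = 2 * \<tau> + C0 * \<kappa>" and "\<theta> = 2 * \<tau> - C0 * \<kappa>" and "N = noise_const"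
  have \<theta>: "\<theta> > 0" and N: "N \<ge> 0"
    using \<kappa> by (simp_all add: \<theta>_def N_def noise_const_nonneg)
  define p where "p = 1 / (\<nu> + 1)"
  have p: "p > 0" "\<nu> * p = 1 - p" "(\<nu> + 1) * p = 1"
    using \<nu> by (simp_all add: p_def field_simps)
  have \<nu>p: "\<nu> / (\<nu> + 1) = 1 - p"
    using \<nu> by (simp add: p_def field_simps)
  \<comment> \<open>The last summand belongs to the case \<alpha> = 1, where the noise is of order
    \<delta>, hence of order \<delta>^(1-p) for \<delta> at most 1; dividing by \<rho>^p makes
    \<open>L\<close> depend on \<rho>.\<close>
  define L where "L = sqrt (H\<^sup>2 + C0\<^sup>2) + sqrt N * (\<bar>C2\<bar> / \<theta>) powr p + sqrt N * \<rho> powr (- p)"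
  have Ex: "(norm (E \<mu> x))\<^sup>2 = \<mu> powr \<nu> * (norm (E \<mu> w))\<^sup>2" for \<mu>
  proof -
    have "\<bar>\<mu> powr (\<nu> / 2)\<bar> \<le> ((onorm K)\<^sup>2) powr (\<nu> / 2)" if "\<mu> \<in> eigenvalues A" for \<mu>
      using eigenvalue_bounds[OF that] \<nu> by (auto intro!: powr_mono2)
    from E_fun_calc[OF this] have "E \<mu> x = \<mu> powr (\<nu> / 2) *\<^sub>R E \<mu> w"
      unfolding x by simp
    then show ?thesis
      by (simp add: power_mult_distrib power2_eq_square powr_add[symmetric])
  qed
  show thesis
  proof (rule that[of L], unfold \<nu>p p_def[symmetric])
    fix \<delta> z assume \<delta>: "0 < \<delta>" "\<delta> \<le> 1" and z: "norm (z - K x) \<le> \<kappa> * \<delta>"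
    define B where "B = \<rho> powr p * \<delta> powr (1 - p)"
    have B: "B > 0"
      using \<rho> \<delta> by (simp add: B_def)
    \<comment> \<open>Balances the two parts of the squared approximation error: \<delta>^2 / s and
      s^\<nu> \<rho>^2 both equal B^2.\<close>
    define s where "s = (\<delta> / \<rho>) powr (2 * p)"
    have s: "s > 0"
      using \<rho> \<delta> by (simp add: s_def)
    have B2: "B\<^sup>2 = \<rho> powr (2 * p) * \<delta> powr (2 - 2 * p)"
      by (simp add: B_def power_mult_distrib power2_eq_square powr_add[symmetric] algebra_simps)
    have \<delta>s: "(1 / s) * \<delta>\<^sup>2 = B\<^sup>2"
      unfolding B2 s_def using \<delta> \<rho>
      by (simp add: powr_divide powr_diff powr_numeral divide_simps)
    have \<rho>s: "s powr \<nu> * \<rho>\<^sup>2 = B\<^sup>2"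
    proof -
      have "s powr \<nu> = (\<delta> / \<rho>) powr (2 - 2 * p)"
      proof -
        have "2 * p * \<nu> = 2 - 2 * p"
          using p(2) by (simp add: mult_ac)
        then show ?thesis
          unfolding s_def powr_powr by simp
      qed
      then show ?thesis
        unfolding B2 using \<delta> \<rho>
        by (simp add: powr_divide powr_diff powr_numeral divide_simps power2_eq_square mult_ac)
    qed
    obtain \<alpha> where \<alpha>: "0 < \<alpha>"
      and K_upper: "norm (K (res \<alpha> x)) \<le> H * \<delta>"
      and est: "norm (est \<delta> z - x) \<le> norm (res \<alpha> x) + sqrt (N * (q * (\<delta>\<^sup>2 / \<alpha>)))"
      and K_lower: "\<alpha> = 1 \<or> \<theta> * \<delta> \<le> norm (K (res (\<alpha> / q) x))"
      using discrepancy_step[OF rate1 \<delta>(1) z] unfolding H_def \<theta>_def N_def by blast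
    have "(norm (res \<alpha> x))\<^sup>2 \<le> (1 / s) * (norm (K (res \<alpha> x)))\<^sup>2 + (C0\<^sup>2 * s powr \<nu>) * (norm w)\<^sup>2"
    proof (rule has_sum_mono[OF has_sum_norm_res[OF \<alpha>]
          has_sum_add[OF has_sum_cmult_right[OF has_sum_norm_K_res[OF \<alpha>]] has_sum_cmult_right[OF has_sum_norm]]])
      fix \<mu> assume \<mu>: "\<mu> \<in> eigenvalues A"
      note \<mu>0 = eigenvalue_bounds(1)[OF \<mu>]
      define r u where "r = (1 - F \<alpha> \<mu> * \<mu>)\<^sup>2" and "u = (norm (E \<mu> w))\<^sup>2"
      have r: "0 \<le> r" "r \<le> C0\<^sup>2" and u: "0 \<le> u"
        using res_bound_squared[OF \<alpha> \<mu>] by (auto simp: r_def u_def)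
      have "r * (\<mu> powr \<nu> * u) \<le> (1 / s) * (\<mu> * r * (\<mu> powr \<nu> * u)) + (C0\<^sup>2 * s powr \<nu>) * u"
      proof (cases "\<mu> < s")
        case True
        then have "r * \<mu> powr \<nu> \<le> C0\<^sup>2 * s powr \<nu>"
          using r \<mu>0 \<nu> by (intro mult_mono powr_mono2) auto
        then have "(r * \<mu> powr \<nu>) * u \<le> (C0\<^sup>2 * s powr \<nu>) * u"
          using u by (rule mult_right_mono)
        moreover have "0 \<le> (1 / s) * (\<mu> * r * (\<mu> powr \<nu> * u))"
          using s \<mu>0 r u by simp
        ultimately show ?thesis
          by (simp add: mult_ac)
      next
        case False
        then have "1 * (r * (\<mu> powr \<nu> * u)) \<le> (\<mu> / s) * (r * (\<mu> powr \<nu> * u))"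
          using r u s by (intro mult_right_mono) auto
        moreover have "0 \<le> (C0\<^sup>2 * s powr \<nu>) * u"
          using u by simp
        ultimately show ?thesis
          by (simp add: mult_ac)
      qed
      then show "(1 - F \<alpha> \<mu> * \<mu>)\<^sup>2 * (norm (E \<mu> x))\<^sup>2
          \<le> 1 / s * (\<mu> * (1 - F \<alpha> \<mu> * \<mu>)\<^sup>2 * (norm (E \<mu> x))\<^sup>2)
            + C0\<^sup>2 * s powr \<nu> * (norm (E \<mu> w))\<^sup>2"
        by (simp add: r_def u_def Ex)
    qed
    also have "\<dots> \<le> (1 / s) * (H * \<delta>)\<^sup>2 + (C0\<^sup>2 * s powr \<nu>) * \<rho>\<^sup>2"
      using s K_upper w by (intro add_mono mult_left_mono power_mono) auto
    also have "\<dots> = H\<^sup>2 * ((1 / s) * \<delta>\<^sup>2) + C0\<^sup>2 * (s powr \<nu> * \<rho>\<^sup>2)"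
      by (simp add: power_mult_distrib)
    also have "\<dots> = (H\<^sup>2 + C0\<^sup>2) * B\<^sup>2"
      unfolding \<delta>s \<rho>s by (simp add: algebra_simps)
    finally have res_le: "norm (res \<alpha> x) \<le> sqrt (H\<^sup>2 + C0\<^sup>2) * B"
      using B by - (rule power2_le_imp_le, simp_all add: power_mult_distrib)
    have "sqrt (q * (\<delta>\<^sup>2 / \<alpha>)) \<le> (\<bar>C2\<bar> / \<theta>) powr p * B + \<rho> powr (- p) * B"
    proof (cases "\<alpha> = 1")
      case True
      have "sqrt (q * \<delta>\<^sup>2) \<le> sqrt (1 * \<delta>\<^sup>2)"
        using q by (intro real_sqrt_le_mono mult_right_mono) auto
      also have "\<dots> = \<delta> powr 1"
        using \<delta> by simp
      also have "\<dots> \<le> \<delta> powr (1 - p)"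
        using \<delta> p by (intro powr_mono') auto
      also have "\<dots> = \<rho> powr (- p) * B"
        using \<rho> by (simp add: B_def powr_minus)
      finally show ?thesis
        using True B by (auto intro!: add_increasing)
    next
      case False
      define \<beta> where "\<beta> = \<alpha> / q"
      have \<beta>: "\<beta> > 0" "q * (\<delta>\<^sup>2 / \<alpha>) = \<delta>\<^sup>2 / \<beta>"
        using \<alpha> q by (auto simp: \<beta>_def)
      have "\<theta> * \<delta> \<le> norm (K (res \<beta> x))"
        using K_lower False by (simp add: \<beta>_def)
      also have "\<dots> \<le> \<bar>C2\<bar> * (sqrt \<beta>) powr (1 + \<nu>) * \<rho>"
      proof (rule power2_le_imp_le)
        have "(norm (K (res \<beta> x)))\<^sup>2 \<le> (C2\<^sup>2 * \<beta> powr (1 + \<nu>)) * (norm w)\<^sup>2"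
        proof (rule has_sum_mono[OF has_sum_norm_K_res[OF \<beta>(1)] has_sum_cmult_right[OF has_sum_norm]])
          fix \<mu> assume \<mu>: "\<mu> \<in> eigenvalues A"
          have "(\<mu> powr (1 + \<nu>) * (1 - F \<beta> \<mu> * \<mu>)\<^sup>2) * (norm (E \<mu> w))\<^sup>2
              \<le> (C2\<^sup>2 * \<beta> powr (1 + \<nu>)) * (norm (E \<mu> w))\<^sup>2"
            by (intro mult_right_mono rate_squared[OF rate2 \<beta>(1) \<mu>]) auto
          then show "\<mu> * (1 - F \<beta> \<mu> * \<mu>)\<^sup>2 * (norm (E \<mu> x))\<^sup>2
              \<le> C2\<^sup>2 * \<beta> powr (1 + \<nu>) * (norm (E \<mu> w))\<^sup>2"
            using eigenvalue_bounds(1)[OF \<mu>] by (simp add: Ex powr_add mult_ac)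
        qed
        also have "\<dots> \<le> (C2\<^sup>2 * \<beta> powr (1 + \<nu>)) * \<rho>\<^sup>2"
          using w by (intro mult_left_mono power_mono) auto
        also have "\<dots> = (\<bar>C2\<bar> * (sqrt \<beta>) powr (1 + \<nu>) * \<rho>)\<^sup>2"
        proof -
          have "((sqrt \<beta>) powr (1 + \<nu>))\<^sup>2 = \<beta> powr (1 + \<nu>)"
            using \<beta>(1) by (simp add: power2_eq_square powr_mult[symmetric])
          then show ?thesis
            by (simp add: power_mult_distrib)
        qed
        finally show "(norm (K (res \<beta> x)))\<^sup>2 \<le> (\<bar>C2\<bar> * (sqrt \<beta>) powr (1 + \<nu>) * \<rho>)\<^sup>2" .
      qed (use \<rho> in auto)
      \<comment> \<open>A lower bound for \<beta>; the power p isolates sqrt \<beta>, since p (1 +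
        \<nu>) = 1. Multiplied by \<delta>^(1-p) it bounds the noise \<delta> / sqrt
        \<beta>.\<close>
      finally have "\<delta> \<le> (\<bar>C2\<bar> / \<theta> * \<rho>) * (sqrt \<beta>) powr (1 + \<nu>)"
        using \<theta> by (simp add: field_simps)
      then have "\<delta> powr p \<le> ((\<bar>C2\<bar> / \<theta> * \<rho>) * (sqrt \<beta>) powr (1 + \<nu>)) powr p"
        using \<delta> p by (intro powr_mono2) auto
      also have "\<dots> = (\<bar>C2\<bar> / \<theta>) powr p * \<rho> powr p * sqrt \<beta>"
      proof -
        have "(sqrt \<beta> powr (1 + \<nu>)) powr p = sqrt \<beta>"
          using p(3) \<beta>(1) by (simp add: powr_powr add.commute)
        moreover have "(\<bar>C2\<bar> / \<theta> * \<rho>) powr p = (\<bar>C2\<bar> / \<theta>) powr p * \<rho> powr p"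
          by (rule powr_mult)
        ultimately show ?thesis
          by (simp only: powr_mult)
      qed
      finally have "\<delta> powr p / sqrt \<beta> \<le> (\<bar>C2\<bar> / \<theta>) powr p * \<rho> powr p"
        using \<beta>(1) by (simp add: field_simps)
      then have "\<delta> powr p / sqrt \<beta> * \<delta> powr (1 - p) \<le> (\<bar>C2\<bar> / \<theta>) powr p * \<rho> powr p * \<delta> powr (1 - p)"
        by (rule mult_right_mono) simp
      moreover have "sqrt (\<delta>\<^sup>2 / \<beta>) = \<delta> powr p / sqrt \<beta> * \<delta> powr (1 - p)"
        using \<delta> by (simp add: real_sqrt_divide powr_diff)
      ultimately have "sqrt (\<delta>\<^sup>2 / \<beta>) \<le> (\<bar>C2\<bar> / \<theta>) powr p * B"
        by (simp add: B_def mult.assoc)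
      then show ?thesis
        using \<beta>(2) B by (auto intro!: add_increasing2)
    qed
    then have "sqrt (N * (q * (\<delta>\<^sup>2 / \<alpha>))) \<le> sqrt N * ((\<bar>C2\<bar> / \<theta>) powr p * B + \<rho> powr (- p) * B)"
      unfolding real_sqrt_mult[of N] using N by (intro mult_left_mono) auto
    with est res_le have "norm (est \<delta> z - x) \<le> L * B"
      by (simp add: L_def algebra_simps)
    then show "norm (est \<delta> z - x) \<le> L * \<rho> powr p * \<delta> powr (1 - p)"
      by (simp add: B_def mult.assoc)
  qed
qed

end

section \<open>The Moore-Penrose inverse of a discretisation\<close>

text \<open>Provides the compact set that the spectral theorem asks for in finite rank: a sum of
  finitely many compact segments.\<close>

lemma finite_rank_compact:
  fixes e :: "'i \<Rightarrow> 'a::real_normed_vector"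
  assumes "finite J"
  shows "\<exists>Q. compact Q \<and> (\<forall>t. (\<forall>j\<in>J. \<bar>t j\<bar> \<le> B j) \<longrightarrow> (\<Sum>j\<in>J. t j *\<^sub>R e j) \<in> Q)"
  using assms
proof (induction J rule: finite_induct)
  case empty
  show ?case
    by (rule exI[of _ "{0}"]) simp
next
  case (insert j J)
  then obtain Q where Q: "compact Q" "\<And>t. (\<forall>j\<in>J. \<bar>t j\<bar> \<le> B j) \<Longrightarrow> (\<Sum>j\<in>J. t j *\<^sub>R e j) \<in> Q"
    by blast
  define S where "S = (\<lambda>t. t *\<^sub>R e j) ` {- B j..B j}"
  have "compact S"
    unfolding S_def by (intro compact_continuous_image continuous_intros) simp
  then have "compact {x + y | x y. x \<in> S \<and> y \<in> Q}"
    using Q(1) by (rule compact_sums)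
  moreover have "(\<Sum>i\<in>insert j J. t i *\<^sub>R e i) \<in> {x + y | x y. x \<in> S \<and> y \<in> Q}"
    if t: "\<forall>i\<in>insert j J. \<bar>t i\<bar> \<le> B i" for t
  proof -
    have "t j *\<^sub>R e j \<in> S"
      using t unfolding S_def by (intro imageI) (auto simp: abs_le_iff)
    then show ?thesis
      using Q(2)[of t] t insert.hyps by auto
  qed
  ultimately show ?case
    by blast
qed

lemma dot_self: "dot m v v = (\<Sum>j=1..m. (v j)\<^sup>2)"
  by (simp add: dot_def power2_eq_square)

lemma adjoint_ip_eqI:
  assumes "\<And>x v. ip (T x) v = x \<bullet> T' v"
  shows "adjoint_ip ip T = T'"
  unfolding adjoint_ip_def
proof (rule some_equality)
  fix S assume "\<forall>x v. ip (T x) v = x \<bullet> S v"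
  then have "x \<bullet> S v = x \<bullet> T' v" for x v
    using assms by simp
  then show "S = T'"
    by (intro ext, rule inner_ext)
qed (use assms in simp)

text \<open>The Riesz vectors e_j make the adjoint of P explicit: it maps v to the combination of
  the e_j with coefficients v_j.\<close>

locale discretisation =
  fixes m :: nat and l :: "nat \<Rightarrow> 'y::{real_inner, complete_space} \<Rightarrow> real" and e :: "nat \<Rightarrow> 'y"
  assumes functional: "\<And>j y. j \<in> {1..m} \<Longrightarrow> l j y = y \<bullet> e j"
    and gram_bij: "bij_betw (\<lambda>v. discr m l (adjoint_ip (dot m) (discr m l) v)) (Rn m) (Rn m)"
begin

abbreviation P :: "'y \<Rightarrow> nat \<Rightarrow> real" where
  "P \<equiv> discr m l"

definition P' :: "(nat \<Rightarrow> real) \<Rightarrow> 'y" where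
  "P' v = (\<Sum>j=1..m. v j *\<^sub>R e j)"

abbreviation Pinv :: "(nat \<Rightarrow> real) \<Rightarrow> 'y" where
  "Pinv \<equiv> mp_inverse (dot m) P"

lemma P_diff: "P (x - y) = P x - P y"
  by (auto simp: discr_def functional inner_diff_left)

lemma P_add: "P (x + y) = P x + P y"
  by (auto simp: discr_def functional inner_add_left)

lemma dot_P: "dot m (P x) v = x \<bullet> P' v"
  by (simp add: dot_def P'_def inner_sum_right discr_def functional mult.commute)

lemma adjoint_P: "adjoint_ip (dot m) P = P'"
  by (rule adjoint_ip_eqI) (rule dot_P)

lemma P_eq_0_if_dot: "dot m (P x) (P x) = 0 \<Longrightarrow> P x = 0"
  by (auto simp: dot_self sum_nonneg_eq_0_iff) (auto simp: discr_def)

lemma Pinv_eqI: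
  assumes x: "x \<in> orthogonal_comp {z. P z = 0}" and v: "P x = v"
  shows "Pinv v = x"
  unfolding mp_inverse_def
proof (rule the_equality)
  show "x \<in> orthogonal_comp {z. P z = 0} \<and> (\<forall>z. dot m (v - P x) (P z) = 0)"
    using x v by (simp add: dot_def)
  fix x' assume x': "x' \<in> orthogonal_comp {z. P z = 0} \<and> (\<forall>z. dot m (v - P x') (P z) = 0)"
  have "dot m (P (x - x')) (P (x - x')) = 0"
    using spec[OF conjunct2[OF x'], of "x - x'"] v by (simp only: P_diff)
  then have "P (x - x') = 0"
    by (rule P_eq_0_if_dot)
  moreover have "x - x' \<in> orthogonal_comp {z. P z = 0}"
    using x x' by (simp add: subspace_diff subspace_orthogonal_comp)
  ultimately have "(x - x') \<bullet> (x - x') = 0"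
    by (auto simp: orthogonal_comp_def orthogonal_def)
  then show "x' = x"
    by simp
qed

text \<open>Solving P P^* u = v gives the preimage P^* u, and the range of P^* is orthogonal to the
  kernel of P.\<close>

lemma Pinv:
  assumes "v \<in> Rn m"
  shows "P (Pinv v) = v" and "Pinv v \<in> orthogonal_comp {z. P z = 0}"
proof -
  obtain u where u: "P (P' u) = v"
    using gram_bij assms unfolding adjoint_P bij_betw_def by (metis (no_types, lifting) imageE)
  have "z \<bullet> P' u = 0" if "P z = 0" for z
    using dot_P[of z u] that by (simp add: dot_def)
  then have "P' u \<in> orthogonal_comp {z. P z = 0}"
    by (auto simp: orthogonal_comp_def orthogonal_def)
  with Pinv_eqI[OF this u] u show "P (Pinv v) = v" "Pinv v \<in> orthogonal_comp {z. P z = 0}"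
    by auto
qed

lemma Pinv_add:
  assumes "u \<in> Rn m" "v \<in> Rn m"
  shows "Pinv (u + v) = Pinv u + Pinv v"
  using assms by (intro Pinv_eqI) (simp_all add: P_add Pinv subspace_add subspace_orthogonal_comp)

text \<open>Serves measurability: the back-projected data become a combination of fixed vectors with
  real random coefficients.\<close>

lemma Pinv_expansion:
  assumes "v \<in> Rn m"
  shows "Pinv v = (\<Sum>j=1..m. v j *\<^sub>R Pinv (\<lambda>i. of_bool (i = j)))"
proof -
  let ?u = "\<lambda>j i. of_bool (i = j) :: real"
  have u: "?u j \<in> Rn m" if "j \<in> {1..m}" for j
    using that by (auto simp: Rn_def)
  have "P (\<Sum>j=1..m. v j *\<^sub>R Pinv (?u j)) i = v i" for i
  proof -
    have "P (\<Sum>j=1..m. v j *\<^sub>R Pinv (?u j)) i = (\<Sum>j=1..m. v j * P (Pinv (?u j)) i)"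
      by (auto simp: discr_def functional inner_sum_left)
    also have "\<dots> = (\<Sum>j=1..m. v j * of_bool (i = j))"
      by (rule sum.cong) (simp_all add: Pinv(1)[OF u])
    also have "\<dots> = v i"
      using assms by (cases "i \<in> {1..m}") (auto simp: Rn_def of_bool_def if_distrib cong: if_cong)
    finally show ?thesis .
  qed
  moreover have "(\<Sum>j=1..m. v j *\<^sub>R Pinv (?u j)) \<in> orthogonal_comp {z. P z = 0}"
    by (intro subspace_sum subspace_scale subspace_orthogonal_comp Pinv u)
  ultimately show ?thesis
    by (intro Pinv_eqI) auto
qed

section \<open>Singular values and the norm of the pseudoinverse\<close>

definition G :: "'y \<Rightarrow> 'y" where
  "G x = P' (P x)"

lemma form_G: "G x \<bullet> y = dot m (P x) (P y)"
  unfolding G_def using dot_P[of y "P x"] by (simp add: inner_commute dot_def mult.commute)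

lemma bounded_linear_G: "bounded_linear G"
proof -
  have "G = (\<lambda>x. \<Sum>j=1..m. (x \<bullet> e j) *\<^sub>R e j)"
    by (intro ext) (auto simp: G_def P'_def discr_def functional intro!: sum.cong)
  moreover have "bounded_linear (\<lambda>x. \<Sum>j=1..m. (x \<bullet> e j) *\<^sub>R e j)"
    by (intro bounded_linear_sum bounded_linear_scaleR_const bounded_linear_inner_left)
  ultimately show ?thesis
    by simp
qed

text \<open>Nonzero eigenvalues of \<open>G\<close>, which is P^* P, are squares of singular values
  and so at least c^2. The vector P^+ v is orthogonal to the kernel and has no component for the
  eigenvalue 0, so Parseval bounds c^2 times its squared norm by that of v.\<close>

lemma norm_Pinv_le:
  assumes c: "0 < c" and sv: "\<And>\<sigma>. \<sigma> \<in> singular_values (dot m) P \<Longrightarrow> c \<le> \<sigma>" and v: "v \<in> Rn m"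
  shows "norm (Pinv v) \<le> sqrt (\<Sum>j=1..m. (v j)\<^sup>2) / c"
proof -
  obtain Q where Q: "compact Q"
    "\<And>t. (\<forall>j\<in>{1..m}. \<bar>t j\<bar> \<le> norm (e j)) \<Longrightarrow> (\<Sum>j=1..m. t j *\<^sub>R e j) \<in> Q"
    using finite_rank_compact[of "{1..m}" "\<lambda>j. norm (e j)" e] by blast
  interpret G: compact_positive_operator G Q
  proof (rule compact_positive_operator.intro)
    show "bounded_linear G"
      by (rule bounded_linear_G)
    show "G x \<bullet> y = x \<bullet> G y" for x y
      using form_G[of x y] form_G[of y x] by (simp add: inner_commute dot_def mult.commute)
    show "0 \<le> G x \<bullet> x" for x
      by (simp add: form_G dot_self sum_nonneg)
    show "compact Q"
      by (rule Q)
    show "G ` cball 0 1 \<subseteq> Q"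
    proof clarify
      fix x :: 'y assume x: "x \<in> cball 0 1"
      have "\<bar>P x j\<bar> \<le> norm (e j)" if j: "j \<in> {1..m}" for j
      proof -
        have "\<bar>x \<bullet> e j\<bar> \<le> norm x * norm (e j)"
          by (rule Cauchy_Schwarz_ineq2)
        also have "\<dots> \<le> 1 * norm (e j)"
          using x by (intro mult_right_mono) auto
        finally show ?thesis
          using j by (simp add: discr_def functional)
      qed
      then show "G x \<in> Q"
        unfolding G_def P'_def by (intro Q) auto
    qed
  qed
  define x where "x = Pinv v"
  have x: "P x = v" "x \<in> orthogonal_comp {z. P z = 0}"
    unfolding x_def using Pinv[OF v] by auto
  have "c\<^sup>2 * (norm x)\<^sup>2 \<le> G x \<bullet> x"
  proof (rule has_sum_mono[OF has_sum_cmult_right[OF G.has_sum_norm] G.has_sum_form])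
    fix \<mu> assume \<mu>: "\<mu> \<in> eigenvalues G"
    show "c\<^sup>2 * (norm (G.E \<mu> x))\<^sup>2 \<le> \<mu> * (norm (G.E \<mu> x))\<^sup>2"
    proof (cases "\<mu> = 0")
      case True
      have "G (G.E 0 x) = 0"
        using G.E_mem[of 0 x] by (simp add: eigenspace_def)
      then have "P (G.E 0 x) = 0"
        using form_G[of "G.E 0 x" "G.E 0 x"] by (intro P_eq_0_if_dot) simp
      then have "x \<bullet> G.E 0 x = 0"
        using x(2) by (auto simp: orthogonal_comp_def orthogonal_def inner_commute)
      then have "G.E 0 x = 0"
        using G.inner_E[OF G.E_mem, of 0 x x] by simp
      then show ?thesis
        using True by simp
    next
      case False
      then have \<mu>_pos: "\<mu> > 0"
        using G.eigenvalue_nonneg[OF \<mu>] by simp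
      obtain u where "u \<noteq> 0" "G u = \<mu> *\<^sub>R u"
        using \<mu> by (auto simp: eigenvalues_def)
      then have "sqrt \<mu> \<in> singular_values (dot m) P"
        using \<mu>_pos by (auto simp: singular_values_def adjoint_P G_def)
      then have "c \<le> sqrt \<mu>"
        by (rule sv)
      then have "c\<^sup>2 \<le> (sqrt \<mu>)\<^sup>2"
        using c by (intro power_mono) auto
      then show ?thesis
        using \<mu>_pos by (intro mult_right_mono) auto
    qed
  qed
  then have "(c * norm x)\<^sup>2 \<le> (\<Sum>j=1..m. (v j)\<^sup>2)"
    by (simp add: form_G x(1) dot_self power_mult_distrib)
  then have "c * norm x \<le> sqrt (\<Sum>j=1..m. (v j)\<^sup>2)"
    by (rule real_le_rsqrt)
  then show ?thesis
    using c by (simp add: x_def field_simps)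
qed

end

section \<open>A maximal inequality for exchangeable arrays\<close>

lemma (in prob_space) indep_vars_reindex:
  assumes X: "indep_vars M' X I" and \<pi>: "inj_on \<pi> J" "\<pi> ` J \<subseteq> I"
  shows "indep_vars (\<lambda>j. M' (\<pi> j)) (\<lambda>j. X (\<pi> j)) J"
proof -
  have "indep_vars (\<lambda>j. PiM {\<pi> j} M') (\<lambda>j \<omega>. restrict (\<lambda>i. X i \<omega>) {\<pi> j}) J"
    using \<pi> by (intro indep_vars_restrict[OF X]) (auto simp: disjoint_family_on_def inj_on_def)
  then have "indep_vars (\<lambda>j. M' (\<pi> j)) (\<lambda>j \<omega>. (\<lambda>f. f (\<pi> j)) (restrict (\<lambda>i. X i \<omega>) {\<pi> j})) J"
    by (rule indep_vars_compose2) (intro measurable_component_singleton, simp)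
  then show ?thesis
    by simp
qed

lemma (in prob_space) iid_indep_vars: "iid M X I \<Longrightarrow> indep_vars (\<lambda>_. borel) X I"
  unfolding iid_def by blast

lemma (in prob_space) iid_distr_eq:
  "iid M X I \<Longrightarrow> i \<in> I \<Longrightarrow> j \<in> I \<Longrightarrow> distr M borel (X i) = distr M borel (X j)"
  unfolding iid_def by blast

lemma (in prob_space) iid_random_variable: "iid M X I \<Longrightarrow> i \<in> I \<Longrightarrow> random_variable borel (X i)"
  using iid_indep_vars unfolding indep_vars_def by blast

lemma (in prob_space) iid_subset: "iid M X I \<Longrightarrow> J \<subseteq> I \<Longrightarrow> iid M X J"
  using indep_vars_subset[of "\<lambda>_. borel" X I J] unfolding iid_def by blast

lemma (in prob_space) iid_compose:
  assumes X: "iid M X I" and g: "g \<in> borel_measurable borel"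
  shows "iid M (\<lambda>i \<omega>. g (X i \<omega>)) I"
proof -
  have "indep_vars (\<lambda>_. borel) (\<lambda>i \<omega>. g (X i \<omega>)) I"
    using g by (intro indep_vars_compose2[OF iid_indep_vars[OF X]]) auto
  moreover have d: "distr M borel (\<lambda>\<omega>. g (X i \<omega>)) = distr (distr M borel (X i)) borel g" if "i \<in> I" for i
    using g iid_random_variable[OF X that] by (subst distr_distr) (auto simp: comp_def)
  have "distr M borel (\<lambda>\<omega>. g (X i \<omega>)) = distr M borel (\<lambda>\<omega>. g (X j \<omega>))" if "i \<in> I" "j \<in> I" for i j
    unfolding d[OF that(1)] d[OF that(2)] iid_distr_eq[OF X that] ..
  ultimately show ?thesis
    unfolding iid_def by blast
qed

lemma (in prob_space) iid_expectation_eq: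
  fixes g :: "real \<Rightarrow> real"
  assumes X: "iid M X I" and ij: "i \<in> I" "j \<in> I" and g: "g \<in> borel_measurable borel"
  shows "expectation (\<lambda>\<omega>. g (X i \<omega>)) = expectation (\<lambda>\<omega>. g (X j \<omega>))"
  using integral_distr[OF iid_random_variable[OF X ij(1)] g] integral_distr[OF iid_random_variable[OF X ij(2)] g]
    iid_distr_eq[OF X ij] by metis

lemma (in prob_space) iid_integrable_iff:
  fixes g :: "real \<Rightarrow> real"
  assumes X: "iid M X I" and ij: "i \<in> I" "j \<in> I" and g: "g \<in> borel_measurable borel"
  shows "integrable M (\<lambda>\<omega>. g (X i \<omega>)) \<longleftrightarrow> integrable M (\<lambda>\<omega>. g (X j \<omega>))"
  using integrable_distr_eq[OF iid_random_variable[OF X ij(1)] g] integrable_distr_eq[OF iid_random_variable[OF X ij(2)] g]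
    iid_distr_eq[OF X ij] by metis

text \<open>The joint law is the product of the marginal laws, and these are all equal, so permuting
  the indices leaves it unchanged.\<close>

lemma (in prob_space) iid_distr_permute:
  assumes X: "iid M X I" and I: "I \<noteq> {}" and \<pi>: "bij_betw \<pi> I I"
  shows "distr M (PiM I (\<lambda>_. borel)) (\<lambda>\<omega>. \<lambda>i\<in>I. X (\<pi> i) \<omega>)
       = distr M (PiM I (\<lambda>_. borel)) (\<lambda>\<omega>. \<lambda>i\<in>I. X i \<omega>)"
proof -
  note ind = iid_indep_vars[OF X]
  note rv = iid_random_variable[OF X]
  have \<pi>I: "\<pi> i \<in> I" if "i \<in> I" for i
    using \<pi> that by (auto simp: bij_betw_def)
  have ind': "indep_vars (\<lambda>_. borel) (\<lambda>i. X (\<pi> i)) I"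
    using indep_vars_reindex[OF ind, of \<pi> I] \<pi> by (auto simp: bij_betw_def)
  have "distr M (PiM I (\<lambda>_. borel)) (\<lambda>\<omega>. \<lambda>i\<in>I. X (\<pi> i) \<omega>) = PiM I (\<lambda>i. distr M borel (X (\<pi> i)))"
    by (rule iffD1[OF indep_vars_iff_distr_eq_PiM'[OF I rv[OF \<pi>I]] ind'])
  also have "\<dots> = PiM I (\<lambda>i. distr M borel (X i))"
    by (rule PiM_cong) (auto intro: iid_distr_eq[OF X] \<pi>I)
  also have "\<dots> = distr M (PiM I (\<lambda>_. borel)) (\<lambda>\<omega>. \<lambda>i\<in>I. X i \<omega>)"
    by (rule iffD1[OF indep_vars_iff_distr_eq_PiM'[OF I rv] ind, symmetric])
  finally show ?thesis .
qed

lemma (in prob_space) iid_integral_permute: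
  fixes h :: "('i \<Rightarrow> real) \<Rightarrow> real"
  assumes X: "iid M X I" and I: "I \<noteq> {}" and \<pi>: "bij_betw \<pi> I I"
    and h: "h \<in> borel_measurable (PiM I (\<lambda>_. borel))"
  shows "expectation (\<lambda>\<omega>. h (\<lambda>i\<in>I. X (\<pi> i) \<omega>)) = expectation (\<lambda>\<omega>. h (\<lambda>i\<in>I. X i \<omega>))"
    and "integrable M (\<lambda>\<omega>. h (\<lambda>i\<in>I. X (\<pi> i) \<omega>)) \<longleftrightarrow> integrable M (\<lambda>\<omega>. h (\<lambda>i\<in>I. X i \<omega>))"
proof -
  note eq = iid_distr_permute[OF X I \<pi>]
  have \<pi>I: "\<pi> i \<in> I" if "i \<in> I" for i
    using \<pi> that by (auto simp: bij_betw_def)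
  have m1: "(\<lambda>\<omega>. \<lambda>i\<in>I. X (\<pi> i) \<omega>) \<in> measurable M (PiM I (\<lambda>_. borel))"
    by (intro measurable_restrict iid_random_variable[OF X] \<pi>I)
  have m2: "(\<lambda>\<omega>. \<lambda>i\<in>I. X i \<omega>) \<in> measurable M (PiM I (\<lambda>_. borel))"
    by (intro measurable_restrict iid_random_variable[OF X])
  show "expectation (\<lambda>\<omega>. h (\<lambda>i\<in>I. X (\<pi> i) \<omega>)) = expectation (\<lambda>\<omega>. h (\<lambda>i\<in>I. X i \<omega>))"
    using integral_distr[OF m1 h] integral_distr[OF m2 h] unfolding eq by simp
  show "integrable M (\<lambda>\<omega>. h (\<lambda>i\<in>I. X (\<pi> i) \<omega>)) \<longleftrightarrow> integrable M (\<lambda>\<omega>. h (\<lambda>i\<in>I. X i \<omega>))"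
    using integrable_distr_eq[OF m1 h] integrable_distr_eq[OF m2 h] unfolding eq by simp
qed

abbreviation swap_rows :: "nat \<Rightarrow> nat \<Rightarrow> (nat \<Rightarrow> 'b) \<Rightarrow> nat \<Rightarrow> 'b" where
  "swap_rows a b x \<equiv> (\<lambda>i. x (Transposition.transpose a b i))"

text \<open>The statistics \<open>\<phi> n\<close> form a reverse submartingale: conditionally on the symmetric functions of the
  first \<open>Suc n\<close> rows all statistics \<open>\<phi> n\<close> with one of these rows left out have the same law, and their
  average dominates \<open>\<phi> (Suc n)\<close>. The inequality is Doob's, and the conditioning is replaced by the
  invariance of expectations under transpositions of rows.\<close>

locale exchangeable_statistic = prob_space M for M :: "'w measure" +
  fixes X :: "nat \<Rightarrow> nat \<Rightarrow> 'w \<Rightarrow> real" and m a :: nat and \<phi> :: "nat \<Rightarrow> (nat \<Rightarrow> nat \<Rightarrow> real) \<Rightarrow> real"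
  assumes iid_X: "iid M (\<lambda>(i, j). X i j) ({1..} \<times> {1..m})"
    and m_pos: "1 \<le> m" and a_pos: "1 \<le> a"
    and local: "\<And>n x y. (\<And>i j. i \<in> {1..n} \<Longrightarrow> j \<in> {1..m} \<Longrightarrow> x i j = y i j) \<Longrightarrow> \<phi> n x = \<phi> n y"
    and symmetric: "\<And>n x k i. k \<in> {1..n} \<Longrightarrow> i \<in> {1..n} \<Longrightarrow> \<phi> n (swap_rows k i x) = \<phi> n x"
    and leave_one_out: "\<And>n x. a \<le> n \<Longrightarrow>
          \<phi> (Suc n) x \<le> (1 / real (Suc n)) * (\<Sum>k=1..Suc n. \<phi> n (swap_rows k (Suc n) x))"
    and measurable_\<phi>: "\<And>n. (\<lambda>f. \<phi> n (\<lambda>i j. f (i, j))) \<in> borel_measurable (PiM ({1..} \<times> {1..m}) (\<lambda>_. borel))"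
    and integrable_\<phi>: "\<And>n. a \<le> n \<Longrightarrow> integrable M (\<lambda>\<omega>. \<phi> n (\<lambda>i j. X i j \<omega>))"
    and nonneg: "\<And>n x. 0 \<le> \<phi> n x"
begin

abbreviation \<xi> :: "'w \<Rightarrow> nat \<Rightarrow> nat \<Rightarrow> real" where
  "\<xi> \<omega> \<equiv> (\<lambda>i j. X i j \<omega>)"

text \<open>The stopping time of Doob's argument: as the martingale runs backwards in n, the largest
  exceedance index up to N is met first. The condition involves only statistics of at least n rows,
  and is thus invariant under permutations of the first n rows.\<close>

definition last_exceedance :: "real \<Rightarrow> nat \<Rightarrow> nat \<Rightarrow> (nat \<Rightarrow> nat \<Rightarrow> real) \<Rightarrow> real" where
  "last_exceedance t N n x = of_bool (t \<le> \<phi> n x \<and> (\<forall>k\<in>{n<..N}. \<phi> k x < t))"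

lemma measurable_\<phi>_\<xi> [measurable]: "(\<lambda>\<omega>. \<phi> n (\<xi> \<omega>)) \<in> borel_measurable M"
proof -
  have X: "(\<lambda>\<omega>. \<lambda>p\<in>{1..} \<times> {1..m}. X (fst p) (snd p) \<omega>) \<in> measurable M (PiM ({1..} \<times> {1..m}) (\<lambda>_. borel))"
    using iid_random_variable[OF iid_X] by (intro measurable_restrict) (auto simp: case_prod_beta)
  have eq: "\<phi> n (\<xi> \<omega>) = \<phi> n (\<lambda>i j. (\<lambda>p\<in>{1..} \<times> {1..m}. X (fst p) (snd p) \<omega>) (i, j))" for \<omega>
    by (rule local) auto
  show ?thesis
    unfolding eq by (rule measurable_compose[OF X measurable_\<phi>])
qed

lemma measurable_last_exceedance [measurable]:
  "(\<lambda>\<omega>. last_exceedance t N n (\<xi> \<omega>)) \<in> borel_measurable M"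
  unfolding last_exceedance_def of_bool_def by measurable

lemma integrable_last_exceedance:
  assumes "a \<le> k"
  shows "integrable M (\<lambda>\<omega>. last_exceedance t N n (\<xi> \<omega>) * \<phi> k (\<xi> \<omega>))"
  by (rule Bochner_Integration.integrable_bound[OF integrable_\<phi>[OF assms]])
    (auto simp: last_exceedance_def nonneg)

lemma swap_integral:
  assumes i: "1 \<le> i" "1 \<le> i'"
  shows "expectation (\<lambda>\<omega>. last_exceedance t N n (swap_rows i i' (\<xi> \<omega>)) * \<phi> k (swap_rows i i' (\<xi> \<omega>)))
       = expectation (\<lambda>\<omega>. last_exceedance t N n (\<xi> \<omega>) * \<phi> k (\<xi> \<omega>))" (is ?E)
    and "a \<le> k \<Longrightarrow> integrable M (\<lambda>\<omega>. last_exceedance t N n (swap_rows i i' (\<xi> \<omega>)) * \<phi> k (swap_rows i i' (\<xi> \<omega>)))"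
      (is "_ \<Longrightarrow> ?J")
proof -
  let ?I = "{1::nat..} \<times> {1..m}"
  let ?\<tau> = "Transposition.transpose i i'"
  define h where "h f = last_exceedance t N n (\<lambda>i j. f (i, j)) * \<phi> k (\<lambda>i j. f (i, j))" for f :: "nat \<times> nat \<Rightarrow> real"
  define \<pi> where "\<pi> p = (?\<tau> (fst p), snd p)" for p :: "nat \<times> nat"
  have \<tau>: "1 \<le> ?\<tau> r" if "1 \<le> r" for r
    using that i by (auto simp: Transposition.transpose_def)
  have I: "?I \<noteq> {}"
    using m_pos by auto
  have \<pi>: "bij_betw \<pi> ?I ?I"
  proof (rule bij_betw_byWitness[where f' = \<pi>])
    show "\<forall>p\<in>?I. \<pi> (\<pi> p) = p" "\<forall>p\<in>?I. \<pi> (\<pi> p) = p"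
      by (simp_all add: \<pi>_def)
    show "\<pi> ` ?I \<subseteq> ?I" "\<pi> ` ?I \<subseteq> ?I"
      unfolding \<pi>_def by (intro image_subsetI; simp only: mem_Times_iff fst_conv snd_conv atLeast_iff \<tau> simp_thms)+
  qed
  have h: "h \<in> borel_measurable (PiM ?I (\<lambda>_. borel))"
    unfolding h_def last_exceedance_def of_bool_def using measurable_\<phi> by measurable
  have h1: "h (\<lambda>p\<in>?I. (\<lambda>(i, j). X i j) (\<pi> p) \<omega>)
      = last_exceedance t N n (swap_rows i i' (\<xi> \<omega>)) * \<phi> k (swap_rows i i' (\<xi> \<omega>))" for \<omega>
  proof -
    have "\<phi> r (\<lambda>i j. (\<lambda>p\<in>?I. (\<lambda>(i, j). X i j) (\<pi> p) \<omega>) (i, j)) = \<phi> r (swap_rows i i' (\<xi> \<omega>))" for r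
      by (rule local) (auto simp: \<pi>_def)
    then show ?thesis
      unfolding h_def last_exceedance_def by presburger
  qed
  have h2: "h (\<lambda>p\<in>?I. (\<lambda>(i, j). X i j) p \<omega>) = last_exceedance t N n (\<xi> \<omega>) * \<phi> k (\<xi> \<omega>)" for \<omega>
  proof -
    have "\<phi> r (\<lambda>i j. (\<lambda>p\<in>?I. (\<lambda>(i, j). X i j) p \<omega>) (i, j)) = \<phi> r (\<xi> \<omega>)" for r
      by (rule local) auto
    then show ?thesis
      unfolding h_def last_exceedance_def by presburger
  qed
  note * = iid_integral_permute[OF iid_X I \<pi> h, unfolded h1 h2]
  show ?E
    by (rule *(1))
  show ?J if "a \<le> k"
    using *(2) integrable_last_exceedance[OF that] by blast
qed

text \<open>The submartingale inequality integrated over the stopping event. That event is symmetric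
  in the first n rows, and \<open>Suc k\<close> is at most n, so all versions of
  \<open>\<phi> k\<close> with one of the first \<open>Suc k\<close> rows left out have the same
  integral over it.\<close>

lemma last_exceedance_step:
  assumes k: "a \<le> k" "k < n"
  shows "expectation (\<lambda>\<omega>. last_exceedance t N n (\<xi> \<omega>) * \<phi> (Suc k) (\<xi> \<omega>))
       \<le> expectation (\<lambda>\<omega>. last_exceedance t N n (\<xi> \<omega>) * \<phi> k (\<xi> \<omega>))"
proof -
  let ?L = "last_exceedance t N n"
  have L_sym: "?L (swap_rows i (Suc k) x) = ?L x" if i: "i \<in> {1..Suc k}" for i x
  proof -
    have "\<phi> r (swap_rows i (Suc k) x) = \<phi> r x" if "n \<le> r" for r
      using that i k by (intro symmetric) auto
    then show ?thesis
      by (simp add: last_exceedance_def)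
  qed
  define g where "g i \<omega> = ?L (swap_rows i (Suc k) (\<xi> \<omega>)) * \<phi> k (swap_rows i (Suc k) (\<xi> \<omega>))" for i \<omega>
  have int_g: "integrable M (g i)" if "i \<in> {1..Suc k}" for i
    unfolding g_def using that k by (intro swap_integral) auto
  have exp_g: "expectation (g i) = expectation (\<lambda>\<omega>. ?L (\<xi> \<omega>) * \<phi> k (\<xi> \<omega>))" if "i \<in> {1..Suc k}" for i
    unfolding g_def using that by (intro swap_integral) auto
  have "expectation (\<lambda>\<omega>. ?L (\<xi> \<omega>) * \<phi> (Suc k) (\<xi> \<omega>)) \<le> expectation (\<lambda>\<omega>. (1 / real (Suc k)) * (\<Sum>i=1..Suc k. g i \<omega>))"
  proof (rule integral_mono)
    show "integrable M (\<lambda>\<omega>. ?L (\<xi> \<omega>) * \<phi> (Suc k) (\<xi> \<omega>))"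
      using k by (intro integrable_last_exceedance) auto
    show "integrable M (\<lambda>\<omega>. (1 / real (Suc k)) * (\<Sum>i=1..Suc k. g i \<omega>))"
      by (intro integrable_mult_right Bochner_Integration.integrable_sum int_g)
    fix \<omega>
    have "?L (\<xi> \<omega>) * \<phi> (Suc k) (\<xi> \<omega>)
        \<le> ?L (\<xi> \<omega>) * ((1 / real (Suc k)) * (\<Sum>i=1..Suc k. \<phi> k (swap_rows i (Suc k) (\<xi> \<omega>))))"
      by (intro mult_left_mono leave_one_out k) (simp add: last_exceedance_def)
    also have "\<dots> = (1 / real (Suc k)) * (\<Sum>i=1..Suc k. ?L (\<xi> \<omega>) * \<phi> k (swap_rows i (Suc k) (\<xi> \<omega>)))"
      by (simp only: sum_distrib_left mult.left_commute)
    also have "(\<Sum>i=1..Suc k. ?L (\<xi> \<omega>) * \<phi> k (swap_rows i (Suc k) (\<xi> \<omega>))) = (\<Sum>i=1..Suc k. g i \<omega>)"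
      unfolding g_def by (intro sum.cong refl arg_cong2[where f = times] L_sym[symmetric])
    finally show "?L (\<xi> \<omega>) * \<phi> (Suc k) (\<xi> \<omega>) \<le> (1 / real (Suc k)) * (\<Sum>i=1..Suc k. g i \<omega>)" .
  qed
  also have "\<dots> = (1 / real (Suc k)) * (\<Sum>i=1..Suc k. expectation (g i))"
    by (simp only: integral_mult_right_zero Bochner_Integration.integral_sum[OF int_g])
  also have "\<dots> = expectation (\<lambda>\<omega>. ?L (\<xi> \<omega>) * \<phi> k (\<xi> \<omega>))"
    by (simp add: exp_g)
  finally show ?thesis .
qed

lemma last_exceedance_first:
  assumes "a \<le> n"
  shows "expectation (\<lambda>\<omega>. last_exceedance t N n (\<xi> \<omega>) * \<phi> n (\<xi> \<omega>))
       \<le> expectation (\<lambda>\<omega>. last_exceedance t N n (\<xi> \<omega>) * \<phi> a (\<xi> \<omega>))"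
proof -
  have "expectation (\<lambda>\<omega>. last_exceedance t N n (\<xi> \<omega>) * \<phi> k (\<xi> \<omega>))
       \<le> expectation (\<lambda>\<omega>. last_exceedance t N n (\<xi> \<omega>) * \<phi> a (\<xi> \<omega>))" if "a \<le> k" "k \<le> n" for k
    using that
  proof (induction k rule: dec_induct)
    case (step k)
    then show ?case
      using last_exceedance_step[of k n t N] by simp
  qed simp
  then show ?thesis
    using assms by blast
qed

lemma sum_last_exceedance:
  "(\<Sum>n=a..N. last_exceedance t N n x) = of_bool (\<exists>n\<in>{a..N}. t \<le> \<phi> n x)"
proof (cases "\<exists>n\<in>{a..N}. t \<le> \<phi> n x")
  case True
  define S where "S = {n\<in>{a..N}. t \<le> \<phi> n x}"
  have S: "finite S" "S \<noteq> {}"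
    using True by (auto simp: S_def)
  have Max_S: "Max S \<in> S"
    using S by (rule Max_in)
  have "last_exceedance t N n x = of_bool (n = Max S)" if n: "n \<in> {a..N}" for n
  proof (cases "n = Max S")
    case True
    have "\<phi> k x < t" if "k \<in> {n<..N}" for k
    proof (rule ccontr)
      assume "\<not> \<phi> k x < t"
      then have "k \<in> S"
        using that n by (auto simp: S_def)
      then show False
        using Max_ge[OF S(1), of k] that True by auto
    qed
    then show ?thesis
      using True Max_S by (auto simp: last_exceedance_def S_def)
  next
    case False
    show ?thesis
    proof -
      have "\<not> (t \<le> \<phi> n x \<and> (\<forall>k\<in>{n<..N}. \<phi> k x < t))"
      proof (intro notI, elim conjE)
        assume n': "t \<le> \<phi> n x" and later: "\<forall>k\<in>{n<..N}. \<phi> k x < t"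
        have "n \<in> S"
          using n n' by (simp add: S_def)
        then have "n < Max S"
          using False Max_ge[OF S(1)] by (simp add: le_neq_implies_less)
        moreover have "Max S \<le> N" "t \<le> \<phi> (Max S) x"
          using Max_S unfolding S_def by auto
        ultimately show False
          using later[rule_format, of "Max S"] by simp
      qed
      then show ?thesis
        using False by (simp add: last_exceedance_def)
    qed
  qed
  then have "(\<Sum>n=a..N. last_exceedance t N n x) = (\<Sum>n=a..N. of_bool (n = Max S))"
    by simp
  also have "\<dots> = 1"
    using Max_S by (auto simp: S_def of_bool_def)
  finally show ?thesis
    using True by simp
qed (auto simp: last_exceedance_def intro!: sum.neutral)

theorem maximal_inequality:
  assumes t: "0 < t"
  shows "prob {\<omega> \<in> space M. \<exists>n\<ge>a. t \<le> \<phi> n (\<xi> \<omega>)} \<le> expectation (\<lambda>\<omega>. \<phi> a (\<xi> \<omega>)) / t"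
proof -
  define Ev where "Ev N = {\<omega> \<in> space M. \<exists>n\<in>{a..N}. t \<le> \<phi> n (\<xi> \<omega>)}" for N
  have [measurable]: "Ev N \<in> sets M" for N
    unfolding Ev_def by measurable
  have bound: "prob (Ev N) \<le> expectation (\<lambda>\<omega>. \<phi> a (\<xi> \<omega>)) / t" for N
  proof -
    let ?L = "last_exceedance t N"
    have int_L: "integrable M (\<lambda>\<omega>. ?L n (\<xi> \<omega>))" for n
      by (rule integrable_const_bound[where B = 1]) (auto simp: last_exceedance_def)
    have "t * prob (Ev N) = expectation (\<lambda>\<omega>. t * of_bool (\<exists>n\<in>{a..N}. t \<le> \<phi> n (\<xi> \<omega>)))"
    proof -
      have "expectation (\<lambda>\<omega>. of_bool (\<exists>n\<in>{a..N}. t \<le> \<phi> n (\<xi> \<omega>))) = expectation (indicator (Ev N) :: 'w \<Rightarrow> real)"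
        by (intro Bochner_Integration.integral_cong) (auto simp: Ev_def indicator_def)
      then show ?thesis
        by simp
    qed
    also have "\<dots> = expectation (\<lambda>\<omega>. \<Sum>n=a..N. t * ?L n (\<xi> \<omega>))"
      by (simp add: sum_last_exceedance[symmetric] sum_distrib_left)
    also have "\<dots> = (\<Sum>n=a..N. expectation (\<lambda>\<omega>. t * ?L n (\<xi> \<omega>)))"
      by (intro Bochner_Integration.integral_sum integrable_mult_right int_L)
    \<comment> \<open>On the nth event the threshold is at most \<open>\<phi> n\<close>, whose
      integral is at most that of \<open>\<phi> a\<close>; as the events are disjoint, the integrals
      add up to at most the full expectation.\<close>
    also have "\<dots> \<le> (\<Sum>n=a..N. expectation (\<lambda>\<omega>. ?L n (\<xi> \<omega>) * \<phi> a (\<xi> \<omega>)))"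
    proof (rule sum_mono)
      fix n assume n: "n \<in> {a..N}"
      have "expectation (\<lambda>\<omega>. t * ?L n (\<xi> \<omega>)) \<le> expectation (\<lambda>\<omega>. ?L n (\<xi> \<omega>) * \<phi> n (\<xi> \<omega>))"
        using n by (intro integral_mono integrable_mult_right int_L integrable_last_exceedance)
          (auto simp: last_exceedance_def)
      also have "\<dots> \<le> expectation (\<lambda>\<omega>. ?L n (\<xi> \<omega>) * \<phi> a (\<xi> \<omega>))"
        using n by (intro last_exceedance_first) auto
      finally show "expectation (\<lambda>\<omega>. t * ?L n (\<xi> \<omega>)) \<le> expectation (\<lambda>\<omega>. ?L n (\<xi> \<omega>) * \<phi> a (\<xi> \<omega>))" .
    qed
    also have "\<dots> = expectation (\<lambda>\<omega>. \<Sum>n=a..N. ?L n (\<xi> \<omega>) * \<phi> a (\<xi> \<omega>))"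
      by (intro Bochner_Integration.integral_sum[symmetric] integrable_last_exceedance order_refl)
    also have "\<dots> \<le> expectation (\<lambda>\<omega>. \<phi> a (\<xi> \<omega>))"
    proof (intro integral_mono Bochner_Integration.integrable_sum integrable_last_exceedance integrable_\<phi> order_refl)
      fix \<omega>
      show "(\<Sum>n=a..N. ?L n (\<xi> \<omega>) * \<phi> a (\<xi> \<omega>)) \<le> \<phi> a (\<xi> \<omega>)"
        unfolding sum_distrib_right[symmetric] sum_last_exceedance by (simp add: nonneg)
    qed
    finally show ?thesis
      using t by (simp add: field_simps)
  qed
  \<comment> \<open>The finite horizon N, without which there need not be a last exceedance, is
    removed by continuity from below.\<close>
  have "incseq Ev"
    by (fastforce simp: incseq_def Ev_def)
  then have "(\<lambda>N. prob (Ev N)) \<longlonglongrightarrow> prob (\<Union>N. Ev N)"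
    by (intro finite_Lim_measure_incseq) auto
  moreover have "(\<Union>N. Ev N) = {\<omega> \<in> space M. \<exists>n\<ge>a. t \<le> \<phi> n (\<xi> \<omega>)}"
    by (auto simp: Ev_def) force
  ultimately show ?thesis
    using bound by (intro LIMSEQ_le_const2) auto
qed

end

section \<open>Sample mean and sample variance\<close>

abbreviation mean_norm :: "nat \<Rightarrow> nat \<Rightarrow> (nat \<Rightarrow> nat \<Rightarrow> real) \<Rightarrow> real" where
  "mean_norm m n x \<equiv> L2_set (sample_mean m n x) {1..m}"

lemma sum_permute_rows:
  fixes y :: "nat \<Rightarrow> 'b::comm_monoid_add"
  assumes "k \<in> S" "i \<in> S"
  shows "(\<Sum>r\<in>S. y (Transposition.transpose k i r)) = (\<Sum>r\<in>S. y r)"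
  using sum.permute[OF permutes_swap_id[OF assms], of y] by (simp add: comp_def)

lemma sum_leave_one_out:
  fixes y :: "nat \<Rightarrow> real"
  assumes "k \<in> {1..Suc n}"
  shows "(\<Sum>r=1..n. y (Transposition.transpose k (Suc n) r)) = (\<Sum>r=1..Suc n. y r) - y k"
  using sum_permute_rows[of k "{1..Suc n}" "Suc n" y] assms by simp

lemma sample_mean_swap:
  assumes "k \<in> {1..n}" "i \<in> {1..n}"
  shows "sample_mean m n (swap_rows k i x) = sample_mean m n x"
proof -
  have "(\<Sum>r=1..n. x (Transposition.transpose k i r) j) = (\<Sum>r=1..n. x r j)" for j
    by (rule sum_permute_rows[OF assms, of "\<lambda>r. x r j"])
  then show ?thesis
    unfolding sample_mean_def by presburger
qed

text \<open>Each row is missing from exactly one of the \<open>Suc n\<close> shortened samples, so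
  their sums add up to n times the full sum. This is the reverse martingale property in algebraic
  form.\<close>

lemma sample_mean_leave_one_out:
  assumes "1 \<le> n"
  shows "sample_mean m (Suc n) x j = (1 / real (Suc n)) * (\<Sum>k=1..Suc n. sample_mean m n (swap_rows k (Suc n) x) j)"
proof (cases "j \<in> {1..m}")
  case True
  define S where "S = (\<Sum>r=1..Suc n. x r j)"
  have "(\<Sum>k=1..Suc n. sample_mean m n (swap_rows k (Suc n) x) j) = (\<Sum>k=1..Suc n. (1 / real n) * (S - x k j))"
  proof (rule sum.cong)
    fix k assume k: "k \<in> {1..Suc n}"
    show "sample_mean m n (swap_rows k (Suc n) x) j = (1 / real n) * (S - x k j)"
      using True sum_leave_one_out[OF k, of "\<lambda>r. x r j"] by (simp add: sample_mean_def S_def)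
  qed simp
  also have "\<dots> = (1 / real n) * (real (Suc n) * S - S)"
    unfolding sum_distrib_left[symmetric] sum_subtractf S_def[symmetric] by simp
  also have "\<dots> = S"
    using assms by (simp add: field_simps)
  finally show ?thesis
    using True by (simp add: sample_mean_def S_def)
next
  case False
  then show ?thesis
    unfolding sample_mean_def if_not_P[OF False] by simp
qed

lemma L2_set_sum_le: "L2_set (\<lambda>j. \<Sum>k\<in>S. f k j) J \<le> (\<Sum>k\<in>S. L2_set (f k) J)"
proof (induction S rule: infinite_finite_induct)
  case (insert k S)
  then show ?case
    using L2_set_triangle_ineq[of "f k" "\<lambda>j. \<Sum>k\<in>S. f k j" J] by simp
qed (simp_all add: L2_set_0')

text \<open>The norm is convex: the triangle inequality turns the identity for means into the
  inequality required of a reverse submartingale.\<close>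

lemma mean_norm_leave_one_out:
  assumes "1 \<le> n"
  shows "mean_norm m (Suc n) x \<le> (1 / real (Suc n)) * (\<Sum>k=1..Suc n. mean_norm m n (swap_rows k (Suc n) x))"
proof -
  have "mean_norm m (Suc n) x
      = L2_set (\<lambda>j. (1 / real (Suc n)) * (\<Sum>k=1..Suc n. sample_mean m n (swap_rows k (Suc n) x) j)) {1..m}"
    by (rule arg_cong2[where f = L2_set]) (auto simp: sample_mean_leave_one_out[OF assms])
  also have "\<dots> = (1 / real (Suc n)) * L2_set (\<lambda>j. \<Sum>k=1..Suc n. sample_mean m n (swap_rows k (Suc n) x) j) {1..m}"
    by (rule L2_set_right_distrib[symmetric]) simp
  also have "\<dots> \<le> (1 / real (Suc n)) * (\<Sum>k=1..Suc n. mean_norm m n (swap_rows k (Suc n) x))"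
    by (intro mult_left_mono L2_set_sum_le) simp
  finally show ?thesis .
qed

section \<open>Sample variances as reverse martingales\<close>

lemma sum_squared_deviations:
  fixes y :: "nat \<Rightarrow> real"
  shows "(\<Sum>i=1..n. (y i - (1 / real n) * (\<Sum>l=1..n. y l))\<^sup>2) = (\<Sum>i=1..n. (y i)\<^sup>2) - (\<Sum>i=1..n. y i)\<^sup>2 / real n"
proof (cases "n = 0")
  case False
  define S where "S = (\<Sum>i=1..n. y i)"
  have "(\<Sum>i=1..n. (y i - (1 / real n) * S)\<^sup>2) = (\<Sum>i=1..n. (y i)\<^sup>2 - 2 * (1 / real n) * S * y i + ((1 / real n) * S)\<^sup>2)"
    by (rule sum.cong) (simp_all add: power2_diff algebra_simps)
  also have "\<dots> = (\<Sum>i=1..n. (y i)\<^sup>2) - 2 * (1 / real n) * S * S + real n * ((1 / real n) * S)\<^sup>2"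
    unfolding sum.distrib sum_subtractf sum_distrib_left[symmetric] S_def[symmetric] by simp
  also have "\<dots> = (\<Sum>i=1..n. (y i)\<^sup>2) - S\<^sup>2 / real n"
    using False by (simp add: power2_eq_square field_simps)
  finally show ?thesis
    by (simp add: S_def)
qed simp

text \<open>Sum of squared deviations from the mean. It is a function of two power sums, from which
  symmetry in the rows and independence between columns are immediate.\<close>

definition centered_squares :: "nat \<Rightarrow> (nat \<Rightarrow> real) \<Rightarrow> real" where
  "centered_squares n y = (\<Sum>i=1..n. (y i)\<^sup>2) - (\<Sum>i=1..n. y i)\<^sup>2 / real n"

lemma centered_squares_nonneg: "0 \<le> centered_squares n y"
  unfolding centered_squares_def sum_squared_deviations[symmetric] by (rule sum_nonneg) simp

lemma centered_squares_le: "centered_squares n y \<le> (\<Sum>i=1..n. (y i)\<^sup>2)"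
  by (simp add: centered_squares_def)

lemma sample_var_eq:
  "sample_var m n x = (1 / real m) * (\<Sum>j=1..m. (1 / (real n - 1)) * centered_squares n (\<lambda>i. x i j))"
  unfolding sample_var_def centered_squares_def sum_squared_deviations ..

text \<open>In this form only differences of observations enter, so a map that does not increase
  distances cannot increase it.\<close>

lemma centered_squares_pairs:
  assumes "1 \<le> n"
  shows "centered_squares n y = (1 / (2 * real n)) * (\<Sum>i=1..n. \<Sum>k=1..n. (y i - y k)\<^sup>2)"
proof -
  define S Q where "S = (\<Sum>i=1..n. y i)" and "Q = (\<Sum>i=1..n. (y i)\<^sup>2)"
  have "(\<Sum>k=1..n. (y i - y k)\<^sup>2) = real n * (y i)\<^sup>2 - 2 * S * y i + Q" for i
  proof -
    have "(\<Sum>k=1..n. (y i - y k)\<^sup>2) = (\<Sum>k=1..n. (y i)\<^sup>2 - 2 * y i * y k + (y k)\<^sup>2)"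
      by (rule sum.cong) (simp_all add: power2_diff)
    also have "\<dots> = real n * (y i)\<^sup>2 - 2 * y i * S + Q"
      unfolding sum.distrib sum_subtractf sum_distrib_left[symmetric] S_def[symmetric] Q_def[symmetric] by simp
    finally show ?thesis
      by simp
  qed
  then have "(\<Sum>i=1..n. \<Sum>k=1..n. (y i - y k)\<^sup>2) = (\<Sum>i=1..n. real n * (y i)\<^sup>2 - 2 * S * y i + Q)"
    by simp
  also have "\<dots> = real n * Q - 2 * S * S + real n * Q"
    unfolding sum.distrib sum_subtractf sum_distrib_left[symmetric] S_def[symmetric] Q_def[symmetric] by simp
  finally have pairs: "(\<Sum>i=1..n. \<Sum>k=1..n. (y i - y k)\<^sup>2) = 2 * real n * Q - 2 * S\<^sup>2"
    by (simp add: power2_eq_square)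
  show ?thesis
    unfolding centered_squares_def pairs S_def[symmetric] Q_def[symmetric]
    using assms by (simp add: field_simps)
qed

text \<open>With the normalisation n - 1 the sample variance is an average of (y_i - y_k)^2 / 2 over
  pairs, and every pair survives equally many omissions; the proof computes with power sums
  instead.\<close>

lemma centered_squares_leave_one_out:
  assumes "2 \<le> n"
  shows "(1 / real n) * centered_squares (Suc n) y
      = (1 / real (Suc n)) * (\<Sum>k=1..Suc n. (1 / (real n - 1)) * centered_squares n (swap_rows k (Suc n) y))"
proof -
  define S Q where "S = (\<Sum>i=1..Suc n. y i)" and "Q = (\<Sum>i=1..Suc n. (y i)\<^sup>2)"
  have "centered_squares n (swap_rows k (Suc n) y) = (Q - S\<^sup>2 / real n) + 2 * S / real n * y k - (1 + 1 / real n) * (y k)\<^sup>2"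
    if k: "k \<in> {1..Suc n}" for k
  proof -
    have "centered_squares n (swap_rows k (Suc n) y) = (Q - (y k)\<^sup>2) - (S - y k)\<^sup>2 / real n"
      unfolding centered_squares_def
        sum_leave_one_out[OF k, of y, folded S_def] sum_leave_one_out[OF k, of "\<lambda>i. (y i)\<^sup>2", folded Q_def] ..
    also have "\<dots> = (Q - S\<^sup>2 / real n) + 2 * S / real n * y k - (1 + 1 / real n) * (y k)\<^sup>2"
      using assms by (simp add: power2_diff field_simps)
    finally show ?thesis .
  qed
  then have "(\<Sum>k=1..Suc n. centered_squares n (swap_rows k (Suc n) y))
      = (\<Sum>k=1..Suc n. (Q - S\<^sup>2 / real n) + 2 * S / real n * y k - (1 + 1 / real n) * (y k)\<^sup>2)"
    by (intro sum.cong) auto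
  also have "\<dots> = real (Suc n) * (Q - S\<^sup>2 / real n) + 2 * S / real n * S - (1 + 1 / real n) * Q"
    unfolding sum.distrib sum_subtractf sum_distrib_left[symmetric] S_def[symmetric] Q_def[symmetric] by (simp add: right_diff_distrib)
  also have "\<dots> = (real n - 1) / real n * (real (Suc n) * Q - S\<^sup>2)"
    using assms by (simp add: field_simps power2_eq_square)
  also have "\<dots> = (real n - 1) * (real (Suc n) / real n) * (Q - S\<^sup>2 / real (Suc n))"
    by (simp add: right_diff_distrib del: of_nat_Suc)
  also have "Q - S\<^sup>2 / real (Suc n) = centered_squares (Suc n) y"
    by (simp only: centered_squares_def S_def Q_def)
  finally have total: "(\<Sum>k=1..Suc n. centered_squares n (swap_rows k (Suc n) y))
      = (real n - 1) * (real (Suc n) / real n) * centered_squares (Suc n) y" .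
  show ?thesis
    unfolding sum_distrib_left[symmetric] total using assms by simp
qed

lemma sample_var_swap:
  assumes "k \<in> {1..n}" "i \<in> {1..n}"
  shows "sample_var m n (swap_rows k i x) = sample_var m n x"
proof -
  have "(\<Sum>r=1..n. x (Transposition.transpose k i r) j) = (\<Sum>r=1..n. x r j)"
    "(\<Sum>r=1..n. (x (Transposition.transpose k i r) j)\<^sup>2) = (\<Sum>r=1..n. (x r j)\<^sup>2)" for j
    by (rule sum_permute_rows[OF assms, of "\<lambda>r. x r j"], rule sum_permute_rows[OF assms, of "\<lambda>r. (x r j)\<^sup>2"])
  then show ?thesis
    unfolding sample_var_eq centered_squares_def by presburger
qed

lemma sample_var_leave_one_out:
  assumes "2 \<le> n"
  shows "sample_var m (Suc n) x = (1 / real (Suc n)) * (\<Sum>k=1..Suc n. sample_var m n (swap_rows k (Suc n) x))"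
proof -
  define c where "c k j = (1 / (real n - 1)) * centered_squares n (\<lambda>i. swap_rows k (Suc n) x i j)" for k j
  have "sample_var m (Suc n) x = (1 / real m) * (\<Sum>j=1..m. (1 / real n) * centered_squares (Suc n) (\<lambda>i. x i j))"
    by (simp add: sample_var_eq)
  also have "\<dots> = (1 / real m) * (\<Sum>j=1..m. (1 / real (Suc n)) * (\<Sum>k=1..Suc n. c k j))"
    unfolding c_def by (simp only: centered_squares_leave_one_out[OF assms])
  also have "\<dots> = (1 / real (Suc n)) * ((1 / real m) * (\<Sum>k=1..Suc n. \<Sum>j=1..m. c k j))"
    unfolding sum_distrib_left[symmetric] by (subst sum.swap) (simp only: mult.left_commute)
  also have "\<dots> = (1 / real (Suc n)) * (\<Sum>k=1..Suc n. sample_var m n (swap_rows k (Suc n) x))"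
    unfolding sample_var_eq c_def by (simp only: sum_distrib_left)
  finally show ?thesis .
qed

text \<open>Truncation thus only lowers the sample variance, and lower bounds proved for truncated
  errors hold for the errors themselves.\<close>

lemma sample_var_contraction:
  assumes n: "2 \<le> n" and g: "\<And>a b. \<bar>g a - g b\<bar> \<le> \<bar>a - b\<bar>"
  shows "sample_var m n (\<lambda>i j. g (x i j)) \<le> sample_var m n x"
proof -
  have "centered_squares n (\<lambda>i. g (x i j)) \<le> centered_squares n (\<lambda>i. x i j)" for j
  proof -
    have "(g a - g b)\<^sup>2 \<le> (a - b)\<^sup>2" for a b
      using g[of a b] by (simp add: abs_le_square_iff)
    then show ?thesis
      using n by (subst (1 2) centered_squares_pairs) (auto intro!: divide_right_mono sum_mono)
  qed
  then show ?thesis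
    unfolding sample_var_eq using n by (intro mult_left_mono sum_mono) auto
qed

lemma sample_var_nonneg: "2 \<le> n \<Longrightarrow> 0 \<le> sample_var m n x"
  unfolding sample_var_eq by (intro mult_nonneg_nonneg sum_nonneg centered_squares_nonneg) auto

lemma sample_var_cong:
  "(\<And>i j. i \<in> {1..n} \<Longrightarrow> j \<in> {1..m} \<Longrightarrow> x i j = y i j) \<Longrightarrow> sample_var m n x = sample_var m n y"
  by (simp add: sample_var_def)

lemma mean_norm_cong:
  "(\<And>i j. i \<in> {1..n} \<Longrightarrow> j \<in> {1..m} \<Longrightarrow> x i j = y i j) \<Longrightarrow> mean_norm m n x = mean_norm m n y"
  by (simp add: sample_mean_def cong: L2_set_cong_simp)

lemma sample_var_shift:
  assumes "1 \<le> n"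
  shows "sample_var m n (\<lambda>i j. a j + x i j) = sample_var m n x"
proof -
  have "a j + x i j - (1 / real n) * (\<Sum>l=1..n. a j + x l j) = x i j - (1 / real n) * (\<Sum>l=1..n. x l j)" for i j
    using assms by (simp add: sum.distrib field_simps)
  then show ?thesis
    unfolding sample_var_def by presburger
qed

lemma sample_var_scale: "sample_var m n (\<lambda>i j. s * x i j) = s\<^sup>2 * sample_var m n x"
proof -
  have "centered_squares n (\<lambda>i. s * y i) = s\<^sup>2 * centered_squares n y" for y
    unfolding centered_squares_def power_mult_distrib sum_distrib_left[symmetric]
    by (simp add: right_diff_distrib)
  then show ?thesis
    by (simp add: sample_var_eq sum_distrib_left mult_ac)
qed

lemma mean_norm_scale: "0 \<le> s \<Longrightarrow> mean_norm m n (\<lambda>i j. s * x i j) = s * mean_norm m n x"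
  by (simp add: L2_set_right_distrib sample_mean_def sum_distrib_left[symmetric] mult_ac cong: L2_set_cong_simp)

section \<open>Bounds uniform in the number of repetitions\<close>

context prob_space
begin

lemma integrable_square_sum:
  fixes Y :: "'i \<Rightarrow> 'a \<Rightarrow> real"
  assumes [measurable]: "\<And>i. i \<in> I \<Longrightarrow> Y i \<in> borel_measurable M"
    and int: "\<And>i. i \<in> I \<Longrightarrow> integrable M (\<lambda>\<omega>. (Y i \<omega>)\<^sup>2)"
  shows "integrable M (\<lambda>\<omega>. (\<Sum>i\<in>I. Y i \<omega>)\<^sup>2)"
proof (rule Bochner_Integration.integrable_bound)
  show "integrable M (\<lambda>\<omega>. real (card I) * (\<Sum>i\<in>I. (Y i \<omega>)\<^sup>2))"
    by (intro integrable_mult_right Bochner_Integration.integrable_sum int)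
  show "AE \<omega> in M. norm ((\<Sum>i\<in>I. Y i \<omega>)\<^sup>2) \<le> norm (real (card I) * (\<Sum>i\<in>I. (Y i \<omega>)\<^sup>2))"
    using Cauchy_Schwarz_ineq_sum[of "\<lambda>_. 1" _ I] by (intro AE_I2) (simp add: sum_nonneg)
qed simp

lemma integrable_mean_norm:
  assumes [measurable]: "\<And>i j. 1 \<le> i \<Longrightarrow> j \<in> {1..m} \<Longrightarrow> X i j \<in> borel_measurable M"
    and int: "\<And>i j. 1 \<le> i \<Longrightarrow> j \<in> {1..m} \<Longrightarrow> integrable M (X i j)"
  shows "integrable M (\<lambda>\<omega>. mean_norm m n (\<lambda>i j. X i j \<omega>))"
proof (rule Bochner_Integration.integrable_bound)
  show "integrable M (\<lambda>\<omega>. \<Sum>j=1..m. \<bar>(1 / real n) * (\<Sum>i=1..n. X i j \<omega>)\<bar>)"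
    by (intro Bochner_Integration.integrable_sum integrable_abs integrable_mult_right int) auto
  show "(\<lambda>\<omega>. mean_norm m n (\<lambda>i j. X i j \<omega>)) \<in> borel_measurable M"
    unfolding L2_set_def sample_mean_def by measurable
  show "AE \<omega> in M. norm (mean_norm m n (\<lambda>i j. X i j \<omega>)) \<le> norm (\<Sum>j=1..m. \<bar>(1 / real n) * (\<Sum>i=1..n. X i j \<omega>)\<bar>)"
  proof (rule AE_I2)
    fix \<omega>
    have "mean_norm m n (\<lambda>i j. X i j \<omega>) \<le> (\<Sum>j=1..m. \<bar>(1 / real n) * (\<Sum>i=1..n. X i j \<omega>)\<bar>)"
      by (rule order_trans[OF L2_set_le_sum_abs]) (simp add: sample_mean_def)
    then show "norm (mean_norm m n (\<lambda>i j. X i j \<omega>)) \<le> norm (\<Sum>j=1..m. \<bar>(1 / real n) * (\<Sum>i=1..n. X i j \<omega>)\<bar>)"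
      by (simp add: sum_nonneg)
  qed
qed

lemma integrable_sample_var:
  assumes [measurable]: "\<And>i j. 1 \<le> i \<Longrightarrow> j \<in> {1..m} \<Longrightarrow> X i j \<in> borel_measurable M"
    and int: "\<And>i j. 1 \<le> i \<Longrightarrow> j \<in> {1..m} \<Longrightarrow> integrable M (\<lambda>\<omega>. (X i j \<omega>)\<^sup>2)"
  shows "integrable M (\<lambda>\<omega>. sample_var m n (\<lambda>i j. X i j \<omega>))"
  unfolding sample_var_eq centered_squares_def
  by (intro integrable_mult_right Bochner_Integration.integrable_sum Bochner_Integration.integrable_diff
      integrable_divide integrable_square_sum) (auto intro: int)

text \<open>The positive part of the norm minus b is convex in the mean and inherits the
  leave-one-out inequality. Subtracting b before applying Doob's inequality is what makes the bound
  small when b is the typical size.\<close>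

lemma mean_norm_maximal:
  assumes X: "iid M (\<lambda>(i, j). X i j) ({1..} \<times> {1..m})" and m: "1 \<le> m" and a: "1 \<le> a" and \<eta>: "0 < \<eta>"
    and int: "\<And>i j. 1 \<le> i \<Longrightarrow> j \<in> {1..m} \<Longrightarrow> integrable M (X i j)"
  shows "prob {\<omega> \<in> space M. \<exists>n\<ge>a. b + \<eta> \<le> mean_norm m n (\<lambda>i j. X i j \<omega>)}
      \<le> expectation (\<lambda>\<omega>. max 0 (mean_norm m a (\<lambda>i j. X i j \<omega>) - b)) / \<eta>"
proof -
  have rv: "X i j \<in> borel_measurable M" if "1 \<le> i" "j \<in> {1..m}" for i j
    using iid_random_variable[OF X, of "(i, j)"] that by simp
  interpret exchangeable_statistic M X m a "\<lambda>n x. max 0 (mean_norm m n x - b)"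
  proof (unfold_locales)
    show "iid M (\<lambda>(i, j). X i j) ({1..} \<times> {1..m})" "1 \<le> m" "1 \<le> a"
      by fact+
    show "max 0 (mean_norm m n x - b) = max 0 (mean_norm m n y - b)"
      if "\<And>i j. i \<in> {1..n} \<Longrightarrow> j \<in> {1..m} \<Longrightarrow> x i j = y i j" for n x y
      by (simp only: mean_norm_cong[OF that])
    show "max 0 (mean_norm m n (swap_rows k i x) - b) = max 0 (mean_norm m n x - b)"
      if "k \<in> {1..n}" "i \<in> {1..n}" for n x k i
      by (simp only: sample_mean_swap[OF that])
    show "max 0 (mean_norm m (Suc n) x - b)
        \<le> (1 / real (Suc n)) * (\<Sum>k=1..Suc n. max 0 (mean_norm m n (swap_rows k (Suc n) x) - b))" if n: "a \<le> n" for n x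
    proof -
      have "mean_norm m (Suc n) x - b \<le> (1 / real (Suc n)) * (\<Sum>k=1..Suc n. mean_norm m n (swap_rows k (Suc n) x)) - b"
        using n a by (intro diff_right_mono mean_norm_leave_one_out) auto
      also have "\<dots> = (1 / real (Suc n)) * (\<Sum>k=1..Suc n. mean_norm m n (swap_rows k (Suc n) x) - b)"
        by (simp add: sum_subtractf right_diff_distrib del: sum.cl_ivl_Suc)
      also have "\<dots> \<le> (1 / real (Suc n)) * (\<Sum>k=1..Suc n. max 0 (mean_norm m n (swap_rows k (Suc n) x) - b))"
        by (intro mult_left_mono sum_mono) auto
      finally show ?thesis
        by (simp add: sum_nonneg del: sum.cl_ivl_Suc)
    qed
    show "(\<lambda>f. max 0 (mean_norm m n (\<lambda>i j. f (i, j)) - b)) \<in> borel_measurable (PiM ({1..} \<times> {1..m}) (\<lambda>_. borel))" for n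
    proof -
      have "(\<lambda>f. f (i, j)) \<in> borel_measurable (PiM ({1..} \<times> {1..m}) (\<lambda>_. borel))" if "i \<in> {1..n}" "j \<in> {1..m}" for i j
        using that by (intro measurable_component_singleton) auto
      then show ?thesis
        unfolding L2_set_def sample_mean_def
        by (intro borel_measurable_max borel_measurable_const borel_measurable_diff borel_measurable_sqrt borel_measurable_sum
            borel_measurable_power) (auto intro!: borel_measurable_times borel_measurable_sum)
    qed
    show "integrable M (\<lambda>\<omega>. max 0 (mean_norm m n (\<lambda>i j. X i j \<omega>) - b))" for n
      by (intro integrable_max integrable_const Bochner_Integration.integrable_diff integrable_mean_norm rv int)
  qed auto
  have "(\<eta> \<le> max 0 (mean_norm m n x - b)) = (b + \<eta> \<le> mean_norm m n x)" for n x
    using \<eta> by auto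
  then show ?thesis
    using maximal_inequality[OF \<eta>] by simp
qed

text \<open>The absolute deviation from v is a convex function of a reverse martingale. The smallest
  sample with a variance, n = 2, controls all larger ones.\<close>

lemma sample_var_maximal:
  assumes X: "iid M (\<lambda>(i, j). X i j) ({1..} \<times> {1..m})" and m: "1 \<le> m" and \<eta>: "0 < \<eta>"
    and int: "\<And>i j. 1 \<le> i \<Longrightarrow> j \<in> {1..m} \<Longrightarrow> integrable M (\<lambda>\<omega>. (X i j \<omega>)\<^sup>2)"
  shows "prob {\<omega> \<in> space M. \<exists>n\<ge>2. \<eta> \<le> \<bar>sample_var m n (\<lambda>i j. X i j \<omega>) - v\<bar>}
      \<le> expectation (\<lambda>\<omega>. \<bar>sample_var m 2 (\<lambda>i j. X i j \<omega>) - v\<bar>) / \<eta>"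
proof -
  have rv: "X i j \<in> borel_measurable M" if "1 \<le> i" "j \<in> {1..m}" for i j
    using iid_random_variable[OF X, of "(i, j)"] that by simp
  interpret exchangeable_statistic M X m 2 "\<lambda>n x. \<bar>sample_var m n x - v\<bar>"
  proof (unfold_locales)
    show "iid M (\<lambda>(i, j). X i j) ({1..} \<times> {1..m})" "1 \<le> m" "1 \<le> (2::nat)"
      using X m by auto
    show "\<bar>sample_var m n x - v\<bar> = \<bar>sample_var m n y - v\<bar>"
      if "\<And>i j. i \<in> {1..n} \<Longrightarrow> j \<in> {1..m} \<Longrightarrow> x i j = y i j" for n x y
      by (simp only: sample_var_cong[OF that])
    show "\<bar>sample_var m n (swap_rows k i x) - v\<bar> = \<bar>sample_var m n x - v\<bar>"
      if "k \<in> {1..n}" "i \<in> {1..n}" for n x k i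
      by (simp only: sample_var_swap[OF that])
    show "\<bar>sample_var m (Suc n) x - v\<bar>
        \<le> (1 / real (Suc n)) * (\<Sum>k=1..Suc n. \<bar>sample_var m n (swap_rows k (Suc n) x) - v\<bar>)" if n: "2 \<le> n" for n x
    proof -
      have "sample_var m (Suc n) x - v = (1 / real (Suc n)) * (\<Sum>k=1..Suc n. sample_var m n (swap_rows k (Suc n) x) - v)"
        by (simp add: sample_var_leave_one_out[OF n] sum_subtractf right_diff_distrib del: sum.cl_ivl_Suc)
      then have "\<bar>sample_var m (Suc n) x - v\<bar> = (1 / real (Suc n)) * \<bar>\<Sum>k=1..Suc n. sample_var m n (swap_rows k (Suc n) x) - v\<bar>"
        by (simp add: abs_mult del: sum.cl_ivl_Suc)
      also have "\<dots> \<le> (1 / real (Suc n)) * (\<Sum>k=1..Suc n. \<bar>sample_var m n (swap_rows k (Suc n) x) - v\<bar>)"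
        by (intro mult_left_mono sum_abs) simp
      finally show ?thesis .
    qed
    show "(\<lambda>f. \<bar>sample_var m n (\<lambda>i j. f (i, j)) - v\<bar>) \<in> borel_measurable (PiM ({1..} \<times> {1..m}) (\<lambda>_. borel))" for n
    proof -
      have "(\<lambda>f. f (i, j)) \<in> borel_measurable (PiM ({1..} \<times> {1..m}) (\<lambda>_. borel))" if "i \<in> {1..n}" "j \<in> {1..m}" for i j
        using that by (intro measurable_component_singleton) auto
      then show ?thesis
        unfolding sample_var_def
        by (intro borel_measurable_abs borel_measurable_diff borel_measurable_const borel_measurable_times borel_measurable_sum
            borel_measurable_power) auto
    qed
    show "integrable M (\<lambda>\<omega>. \<bar>sample_var m n (\<lambda>i j. X i j \<omega>) - v\<bar>)" for n
      by (intro integrable_abs integrable_const Bochner_Integration.integrable_diff integrable_sample_var rv int)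
  qed auto
  show ?thesis
    by (rule maximal_inequality[OF \<eta>])
qed

end

section \<open>Moments and truncation\<close>

context prob_space
begin

lemma expectation_abs_le_sqrt:
  fixes f :: "'a \<Rightarrow> real"
  assumes [measurable]: "f \<in> borel_measurable M" and int: "integrable M (\<lambda>\<omega>. (f \<omega>)\<^sup>2)"
  shows "expectation (\<lambda>\<omega>. \<bar>f \<omega>\<bar>) \<le> sqrt (expectation (\<lambda>\<omega>. (f \<omega>)\<^sup>2))"
proof -
  have "integrable M (\<lambda>\<omega>. \<bar>f \<omega>\<bar>)"
    by (rule integrable_abs[OF square_integrable_imp_integrable[OF assms]])
  from variance_eq[OF this] have "variance (\<lambda>\<omega>. \<bar>f \<omega>\<bar>) = expectation (\<lambda>\<omega>. (f \<omega>)\<^sup>2) - (expectation (\<lambda>\<omega>. \<bar>f \<omega>\<bar>))\<^sup>2"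
    using int by simp
  with variance_positive[of "\<lambda>\<omega>. \<bar>f \<omega>\<bar>"] have "(expectation (\<lambda>\<omega>. \<bar>f \<omega>\<bar>))\<^sup>2 \<le> expectation (\<lambda>\<omega>. (f \<omega>)\<^sup>2)"
    by linarith
  then show ?thesis
    by (rule real_le_rsqrt)
qed

lemma indep_vars_measurable: "indep_vars M' Y I \<Longrightarrow> i \<in> I \<Longrightarrow> Y i \<in> measurable M (M' i)"
  unfolding indep_vars_def by blast

lemma sum_second_moment:
  fixes Y :: "'i \<Rightarrow> 'a \<Rightarrow> real"
  assumes "finite I" and "indep_vars (\<lambda>_. borel) Y I"
    and "\<And>i. i \<in> I \<Longrightarrow> integrable M (\<lambda>\<omega>. (Y i \<omega>)\<^sup>2)" and "\<And>i. i \<in> I \<Longrightarrow> expectation (Y i) = 0"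
  shows "expectation (\<lambda>\<omega>. (\<Sum>i\<in>I. Y i \<omega>)\<^sup>2) = (\<Sum>i\<in>I. expectation (\<lambda>\<omega>. (Y i \<omega>)\<^sup>2))"
  using assms
proof (induction I rule: finite_induct)
  case (insert i I)
  let ?S = "\<lambda>\<omega>. \<Sum>i\<in>I. Y i \<omega>"
  note rv [measurable] = indep_vars_measurable[OF insert.prems(1)]
  have int2: "integrable M (\<lambda>\<omega>. (Y k \<omega>)\<^sup>2)" and int: "integrable M (Y k)" if "k \<in> insert i I" for k
    using that insert.prems(2) rv by (auto intro: square_integrable_imp_integrable)
  have ind: "indep_var borel (Y i) borel ?S"
    by (intro indep_vars_sum insert)
  have int_S: "integrable M ?S" and int_S2: "integrable M (\<lambda>\<omega>. (?S \<omega>)\<^sup>2)"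
    using int int2 by (auto intro!: Bochner_Integration.integrable_sum integrable_square_sum)
  have int_YS: "integrable M (\<lambda>\<omega>. Y i \<omega> * ?S \<omega>)"
    by (intro indep_var_integrable ind int int_S) simp
  have "expectation (\<lambda>\<omega>. Y i \<omega> * ?S \<omega>) = expectation (Y i) * expectation ?S"
    by (intro indep_var_lebesgue_integral ind int int_S) simp
  then have cross: "expectation (\<lambda>\<omega>. Y i \<omega> * ?S \<omega>) = 0"
    using insert.prems(3) by simp
  have "(\<Sum>k\<in>insert i I. Y k \<omega>)\<^sup>2 = (Y i \<omega>)\<^sup>2 + 2 * (Y i \<omega> * ?S \<omega>) + (?S \<omega>)\<^sup>2" for \<omega>
    using insert.hyps by (simp add: power2_sum)
  then have "expectation (\<lambda>\<omega>. (\<Sum>k\<in>insert i I. Y k \<omega>)\<^sup>2)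
      = expectation (\<lambda>\<omega>. (Y i \<omega>)\<^sup>2) + expectation (\<lambda>\<omega>. (?S \<omega>)\<^sup>2)"
    using int2[of i] int_YS int_S2 cross by simp
  also have "expectation (\<lambda>\<omega>. (?S \<omega>)\<^sup>2) = (\<Sum>i\<in>I. expectation (\<lambda>\<omega>. (Y i \<omega>)\<^sup>2))"
    using insert.prems indep_vars_subset[OF insert.prems(1)] by (intro insert.IH) auto
  finally show ?case
    using insert.hyps by simp
qed simp

text \<open>A weak law in L^1, to be applied across the m channels: by independence the variance of
  the average is at most s / m.\<close>

lemma average_deviation:
  fixes U :: "nat \<Rightarrow> 'a \<Rightarrow> real"
  assumes ind: "indep_vars (\<lambda>_. borel) U {1..m}" and m: "1 \<le> m"
    and int: "\<And>j. j \<in> {1..m} \<Longrightarrow> integrable M (\<lambda>\<omega>. (U j \<omega>)\<^sup>2)"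
    and mean: "\<And>j. j \<in> {1..m} \<Longrightarrow> expectation (U j) = u"
    and bound: "\<And>j. j \<in> {1..m} \<Longrightarrow> expectation (\<lambda>\<omega>. (U j \<omega>)\<^sup>2) \<le> s"
  shows "expectation (\<lambda>\<omega>. \<bar>(1 / real m) * (\<Sum>j=1..m. U j \<omega>) - u\<bar>) \<le> sqrt (s / real m)"
proof -
  define Y where "Y j \<omega> = (1 / real m) * (U j \<omega> - u)" for j \<omega>
  note rv = indep_vars_measurable[OF ind]
  have int1: "integrable M (U j)" if "j \<in> {1..m}" for j
    using that int rv by (auto intro: square_integrable_imp_integrable)
  have ind_Y: "indep_vars (\<lambda>_. borel) Y {1..m}"
    unfolding Y_def by (rule indep_vars_compose2[OF ind, of "\<lambda>_ x. (1 / real m) * (x - u)"]) simp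
  have int_Y: "integrable M (\<lambda>\<omega>. (Y j \<omega>)\<^sup>2)" if "j \<in> {1..m}" for j
    unfolding Y_def power_mult_distrib power2_diff using that int int1 by simp
  have mean_Y: "expectation (Y j) = 0" if "j \<in> {1..m}" for j
    unfolding Y_def using that int1 mean by (simp add: prob_space)
  have sq: "expectation (\<lambda>\<omega>. (Y j \<omega>)\<^sup>2) \<le> s / (real m)\<^sup>2" if j: "j \<in> {1..m}" for j
  proof -
    have "expectation (\<lambda>\<omega>. (U j \<omega> - u)\<^sup>2) = expectation (\<lambda>\<omega>. (U j \<omega>)\<^sup>2) - u\<^sup>2"
      using variance_eq[OF int1[OF j] int[OF j]] mean[OF j] by simp
    also have "\<dots> \<le> s"
      using bound[OF j] by (smt (verit) zero_le_power2)
    finally have "(1 / (real m)\<^sup>2) * expectation (\<lambda>\<omega>. (U j \<omega> - u)\<^sup>2) \<le> (1 / (real m)\<^sup>2) * s"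
      by (rule mult_left_mono) simp
    then show ?thesis
      unfolding Y_def power_mult_distrib by (simp add: power_divide)
  qed
  have sum_Y: "(1 / real m) * (\<Sum>j=1..m. U j \<omega>) - u = (\<Sum>j=1..m. Y j \<omega>)" for \<omega>
    using m unfolding Y_def sum_distrib_left[symmetric] sum_subtractf by (simp add: field_simps)
  have "expectation (\<lambda>\<omega>. \<bar>\<Sum>j=1..m. Y j \<omega>\<bar>) \<le> sqrt (expectation (\<lambda>\<omega>. (\<Sum>j=1..m. Y j \<omega>)\<^sup>2))"
    using indep_vars_measurable[OF ind_Y] int_Y by (intro expectation_abs_le_sqrt integrable_square_sum) auto
  also have "\<dots> \<le> sqrt (\<Sum>j=1..m. s / (real m)\<^sup>2)"
  proof (rule real_sqrt_le_mono)
    have "expectation (\<lambda>\<omega>. (\<Sum>j=1..m. Y j \<omega>)\<^sup>2) = (\<Sum>j=1..m. expectation (\<lambda>\<omega>. (Y j \<omega>)\<^sup>2))"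
      by (rule sum_second_moment[OF _ ind_Y int_Y mean_Y]) auto
    also have "\<dots> \<le> (\<Sum>j=1..m. s / (real m)\<^sup>2)"
      by (rule sum_mono[OF sq])
    finally show "expectation (\<lambda>\<omega>. (\<Sum>j=1..m. Y j \<omega>)\<^sup>2) \<le> (\<Sum>j=1..m. s / (real m)\<^sup>2)" .
  qed
  also have "(\<Sum>j=1..m. s / (real m)\<^sup>2) = s / real m"
    using m by (simp add: power2_eq_square)
  finally show ?thesis
    by (simp only: sum_Y)
qed

lemma integrable_bounded:
  fixes f :: "'a \<Rightarrow> real"
  assumes "f \<in> borel_measurable M" "\<And>\<omega>. \<bar>f \<omega>\<bar> \<le> B"
  shows "integrable M f"
  using assms by (intro integrable_const_bound[where B = B]) auto

text \<open>Products with an isolated first power have mean zero, which leaves the step from N to N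
  + 1 summands at B^4 + 6 N B^4, within the increment of 3 N^2 B^4. After division by the square of
  the number of rows the bound is free of it, as needed for squared sample means.\<close>

lemma sum_fourth_moment:
  fixes Y :: "'i \<Rightarrow> 'a \<Rightarrow> real"
  assumes "finite I" and "indep_vars (\<lambda>_. borel) Y I"
    and "\<And>i \<omega>. i \<in> I \<Longrightarrow> \<bar>Y i \<omega>\<bar> \<le> B" and "\<And>i. i \<in> I \<Longrightarrow> expectation (Y i) = 0"
  shows "expectation (\<lambda>\<omega>. (\<Sum>i\<in>I. Y i \<omega>) ^ 4) \<le> 3 * (real (card I))\<^sup>2 * B ^ 4"
  using assms
proof (induction I rule: finite_induct)
  case (insert i I)
  let ?S = "\<lambda>\<omega>. \<Sum>i\<in>I. Y i \<omega>"
  note rv [measurable] = indep_vars_measurable[OF insert.prems(1)]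
  have B: "0 \<le> B"
    using order_trans[OF abs_ge_zero insert.prems(2)[of i undefined]] by simp
  have S_bound: "\<bar>?S \<omega>\<bar> \<le> real (card I) * B" for \<omega>
    using insert.prems(2) by (intro order_trans[OF sum_abs] sum_bounded_above) auto
  have pow_bound: "\<bar>x ^ k\<bar> \<le> c ^ k" if "\<bar>x\<bar> \<le> c" for x c :: real and k
    using that by (simp add: power_abs power_mono)
  have [measurable]: "?S \<in> borel_measurable M" "Y i \<in> borel_measurable M"
    by measurable
  have int_Y: "integrable M (\<lambda>\<omega>. Y i \<omega> ^ k)" for k
    using insert.prems(2) by (intro integrable_bounded[where B = "B ^ k"] pow_bound) auto
  have int_S: "integrable M (\<lambda>\<omega>. ?S \<omega> ^ k)" for k
    by (intro integrable_bounded[where B = "(real (card I) * B) ^ k"] pow_bound S_bound) simp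
  have ind: "indep_var borel (\<lambda>\<omega>. Y i \<omega> ^ k) borel (\<lambda>\<omega>. ?S \<omega> ^ k')" for k k'
    using indep_var_compose[OF indep_vars_sum[OF insert.hyps insert.prems(1)], of "\<lambda>x. x ^ k" borel "\<lambda>x. x ^ k'" borel]
    by (simp add: comp_def)
  have prod_eq: "expectation (\<lambda>\<omega>. Y i \<omega> ^ k * ?S \<omega> ^ k') = expectation (\<lambda>\<omega>. Y i \<omega> ^ k) * expectation (\<lambda>\<omega>. ?S \<omega> ^ k')"
    and prod_int: "integrable M (\<lambda>\<omega>. Y i \<omega> ^ k * ?S \<omega> ^ k')" for k k'
    by (intro indep_var_lebesgue_integral indep_var_integrable ind int_Y int_S)+
  have mean: "expectation (Y i) = 0" "expectation ?S = 0"
    using insert.prems(3) int_Y[of 1] insert.prems(2) rv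
    by (auto simp: Bochner_Integration.integral_sum[OF integrable_bounded[where B = B]])
  have ind_I: "indep_vars (\<lambda>_. borel) Y I"
    by (rule indep_vars_subset[OF insert.prems(1)]) auto
  have Y2: "expectation (\<lambda>\<omega>. (Y k \<omega>)\<^sup>2) \<le> B\<^sup>2" if "k \<in> insert i I" for k
  proof -
    have "expectation (\<lambda>\<omega>. (Y k \<omega>)\<^sup>2) \<le> expectation (\<lambda>\<omega>. B\<^sup>2)"
      using that insert.prems(2) rv power_mono[OF insert.prems(2), of k _ 2]
      by (intro integral_mono integrable_bounded[where B = "B\<^sup>2"]) auto
    then show ?thesis
      by (simp add: prob_space)
  qed
  have Y4: "expectation (\<lambda>\<omega>. Y i \<omega> ^ 4) \<le> B ^ 4"
  proof -
    have "expectation (\<lambda>\<omega>. Y i \<omega> ^ 4) \<le> expectation (\<lambda>\<omega>. B ^ 4)"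
      using pow_bound[OF insert.prems(2), of i _ 4] int_Y[of 4] by (intro integral_mono) auto
    then show ?thesis
      by (simp add: prob_space)
  qed
  have S2: "expectation (\<lambda>\<omega>. (?S \<omega>)\<^sup>2) \<le> real (card I) * B\<^sup>2"
  proof -
    have "expectation (\<lambda>\<omega>. (?S \<omega>)\<^sup>2) = (\<Sum>i\<in>I. expectation (\<lambda>\<omega>. (Y i \<omega>)\<^sup>2))"
      using insert.prems insert.hyps rv power_mono[OF insert.prems(2), of _ _ 2]
      by (intro sum_second_moment ind_I integrable_bounded[where B = "B\<^sup>2"]) auto
    also have "\<dots> \<le> real (card I) * B\<^sup>2"
      using Y2 by (intro sum_bounded_above) auto
    finally show ?thesis .
  qed
  have mean1: "expectation (\<lambda>\<omega>. Y i \<omega> ^ 1) = 0" "expectation (\<lambda>\<omega>. ?S \<omega> ^ 1) = 0"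
    using mean by simp_all
  have expand: "(\<Sum>k\<in>insert i I. Y k \<omega>) ^ 4 = Y i \<omega> ^ 4 + 4 * (Y i \<omega> ^ 3 * ?S \<omega> ^ 1) + 6 * (Y i \<omega> ^ 2 * ?S \<omega> ^ 2)
      + 4 * (Y i \<omega> ^ 1 * ?S \<omega> ^ 3) + ?S \<omega> ^ 4" for \<omega>
    using insert.hyps by (simp add: power4_eq_xxxx power3_eq_cube power2_eq_square algebra_simps)
  have "expectation (\<lambda>\<omega>. (\<Sum>k\<in>insert i I. Y k \<omega>) ^ 4)
      = expectation (\<lambda>\<omega>. Y i \<omega> ^ 4) + 6 * (expectation (\<lambda>\<omega>. Y i \<omega> ^ 2) * expectation (\<lambda>\<omega>. ?S \<omega> ^ 2))
        + expectation (\<lambda>\<omega>. ?S \<omega> ^ 4)"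
    unfolding expand
    by (simp only: Bochner_Integration.integral_add Bochner_Integration.integrable_add integrable_mult_right
        integral_mult_right_zero prod_eq prod_int int_Y int_S mean1 mult_zero_left mult_zero_right add_0_right)
  also have "\<dots> \<le> B ^ 4 + 6 * (B\<^sup>2 * (real (card I) * B\<^sup>2)) + 3 * (real (card I))\<^sup>2 * B ^ 4"
    using insert.prems ind_I
    by (intro add_mono Y4 mult_left_mono mult_mono Y2 S2 insert.IH) auto
  also have "\<dots> \<le> 3 * (real (card (insert i I)))\<^sup>2 * B ^ 4"
    using insert.hyps B by (simp add: power2_eq_square power4_eq_xxxx algebra_simps)
  finally show ?case .
qed simp

text \<open>Different columns are disjoint blocks of the array. Two power sums as arguments suffice
  for both the squared mean and the variance of a column.\<close>

lemma indep_vars_columns: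
  assumes X: "iid M (\<lambda>(i, j). X i j) ({1::nat..} \<times> {1..m::nat})"
    and G: "(\<lambda>p. G (fst p) (snd p)) \<in> borel_measurable (borel \<Otimes>\<^sub>M borel)"
  shows "indep_vars (\<lambda>_. borel) (\<lambda>j \<omega>. G (\<Sum>i=1..n. X i j \<omega>) (\<Sum>i=1..n. (X i j \<omega>)\<^sup>2) :: real) {1..m}"
proof -
  let ?K = "\<lambda>j. {1..n} \<times> {j}"
  define H where "H j z = G (\<Sum>i=1..n. z (i, j)) (\<Sum>i=1..n. (z (i, j))\<^sup>2)" for j and z :: "nat \<times> nat \<Rightarrow> real"
  have "indep_vars (\<lambda>j. PiM (?K j) (\<lambda>_. borel)) (\<lambda>j \<omega>. restrict (\<lambda>p. (\<lambda>(i, j). X i j) p \<omega>) (?K j)) {1..m}"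
    by (rule indep_vars_restrict[OF iid_indep_vars[OF X]]) (auto simp: disjoint_family_on_def)
  then have "indep_vars (\<lambda>_. borel) (\<lambda>j \<omega>. H j (restrict (\<lambda>p. (\<lambda>(i, j). X i j) p \<omega>) (?K j))) {1..m}"
  proof (rule indep_vars_compose2)
    fix j assume "j \<in> {1..m}"
    have c: "(\<lambda>z. z (i, j)) \<in> borel_measurable (PiM (?K j) (\<lambda>_. borel :: real measure))" if "i \<in> {1..n}" for i
      using that by (intro measurable_component_singleton) auto
    have s1: "(\<lambda>z. \<Sum>i=1..n. z (i, j)) \<in> borel_measurable (PiM (?K j) (\<lambda>_. borel :: real measure))"
      by (rule borel_measurable_sum) (rule c)
    have s2: "(\<lambda>z. \<Sum>i=1..n. (z (i, j))\<^sup>2) \<in> borel_measurable (PiM (?K j) (\<lambda>_. borel :: real measure))"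
      by (rule borel_measurable_sum) (rule borel_measurable_power[OF c])
    have "(\<lambda>z. (\<Sum>i=1..n. z (i, j), \<Sum>i=1..n. (z (i, j))\<^sup>2)) \<in> measurable (PiM (?K j) (\<lambda>_. borel :: real measure)) (borel \<Otimes>\<^sub>M borel)"
      by (rule measurable_Pair[OF s1 s2])
    from measurable_compose[OF this G] show "H j \<in> borel_measurable (PiM (?K j) (\<lambda>_. borel))"
      by (simp add: H_def[abs_def])
  qed
  then show ?thesis
    by (simp add: H_def)
qed

end

text \<open>Errors scaled to variance one. All bounds below are explicit in the truncation level b
  and the tail mass t, so that they are uniform over all error laws sharing b and t.\<close>

locale standardised_array = prob_space M for M :: "'w measure" +
  fixes X :: "nat \<Rightarrow> nat \<Rightarrow> 'w \<Rightarrow> real" and m :: nat and b t :: real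
  assumes iid_X: "iid M (\<lambda>(i, j). X i j) ({1..} \<times> {1..m})" and m: "1 \<le> m"
    and integrable_X2: "integrable M (\<lambda>\<omega>. (X 1 1 \<omega>)\<^sup>2)"
    and mean_X: "expectation (X 1 1) = 0" and var_X: "expectation (\<lambda>\<omega>. (X 1 1 \<omega>)\<^sup>2) = 1"
    and b: "0 < b" and tail: "expectation (\<lambda>\<omega>. (X 1 1 \<omega>)\<^sup>2 * of_bool (b < \<bar>X 1 1 \<omega>\<bar>)) \<le> t"
begin

text \<open>Large values are moved to the nearest end of the interval rather than to 0, which keeps
  the map from increasing distances, as the comparison of sample variances demands.\<close>

definition clip :: "real \<Rightarrow> real" where
  "clip x = max (- b) (min b x)"

definition u :: real where
  "u = expectation (\<lambda>\<omega>. clip (X 1 1 \<omega>))"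

text \<open>Recentred clipping: both T X and the remainder X - T X have mean zero, so that second
  moments of independent sums of either add up.\<close>

definition T :: "real \<Rightarrow> real" where
  "T x = clip x - u"

definition v :: real where
  "v = expectation (\<lambda>\<omega>. (T (X 1 1 \<omega>))\<^sup>2)"

lemma clip_bound: "\<bar>clip x\<bar> \<le> b"
  using b by (auto simp: clip_def)

lemma T_measurable [measurable]: "T \<in> borel_measurable borel"
  unfolding T_def clip_def by measurable

lemma X_measurable: "1 \<le> i \<Longrightarrow> j \<in> {1..m} \<Longrightarrow> X i j \<in> borel_measurable M"
  using iid_random_variable[OF iid_X, of "(i, j)"] by simp

lemma X11_measurable [measurable]: "X 1 1 \<in> borel_measurable M" "X (Suc 0) (Suc 0) \<in> borel_measurable M"
  using X_measurable[of 1 1] m by simp_all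

lemma expectation_X:
  assumes "1 \<le> i" "j \<in> {1..m}" "g \<in> borel_measurable borel"
  shows "expectation (\<lambda>\<omega>. g (X i j \<omega>) :: real) = expectation (\<lambda>\<omega>. g (X 1 1 \<omega>))"
  using iid_expectation_eq[OF iid_X, of "(i, j)" "(1, 1)" g] assms m by simp

lemma integrable_X:
  assumes "1 \<le> i" "j \<in> {1..m}" "g \<in> borel_measurable borel"
  shows "integrable M (\<lambda>\<omega>. g (X i j \<omega>) :: real) \<longleftrightarrow> integrable M (\<lambda>\<omega>. g (X 1 1 \<omega>))"
  using iid_integrable_iff[OF iid_X, of "(i, j)" "(1, 1)" g] assms m by simp

lemma integrable_X11: "integrable M (X 1 1)"
  by (rule square_integrable_imp_integrable[OF _ integrable_X2]) simp

lemma integrable_clip: "integrable M (\<lambda>\<omega>. clip (X 1 1 \<omega>))"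
proof (rule integrable_bounded[OF _ clip_bound])
  show "(\<lambda>\<omega>. clip (X 1 1 \<omega>)) \<in> borel_measurable M"
    unfolding clip_def by measurable
qed

lemma abs_u: "\<bar>u\<bar> \<le> b"
proof -
  have "\<bar>u\<bar> \<le> expectation (\<lambda>\<omega>. \<bar>clip (X 1 1 \<omega>)\<bar>)"
    unfolding u_def by (rule integral_abs_bound)
  also have "\<dots> \<le> expectation (\<lambda>\<omega>. b)"
    by (intro integral_mono integrable_abs integrable_clip clip_bound integrable_const)
  finally show ?thesis
    by (simp add: prob_space)
qed

lemma T_bound: "\<bar>T x\<bar> \<le> 2 * b"
  using clip_bound[of x] abs_u by (simp add: T_def)

lemma T_contraction: "\<bar>T x - T y\<bar> \<le> \<bar>x - y\<bar>"
  by (auto simp: T_def clip_def)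

lemma iid_T: "iid M (\<lambda>(i, j) \<omega>. T (X i j \<omega>)) ({1..} \<times> {1..m})"
proof -
  have "(\<lambda>(i, j) \<omega>. T (X i j \<omega>)) = (\<lambda>p \<omega>. T ((\<lambda>(i, j). X i j) p \<omega>))"
    by (auto simp: fun_eq_iff)
  then show ?thesis
    using iid_compose[OF iid_X T_measurable] by simp
qed

lemma TX_measurable: "1 \<le> i \<Longrightarrow> j \<in> {1..m} \<Longrightarrow> (\<lambda>\<omega>. T (X i j \<omega>)) \<in> borel_measurable M"
  by (rule measurable_compose[OF X_measurable T_measurable])

lemma mean_T: "1 \<le> i \<Longrightarrow> j \<in> {1..m} \<Longrightarrow> expectation (\<lambda>\<omega>. T (X i j \<omega>)) = 0"
  unfolding expectation_X[OF _ _ T_measurable] using integrable_clip by (simp add: T_def u_def prob_space)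

lemma T2_measurable: "(\<lambda>x. (T x)\<^sup>2) \<in> borel_measurable borel"
  by measurable

lemma T2_integrable: "1 \<le> i \<Longrightarrow> j \<in> {1..m} \<Longrightarrow> integrable M (\<lambda>\<omega>. (T (X i j \<omega>))\<^sup>2)"
  using TX_measurable power_mono[OF T_bound, of _ 2]
  by (intro integrable_bounded[where B = "(2 * b)\<^sup>2"]) auto

lemma var_T: "1 \<le> i \<Longrightarrow> j \<in> {1..m} \<Longrightarrow> expectation (\<lambda>\<omega>. (T (X i j \<omega>))\<^sup>2) = v"
  unfolding v_def by (rule expectation_X[OF _ _ T2_measurable])

text \<open>X minus its clipped value lives on the tail and is at most |X| there, so its second
  moment is at most t. Its mean is - u, hence u^2 \<le> t, and recentring can only reduce the second
  moment.\<close>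

lemma remainder:
  shows "expectation (\<lambda>\<omega>. X 1 1 \<omega> - T (X 1 1 \<omega>)) = 0"
    and "integrable M (\<lambda>\<omega>. (X 1 1 \<omega> - T (X 1 1 \<omega>))\<^sup>2)"
    and "expectation (\<lambda>\<omega>. (X 1 1 \<omega> - T (X 1 1 \<omega>))\<^sup>2) \<le> t"
    and "u\<^sup>2 \<le> t"
proof -
  let ?X = "X 1 1"
  define D where "D \<omega> = ?X \<omega> - clip (?X \<omega>)" for \<omega>
  have [measurable]: "D \<in> borel_measurable M"
    unfolding D_def clip_def by measurable
  have D_le: "(D \<omega>)\<^sup>2 \<le> (?X \<omega>)\<^sup>2 * of_bool (b < \<bar>?X \<omega>\<bar>)" for \<omega>
  proof (cases "b < \<bar>?X \<omega>\<bar>")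
    case True
    then have "\<bar>D \<omega>\<bar> \<le> \<bar>?X \<omega>\<bar>"
      using b by (auto simp: D_def clip_def)
    then show ?thesis
      using True by (simp add: abs_le_square_iff)
  qed (auto simp: D_def clip_def)
  have int_tail: "integrable M (\<lambda>\<omega>. (?X \<omega>)\<^sup>2 * of_bool (b < \<bar>?X \<omega>\<bar>))"
    by (rule Bochner_Integration.integrable_bound[OF integrable_X2]) (auto simp: of_bool_def)
  have int_D2: "integrable M (\<lambda>\<omega>. (D \<omega>)\<^sup>2)"
    by (rule Bochner_Integration.integrable_bound[OF int_tail]) (use D_le in auto)
  have int_D: "integrable M D"
    by (rule square_integrable_imp_integrable[OF _ int_D2]) simp
  have mean_D: "expectation D = - u"
    unfolding D_def u_def using integrable_X11 integrable_clip mean_X by simp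
  have D2: "expectation (\<lambda>\<omega>. (D \<omega>)\<^sup>2) \<le> t"
    using integral_mono[OF int_D2 int_tail D_le] tail by simp
  have eq: "?X \<omega> - T (?X \<omega>) = D \<omega> + u" for \<omega>
    by (simp add: D_def T_def)
  show "expectation (\<lambda>\<omega>. ?X \<omega> - T (?X \<omega>)) = 0"
    unfolding eq using int_D mean_D by (simp add: prob_space)
  show "integrable M (\<lambda>\<omega>. (?X \<omega> - T (?X \<omega>))\<^sup>2)"
    unfolding eq power2_sum using int_D int_D2 by simp
  have "expectation (\<lambda>\<omega>. (D \<omega> + u)\<^sup>2) = expectation (\<lambda>\<omega>. (D \<omega>)\<^sup>2) - u\<^sup>2"
    using variance_eq[OF int_D int_D2] mean_D by simp
  moreover have "0 \<le> expectation (\<lambda>\<omega>. (D \<omega> + u)\<^sup>2)"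
    by simp
  ultimately show "expectation (\<lambda>\<omega>. (?X \<omega> - T (?X \<omega>))\<^sup>2) \<le> t" "u\<^sup>2 \<le> t"
    unfolding eq using D2 by (auto intro: order_trans[OF _ D2])
qed

text \<open>In the lower bound one t is the second moment lost by clipping, the other bounds the
  squared mean u^2 that recentring removes.\<close>

lemma v_bounds: "1 - 2 * t \<le> v" "v \<le> 1"
proof -
  let ?X = "X 1 1"
  have clip_X: "(\<lambda>\<omega>. clip (?X \<omega>)) \<in> borel_measurable M"
    unfolding clip_def by measurable
  have int2: "integrable M (\<lambda>\<omega>. (clip (?X \<omega>))\<^sup>2)"
    using power_mono[OF clip_bound, of _ 2]
    by (intro integrable_bounded[where B = "b\<^sup>2"] borel_measurable_power clip_X) auto
  have v: "v = expectation (\<lambda>\<omega>. (clip (?X \<omega>))\<^sup>2) - u\<^sup>2"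
    using variance_eq[OF integrable_clip int2] by (simp add: v_def T_def u_def)
  have int_tail: "integrable M (\<lambda>\<omega>. (?X \<omega>)\<^sup>2 * of_bool (b < \<bar>?X \<omega>\<bar>))"
    by (rule Bochner_Integration.integrable_bound[OF integrable_X2]) (auto simp: of_bool_def)
  have "expectation (\<lambda>\<omega>. (clip (?X \<omega>))\<^sup>2) \<le> expectation (\<lambda>\<omega>. (?X \<omega>)\<^sup>2)"
  proof (intro integral_mono int2 integrable_X2)
    fix \<omega>
    have "\<bar>clip (?X \<omega>)\<bar> \<le> \<bar>?X \<omega>\<bar>"
      using b by (auto simp: clip_def)
    then show "(clip (?X \<omega>))\<^sup>2 \<le> (?X \<omega>)\<^sup>2"
      by (simp add: abs_le_square_iff)
  qed
  then show "v \<le> 1"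
    using v var_X by (smt (verit) zero_le_power2)
  have "expectation (\<lambda>\<omega>. (?X \<omega>)\<^sup>2 - (?X \<omega>)\<^sup>2 * of_bool (b < \<bar>?X \<omega>\<bar>)) \<le> expectation (\<lambda>\<omega>. (clip (?X \<omega>))\<^sup>2)"
  proof (intro integral_mono int2 Bochner_Integration.integrable_diff integrable_X2 int_tail)
    show "(?X \<omega>)\<^sup>2 - (?X \<omega>)\<^sup>2 * of_bool (b < \<bar>?X \<omega>\<bar>) \<le> (clip (?X \<omega>))\<^sup>2" for \<omega>
      by (cases "b < \<bar>?X \<omega>\<bar>") (auto simp: clip_def)
  qed
  then have "1 - t \<le> expectation (\<lambda>\<omega>. (clip (?X \<omega>))\<^sup>2)"
    using tail var_X integrable_X2 int_tail by simp
  then show "1 - 2 * t \<le> v"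
    using v remainder(4) by simp
qed

section \<open>Concentration across the channels\<close>

lemma indep_T_rows:
  assumes "j \<in> {1..m}"
  shows "indep_vars (\<lambda>_. borel) (\<lambda>i \<omega>. T (X i j \<omega>)) {1..n}"
  using indep_vars_reindex[OF iid_indep_vars[OF iid_T], of "\<lambda>i. (i, j)" "{1..n}"] assms
  by (auto simp: inj_on_def image_subset_iff)

lemma second_moment_T_sum:
  assumes "j \<in> {1..m}"
  shows "expectation (\<lambda>\<omega>. (\<Sum>i=1..n. T (X i j \<omega>))\<^sup>2) = real n * v"
  using sum_second_moment[OF _ indep_T_rows[OF assms, of n]] T2_integrable mean_T var_T assms by simp

text \<open>Doob's inequality reduces all n to n = 2, where the variances of the m columns are
  independent and bounded. The truncated variance lies below the original one and has mean v, at
  least 1 - 2 t.\<close>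

theorem sample_var_lower_bound:
  assumes \<eta>: "0 < \<eta>"
  shows "prob {\<omega> \<in> space M. \<exists>n\<ge>2. sample_var m n (\<lambda>i j. X i j \<omega>) \<le> 1 - 2 * t - \<eta>} \<le> 8 * b\<^sup>2 / (\<eta> * sqrt (real m))"
proof -
  let ?T = "\<lambda>\<omega> i j. T (X i j \<omega>)"
  define U where "U j \<omega> = (\<Sum>i=1..2. (T (X i j \<omega>))\<^sup>2) - (\<Sum>i=1..2. T (X i j \<omega>))\<^sup>2 / 2" for j \<omega>
  have U_cs: "U j \<omega> = centered_squares 2 (\<lambda>i. T (X i j \<omega>))" for j \<omega>
    by (simp add: U_def centered_squares_def)
  have var_U: "sample_var m 2 (?T \<omega>) = (1 / real m) * (\<Sum>j=1..m. U j \<omega>)" for \<omega>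
    by (simp add: sample_var_eq U_cs)
  have ind_U: "indep_vars (\<lambda>_. borel) U {1..m}"
    unfolding U_def by (rule indep_vars_columns[OF iid_T, of "\<lambda>s q. q - s\<^sup>2 / 2" 2]) measurable
  note rv = indep_vars_measurable[OF ind_U]
  \<comment> \<open>Two squares, each at most \<open>(2 * b)\<^sup>2\<close>.\<close>
  have U_bound: "\<bar>U j \<omega>\<bar> \<le> 8 * b\<^sup>2" for j \<omega>
  proof -
    have "U j \<omega> \<le> (\<Sum>i=1..2. (T (X i j \<omega>))\<^sup>2)"
      unfolding U_cs by (rule centered_squares_le)
    also have "\<dots> \<le> (\<Sum>i=1..2::nat. (2 * b)\<^sup>2)"
      using power_mono[OF T_bound, of _ 2] by (intro sum_mono) simp
    also have "\<dots> = 8 * b\<^sup>2"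
      by (simp add: power_mult_distrib)
    finally show ?thesis
      using centered_squares_nonneg[of 2 "\<lambda>i. T (X i j \<omega>)"] by (simp add: U_cs)
  qed
  have U2_bound: "(U j \<omega>)\<^sup>2 \<le> (8 * b\<^sup>2)\<^sup>2" for j \<omega>
    using power_mono[OF U_bound, of j \<omega> 2] by simp
  have int_U2: "integrable M (\<lambda>\<omega>. (U j \<omega>)\<^sup>2)" if "j \<in> {1..m}" for j
    using rv[OF that] U2_bound by (intro integrable_bounded[where B = "(8 * b\<^sup>2)\<^sup>2"]) auto
  have mean_U: "expectation (U j) = v" if j: "j \<in> {1..m}" for j
  proof -
    have "integrable M (\<lambda>\<omega>. (\<Sum>i=1..2. T (X i j \<omega>))\<^sup>2)"
      using j by (intro integrable_square_sum TX_measurable T2_integrable) auto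
    then have "expectation (U j) = (\<Sum>i=1..2. expectation (\<lambda>\<omega>. (T (X i j \<omega>))\<^sup>2)) - expectation (\<lambda>\<omega>. (\<Sum>i=1..2. T (X i j \<omega>))\<^sup>2) / 2"
      unfolding U_def using T2_integrable j
      by (subst Bochner_Integration.integral_diff) (auto intro!: Bochner_Integration.integral_sum Bochner_Integration.integrable_sum)
    also have "\<dots> = v"
      unfolding second_moment_T_sum[OF j] using var_T j by simp
    finally show ?thesis .
  qed
  have sq_U: "expectation (\<lambda>\<omega>. (U j \<omega>)\<^sup>2) \<le> (8 * b\<^sup>2)\<^sup>2" if "j \<in> {1..m}" for j
    using integral_mono[OF int_U2[OF that] integrable_const U2_bound] by (simp add: prob_space)
  have "prob {\<omega> \<in> space M. \<exists>n\<ge>2. sample_var m n (\<lambda>i j. X i j \<omega>) \<le> 1 - 2 * t - \<eta>}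
      \<le> prob {\<omega> \<in> space M. \<exists>n\<ge>2. \<eta> \<le> \<bar>sample_var m n (?T \<omega>) - v\<bar>}"
  proof (rule finite_measure_mono)
    show "{\<omega> \<in> space M. \<exists>n\<ge>2. sample_var m n (\<lambda>i j. X i j \<omega>) \<le> 1 - 2 * t - \<eta>}
        \<subseteq> {\<omega> \<in> space M. \<exists>n\<ge>2. \<eta> \<le> \<bar>sample_var m n (?T \<omega>) - v\<bar>}"
    proof clarify
      fix \<omega> n assume n: "2 \<le> n" and le: "sample_var m n (\<lambda>i j. X i j \<omega>) \<le> 1 - 2 * t - \<eta>"
      have "sample_var m n (?T \<omega>) \<le> sample_var m n (\<lambda>i j. X i j \<omega>)"
        by (rule sample_var_contraction[OF n T_contraction])
      then show "\<exists>n\<ge>2. \<eta> \<le> \<bar>sample_var m n (?T \<omega>) - v\<bar>"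
        using le v_bounds(1) n by (intro exI[of _ n]) auto
    qed
    have [measurable]: "(\<lambda>\<omega>. sample_var m n (?T \<omega>)) \<in> borel_measurable M" for n
      using integrable_sample_var[of m "\<lambda>i j \<omega>. T (X i j \<omega>)" n] TX_measurable T2_integrable by blast
    show "{\<omega> \<in> space M. \<exists>n\<ge>2. \<eta> \<le> \<bar>sample_var m n (?T \<omega>) - v\<bar>} \<in> events"
      by measurable
  qed
  also have "\<dots> \<le> expectation (\<lambda>\<omega>. \<bar>sample_var m 2 (?T \<omega>) - v\<bar>) / \<eta>"
    by (rule sample_var_maximal[OF iid_T m \<eta>]) (rule T2_integrable)
  also have "\<dots> \<le> sqrt ((8 * b\<^sup>2)\<^sup>2 / real m) / \<eta>"
    unfolding var_U using \<eta> average_deviation[OF ind_U m int_U2 mean_U sq_U]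
    by (intro divide_right_mono) auto
  also have "\<dots> = 8 * b\<^sup>2 / (\<eta> * sqrt (real m))"
    unfolding real_sqrt_divide real_sqrt_abs by simp
  finally show ?thesis .
qed

text \<open>The truncated part has squared norm m / n times an average over columns with mean v
  \<le> 1, which the fourth moment bound makes concentrate; the remainder is small in L^2, with
  second moment at most t per entry.\<close>

lemma mean_norm_excess:
  assumes n: "1 \<le> n"
  shows "expectation (\<lambda>\<omega>. max 0 (mean_norm m n (\<lambda>i j. X i j \<omega>) - sqrt (real m / real n)))
      \<le> sqrt (real m / real n) * (7 * b\<^sup>2 / sqrt (real m) + sqrt t)"
proof -
  define a where "a = sqrt (real m / real n)"
  have a: "a > 0"
    using m n by (simp add: a_def)
  let ?T = "\<lambda>\<omega> i j. T (X i j \<omega>)" and ?R = "\<lambda>\<omega> i j. X i j \<omega> - T (X i j \<omega>)"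
  define U where "U j \<omega> = (\<Sum>i=1..n. T (X i j \<omega>))\<^sup>2 / real n" for j \<omega>
  have ind_U: "indep_vars (\<lambda>_. borel) U {1..m}"
    unfolding U_def by (rule indep_vars_columns[OF iid_T, of "\<lambda>s q. s\<^sup>2 / real n" n]) measurable
  note rv = indep_vars_measurable[OF ind_U]
  have U2: "(U j \<omega>)\<^sup>2 = (1 / (real n)\<^sup>2) * (\<Sum>i=1..n. T (X i j \<omega>)) ^ 4" for j \<omega>
    by (simp add: U_def power_divide flip: power_mult)
  have int_U2: "integrable M (\<lambda>\<omega>. (U j \<omega>)\<^sup>2)" if j: "j \<in> {1..m}" for j
  proof (rule integrable_bounded)
    show "(\<lambda>\<omega>. (U j \<omega>)\<^sup>2) \<in> borel_measurable M"
      using rv[OF j] by simp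
    fix \<omega>
    have "\<bar>\<Sum>i=1..n. T (X i j \<omega>)\<bar> \<le> real (card {1..n}) * (2 * b)"
      by (rule order_trans[OF sum_abs sum_bounded_above]) (rule T_bound)
    then have "\<bar>\<Sum>i=1..n. T (X i j \<omega>)\<bar> ^ 4 \<le> (real n * (2 * b)) ^ 4"
      by (intro power_mono) auto
    then show "\<bar>(U j \<omega>)\<^sup>2\<bar> \<le> (1 / (real n)\<^sup>2) * (real n * (2 * b)) ^ 4"
      unfolding U2 by (simp add: divide_right_mono power_even_abs)
  qed
  have mean_U: "expectation (U j) = v" if "j \<in> {1..m}" for j
    unfolding U_def using second_moment_T_sum[OF that, of n] n by simp
  \<comment> \<open>48 is 3 * 2^4, from the fourth moment bound for variables of size 2 b. Its root
    is later bounded by 7.\<close>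
  have sq_U: "expectation (\<lambda>\<omega>. (U j \<omega>)\<^sup>2) \<le> 48 * b ^ 4" if j: "j \<in> {1..m}" for j
  proof -
    have "expectation (\<lambda>\<omega>. (\<Sum>i=1..n. T (X i j \<omega>)) ^ 4) \<le> 3 * (real (card {1..n}))\<^sup>2 * (2 * b) ^ 4"
      using j by (intro sum_fourth_moment indep_T_rows T_bound mean_T) auto
    then have "(1 / (real n)\<^sup>2) * expectation (\<lambda>\<omega>. (\<Sum>i=1..n. T (X i j \<omega>)) ^ 4) \<le> (1 / (real n)\<^sup>2) * (3 * (real (card {1..n}))\<^sup>2 * (2 * b) ^ 4)"
      by (rule mult_left_mono) simp
    then show ?thesis
      unfolding U2 using n by (simp add: power_mult_distrib)
  qed
  have mean_T_eq: "(mean_norm m n (?T \<omega>) / a)\<^sup>2 = (1 / real m) * (\<Sum>j=1..m. U j \<omega>)" for \<omega>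
  proof -
    have "(mean_norm m n (?T \<omega>))\<^sup>2 = (\<Sum>j=1..m. ((1 / real n) * (\<Sum>i=1..n. T (X i j \<omega>)))\<^sup>2)"
      by (simp add: L2_set_def sum_nonneg sample_mean_def)
    also have "\<dots> = (\<Sum>j=1..m. (1 / real n) * U j \<omega>)"
      by (rule sum.cong) (simp_all add: U_def power_mult_distrib power2_eq_square)
    also have "\<dots> = (1 / real n) * (\<Sum>j=1..m. U j \<omega>)"
      by (rule sum_distrib_left[symmetric])
    finally show ?thesis
      using n by (simp add: power_divide a_def)
  qed
  have excess: "max 0 (mean_norm m n (\<lambda>i j. X i j \<omega>) - a)
      \<le> a * \<bar>(1 / real m) * (\<Sum>j=1..m. U j \<omega>) - v\<bar> + mean_norm m n (?R \<omega>)" for \<omega>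
  proof -
    define x where "x = mean_norm m n (?T \<omega>) / a"
    have x0: "0 \<le> x"
      using a by (simp add: x_def)
    have "mean_norm m n (\<lambda>i j. X i j \<omega>) = L2_set (\<lambda>j. sample_mean m n (?T \<omega>) j + sample_mean m n (?R \<omega>) j) {1..m}"
      by (rule L2_set_cong) (auto simp: sample_mean_def sum_subtractf right_diff_distrib)
    also have "\<dots> \<le> a * x + mean_norm m n (?R \<omega>)"
      using L2_set_triangle_ineq[of "sample_mean m n (?T \<omega>)" "sample_mean m n (?R \<omega>)" "{1..m}"] a by (simp add: x_def)
    finally have "mean_norm m n (\<lambda>i j. X i j \<omega>) - a \<le> a * (x - 1) + mean_norm m n (?R \<omega>)"
      by (simp add: algebra_simps)
    \<comment> \<open>For x above 1 this is x \<le> x^2 together with v \<le> 1; passing to squares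
      leaves a plain average over the columns.\<close>
    also have "x - 1 \<le> \<bar>x\<^sup>2 - v\<bar>"
    proof (cases "x \<le> 1")
      case False
      then have "x * 1 \<le> x * x"
        by (intro mult_left_mono) auto
      then show ?thesis
        using v_bounds(2) by (simp add: power2_eq_square)
    qed auto
    finally have "mean_norm m n (\<lambda>i j. X i j \<omega>) - a \<le> a * \<bar>x\<^sup>2 - v\<bar> + mean_norm m n (?R \<omega>)"
      using a by simp
    then show ?thesis
      using a mean_T_eq[of \<omega>] by (simp add: x_def)
  qed
  have R_measurable: "(\<lambda>x. x - T x) \<in> borel_measurable borel" "(\<lambda>x. (x - T x)\<^sup>2) \<in> borel_measurable borel"
    by measurable
  have rv_R: "(\<lambda>\<omega>. ?R \<omega> i j) \<in> borel_measurable M" if "1 \<le> i" "j \<in> {1..m}" for i j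
    using measurable_compose[OF X_measurable[OF that] R_measurable(1)] .
  have int_R2: "integrable M (\<lambda>\<omega>. (?R \<omega> i j)\<^sup>2)" and R2: "expectation (\<lambda>\<omega>. (?R \<omega> i j)\<^sup>2) \<le> t"
    and mean_R: "expectation (\<lambda>\<omega>. ?R \<omega> i j) = 0" if "1 \<le> i" "j \<in> {1..m}" for i j
    using remainder integrable_X[OF that R_measurable(2)] expectation_X[OF that R_measurable(2)]
      expectation_X[OF that R_measurable(1)] by simp_all
  have int_R: "integrable M (\<lambda>\<omega>. ?R \<omega> i j)" if "1 \<le> i" "j \<in> {1..m}" for i j
    by (rule square_integrable_imp_integrable[OF rv_R[OF that] int_R2[OF that]])
  have int_mR: "integrable M (\<lambda>\<omega>. mean_norm m n (?R \<omega>))"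
    by (rule integrable_mean_norm[OF rv_R int_R])
  have norm_R: "expectation (\<lambda>\<omega>. mean_norm m n (?R \<omega>)) \<le> a * sqrt t"
  proof -
    have ind_R: "indep_vars (\<lambda>_. borel) (\<lambda>i \<omega>. ?R \<omega> i j) {1..n}" if "j \<in> {1..m}" for j
      using indep_vars_reindex[OF iid_indep_vars[OF iid_compose[OF iid_X R_measurable(1)]], of "\<lambda>i. (i, j)" "{1..n}"] that
      by (auto simp: inj_on_def image_subset_iff)
    have sq: "(mean_norm m n (?R \<omega>))\<^sup>2 = (1 / (real n)\<^sup>2) * (\<Sum>j=1..m. (\<Sum>i=1..n. ?R \<omega> i j)\<^sup>2)" for \<omega>
    proof -
      have "(mean_norm m n (?R \<omega>))\<^sup>2 = (\<Sum>j=1..m. ((1 / real n) * (\<Sum>i=1..n. ?R \<omega> i j))\<^sup>2)"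
        by (simp add: L2_set_def sum_nonneg sample_mean_def)
      then show ?thesis
        unfolding power_mult_distrib sum_distrib_left[symmetric] by (simp only: power_divide power_one)
    qed
    have int_S: "integrable M (\<lambda>\<omega>. (\<Sum>i=1..n. ?R \<omega> i j)\<^sup>2)" if "j \<in> {1..m}" for j
      using that by (intro integrable_square_sum rv_R int_R2) auto
    have int_N: "integrable M (\<lambda>\<omega>. (mean_norm m n (?R \<omega>))\<^sup>2)"
      unfolding sq by (intro integrable_mult_right Bochner_Integration.integrable_sum int_S)
    have "expectation (\<lambda>\<omega>. mean_norm m n (?R \<omega>)) = expectation (\<lambda>\<omega>. \<bar>mean_norm m n (?R \<omega>)\<bar>)"
      by simp
    also have "\<dots> \<le> sqrt (expectation (\<lambda>\<omega>. (mean_norm m n (?R \<omega>))\<^sup>2))"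
      by (intro expectation_abs_le_sqrt int_N borel_measurable_integrable int_mR)
    also have "\<dots> \<le> sqrt (a\<^sup>2 * t)"
    proof (rule real_sqrt_le_mono)
      have "expectation (\<lambda>\<omega>. (mean_norm m n (?R \<omega>))\<^sup>2)
          = (1 / (real n)\<^sup>2) * (\<Sum>j=1..m. expectation (\<lambda>\<omega>. (\<Sum>i=1..n. ?R \<omega> i j)\<^sup>2))"
        unfolding sq integral_mult_right_zero
        by (intro arg_cong2[where f = times] refl Bochner_Integration.integral_sum int_S)
      also have "\<dots> = (1 / (real n)\<^sup>2) * (\<Sum>j=1..m. \<Sum>i=1..n. expectation (\<lambda>\<omega>. (?R \<omega> i j)\<^sup>2))"
        by (intro arg_cong2[where f = times] sum.cong refl sum_second_moment ind_R int_R2 mean_R) auto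
      also have "\<dots> \<le> (1 / (real n)\<^sup>2) * (\<Sum>j=1..m. \<Sum>i=1..n. t)"
        using R2 by (intro mult_left_mono sum_mono) auto
      also have "\<dots> = a\<^sup>2 * t"
        using n by (simp add: a_def power2_eq_square)
      finally show "expectation (\<lambda>\<omega>. (mean_norm m n (?R \<omega>))\<^sup>2) \<le> a\<^sup>2 * t" .
    qed
    also have "\<dots> = a * sqrt t"
      using a by (simp add: real_sqrt_mult)
    finally show ?thesis .
  qed
  have int_dev: "integrable M (\<lambda>\<omega>. \<bar>(1 / real m) * (\<Sum>j=1..m. U j \<omega>) - v\<bar>)"
    by (intro integrable_abs Bochner_Integration.integrable_diff integrable_const integrable_mult_right
        Bochner_Integration.integrable_sum square_integrable_imp_integrable[OF rv int_U2])
  have int_X: "integrable M (X i j)" if "1 \<le> i" "j \<in> {1..m}" for i j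
    using integrable_X[OF that, of "\<lambda>x. x"] integrable_X11 by simp
  have "expectation (\<lambda>\<omega>. max 0 (mean_norm m n (\<lambda>i j. X i j \<omega>) - a))
      \<le> expectation (\<lambda>\<omega>. a * \<bar>(1 / real m) * (\<Sum>j=1..m. U j \<omega>) - v\<bar> + mean_norm m n (?R \<omega>))"
    by (intro integral_mono excess integrable_max integrable_const Bochner_Integration.integrable_diff
        Bochner_Integration.integrable_add integrable_mult_right int_dev int_mR integrable_mean_norm X_measurable int_X)
  also have "\<dots> = a * expectation (\<lambda>\<omega>. \<bar>(1 / real m) * (\<Sum>j=1..m. U j \<omega>) - v\<bar>) + expectation (\<lambda>\<omega>. mean_norm m n (?R \<omega>))"
    using int_dev int_mR by simp
  also have "\<dots> \<le> a * sqrt (48 * b ^ 4 / real m) + a * sqrt t"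
    using a by (intro add_mono norm_R mult_left_mono average_deviation[OF ind_U m int_U2 mean_U sq_U]) auto
  also have "sqrt (48 * b ^ 4 / real m) \<le> 7 * b\<^sup>2 / sqrt (real m)"
  proof -
    have "sqrt (48 * b ^ 4) \<le> sqrt ((7 * b\<^sup>2)\<^sup>2)"
      by (intro real_sqrt_le_mono) (simp add: power_mult_distrib flip: power_mult)
    also have "\<dots> = 7 * b\<^sup>2"
      unfolding real_sqrt_abs by simp
    finally show ?thesis
      unfolding real_sqrt_divide by (rule divide_right_mono) simp
  qed
  finally show ?thesis
    using a by (simp add: a_def algebra_simps)
qed

text \<open>The excess is measured in units of sqrt (m / a), which cancels: the bound does not
  depend on a, and a may later be adapted to m and the noise scale.\<close>

theorem mean_norm_upper_bound:
  assumes a: "1 \<le> a" and \<eta>: "0 < \<eta>"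
  shows "prob {\<omega> \<in> space M. \<exists>n\<ge>a. (1 + \<eta>) * sqrt (real m / real a) \<le> mean_norm m n (\<lambda>i j. X i j \<omega>)}
      \<le> (7 * b\<^sup>2 / sqrt (real m) + sqrt t) / \<eta>"
proof -
  define s where "s = sqrt (real m / real a)"
  have s: "s > 0"
    using m a by (simp add: s_def)
  have int_X: "integrable M (X i j)" if "1 \<le> i" "j \<in> {1..m}" for i j
    using integrable_X[OF that, of "\<lambda>x. x"] integrable_X11 by simp
  have "prob {\<omega> \<in> space M. \<exists>n\<ge>a. s + \<eta> * s \<le> mean_norm m n (\<lambda>i j. X i j \<omega>)}
      \<le> expectation (\<lambda>\<omega>. max 0 (mean_norm m a (\<lambda>i j. X i j \<omega>) - s)) / (\<eta> * s)"
    using s \<eta> by (intro mean_norm_maximal[OF iid_X m a] int_X) auto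
  also have "\<dots> \<le> (s * (7 * b\<^sup>2 / sqrt (real m) + sqrt t)) / (\<eta> * s)"
    using s \<eta> mean_norm_excess[OF a] by (intro divide_right_mono) (auto simp: s_def)
  also have "\<dots> = (7 * b\<^sup>2 / sqrt (real m) + sqrt t) / \<eta>"
    using s by simp
  finally show ?thesis
    by (simp add: s_def algebra_simps)
qed

end

section \<open>The stopped sample mean\<close>

context prob_space
begin

lemma sample_var_measurable:
  assumes "\<And>i j. 1 \<le> i \<Longrightarrow> j \<in> {1..m} \<Longrightarrow> X i j \<in> borel_measurable M"
  shows "(\<lambda>\<omega>. sample_var m n (\<lambda>i j. X i j \<omega>)) \<in> borel_measurable M"
  unfolding sample_var_def
  by (intro borel_measurable_times borel_measurable_const borel_measurable_sum borel_measurable_power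
      borel_measurable_diff assms) auto

lemma sample_mean_measurable:
  assumes "\<And>i j. 1 \<le> i \<Longrightarrow> j \<in> {1..m} \<Longrightarrow> X i j \<in> borel_measurable M"
  shows "(\<lambda>\<omega>. sample_mean m n (\<lambda>i j. X i j \<omega>) j) \<in> borel_measurable M"
proof (cases "j \<in> {1..m}")
  case True
  then show ?thesis
    unfolding sample_mean_def if_P[OF True]
    by (intro borel_measurable_times borel_measurable_const borel_measurable_sum assms) auto
qed (auto simp: sample_mean_def)

lemma num_reps_measurable:
  assumes "\<And>i j. 1 \<le> i \<Longrightarrow> j \<in> {1..m} \<Longrightarrow> X i j \<in> borel_measurable M"
  shows "(\<lambda>\<omega>. num_reps m c d (\<lambda>i j. X i j \<omega>)) \<in> measurable M (count_space UNIV)"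
proof -
  note [measurable] = sample_var_measurable[OF assms]
  show ?thesis
    unfolding num_reps_def by measurable
qed

lemma mean_norm_measurable:
  assumes "\<And>i j. 1 \<le> i \<Longrightarrow> j \<in> {1..m} \<Longrightarrow> X i j \<in> borel_measurable M"
  shows "(\<lambda>\<omega>. mean_norm m n (\<lambda>i j. X i j \<omega>)) \<in> borel_measurable M"
proof -
  note [measurable] = sample_mean_measurable[OF assms]
  show ?thesis
    unfolding L2_set_def by measurable
qed

text \<open>The condition \<open>2 \<le> num_reps\<close> excludes the unspecified value that \<open>LEAST\<close> takes when no \<open>n\<close> qualifies.\<close>

definition stopped_badly :: "nat \<Rightarrow> (nat \<Rightarrow> nat \<Rightarrow> 'a \<Rightarrow> real) \<Rightarrow> real \<Rightarrow> real \<Rightarrow> real \<Rightarrow> 'a set" where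
  "stopped_badly m X c d \<kappa> = {\<omega> \<in> space M.
     \<not> (2 \<le> num_reps m c d (\<lambda>i j. X i j \<omega>) \<and>
        mean_norm m (num_reps m c d (\<lambda>i j. X i j \<omega>)) (\<lambda>i j. X i j \<omega>) \<le> \<kappa> * (c * d))}"

lemma stopped_badly_measurable:
  assumes "\<And>i j. 1 \<le> i \<Longrightarrow> j \<in> {1..m} \<Longrightarrow> X i j \<in> borel_measurable M"
  shows "stopped_badly m X c d \<kappa> \<in> events"
proof -
  note [measurable] = num_reps_measurable[OF assms, where c = c and d = d] mean_norm_measurable[OF assms]
  have [measurable]: "(\<lambda>\<omega>. mean_norm m (num_reps m c d (\<lambda>i j. X i j \<omega>)) (\<lambda>i j. X i j \<omega>)) \<in> borel_measurable M"
    by (rule measurable_compose_countable[where g = "\<lambda>\<omega>. num_reps m c d (\<lambda>i j. X i j \<omega>)"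
          and f = "\<lambda>n \<omega>. mean_norm m n (\<lambda>i j. X i j \<omega>)"]) measurable
  show ?thesis
    unfolding stopped_badly_def by measurable
qed

end

section \<open>The exceptional event for errors of variance one\<close>

context standardised_array
begin

text \<open>A crude bound by the uncentred squares, with n / (n - 1) \<le> 2; it serves only to show
  that the stopping rule terminates almost surely.\<close>

lemma expectation_sample_var_le:
  assumes n: "2 \<le> n"
  shows "expectation (\<lambda>\<omega>. sample_var m n (\<lambda>i j. X i j \<omega>)) \<le> 2"
proof -
  have int: "integrable M (\<lambda>\<omega>. (X i j \<omega>)\<^sup>2)" and sq: "expectation (\<lambda>\<omega>. (X i j \<omega>)\<^sup>2) = 1"
    if "1 \<le> i" "j \<in> {1..m}" for i j
    using integrable_X[OF that, of "\<lambda>x. x\<^sup>2"] expectation_X[OF that, of "\<lambda>x. x\<^sup>2"] integrable_X2 var_X by simp_all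
  define S where "S \<omega> = (1 / real m) * (\<Sum>j=1..m. (1 / (real n - 1)) * (\<Sum>i=1..n. (X i j \<omega>)\<^sup>2))" for \<omega>
  have int_S: "integrable M S"
    unfolding S_def by (intro integrable_mult_right Bochner_Integration.integrable_sum int) auto
  have "expectation (\<lambda>\<omega>. sample_var m n (\<lambda>i j. X i j \<omega>)) \<le> expectation S"
  proof (intro integral_mono int_S integrable_sample_var X_measurable int)
    show "sample_var m n (\<lambda>i j. X i j \<omega>) \<le> S \<omega>" for \<omega>
      unfolding sample_var_eq S_def using n by (intro mult_left_mono sum_mono centered_squares_le) auto
  qed auto
  also have "expectation S = (1 / real m) * (\<Sum>j=1..m. (1 / (real n - 1)) * (\<Sum>i=1..n. expectation (\<lambda>\<omega>. (X i j \<omega>)\<^sup>2)))"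
  proof -
    have inner: "expectation (\<lambda>\<omega>. (1 / (real n - 1)) * (\<Sum>i=1..n. (X i j \<omega>)\<^sup>2))
        = (1 / (real n - 1)) * (\<Sum>i=1..n. expectation (\<lambda>\<omega>. (X i j \<omega>)\<^sup>2))" if "j \<in> {1..m}" for j
      unfolding integral_mult_right_zero using that
      by (intro arg_cong2[where f = times] refl Bochner_Integration.integral_sum int) auto
    have "expectation S = (1 / real m) * (\<Sum>j=1..m. expectation (\<lambda>\<omega>. (1 / (real n - 1)) * (\<Sum>i=1..n. (X i j \<omega>)\<^sup>2)))"
      unfolding S_def integral_mult_right_zero[of _ "1 / real m"]
      by (intro arg_cong2[where f = times] refl Bochner_Integration.integral_sum integrable_mult_right
          Bochner_Integration.integrable_sum int) auto
    then show ?thesis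
      by (simp only: sum.cong[OF refl inner])
  qed
  also have "\<dots> = real n / (real n - 1)"
    using m sq by simp
  also have "\<dots> \<le> 2"
    using n by (simp add: field_simps)
  finally show ?thesis .
qed

text \<open>Almost sure termination: the criterion asks the sample variance to fall below a multiple
  of n, while its expectation stays bounded; Markov's inequality for each single n leaves a
  probability of order 1 / n.\<close>

lemma criterion_met:
  assumes \<kappa>: "0 < \<kappa>"
  shows "prob {\<omega> \<in> space M. \<forall>n\<ge>2. real n * \<kappa> \<le> sample_var m n (\<lambda>i j. X i j \<omega>)} = 0"
proof -
  let ?E = "{\<omega> \<in> space M. \<forall>n\<ge>2. real n * \<kappa> \<le> sample_var m n (\<lambda>i j. X i j \<omega>)}"
  note [measurable] = sample_var_measurable[OF X_measurable]
  have le: "prob ?E \<le> (2 / \<kappa>) * (1 / real n)" if n: "2 \<le> n" for n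
  proof -
    have int: "integrable M (\<lambda>\<omega>. sample_var m n (\<lambda>i j. X i j \<omega>))"
      using integrable_X[of _ _ "\<lambda>x. x\<^sup>2"] integrable_X2 by (intro integrable_sample_var X_measurable) auto
    have "prob ?E \<le> prob {\<omega> \<in> space M. real n * \<kappa> \<le> sample_var m n (\<lambda>i j. X i j \<omega>)}"
      using n by (intro finite_measure_mono) auto
    also have "\<dots> \<le> expectation (\<lambda>\<omega>. sample_var m n (\<lambda>i j. X i j \<omega>)) / (real n * \<kappa>)"
      using n \<kappa> sample_var_nonneg[OF n] by (intro integral_Markov_inequality_measure[where A = "space M"] int) auto
    also have "\<dots> \<le> 2 / (real n * \<kappa>)"
      using n \<kappa> by (intro divide_right_mono expectation_sample_var_le) auto
    finally show ?thesis
      by (simp add: mult.commute)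
  qed
  have "(\<lambda>n. (2 / \<kappa>) * (1 / real n)) \<longlonglongrightarrow> (2 / \<kappa>) * 0"
    by (intro tendsto_intros lim_1_over_n)
  then have "prob ?E \<le> (2 / \<kappa>) * 0"
    using le by (intro LIMSEQ_le_const) auto
  then show ?thesis
    by (simp add: measure_le_0_iff)
qed

text \<open>Off three events (no termination, some sample variance at most \<beta>, a mean too large
  from a on) the rule cannot stop before a, and from a on the mean is small enough. The randomness
  of the stopping index does no harm, as the last two events take all relevant n into account at
  once.\<close>

lemma stopped_badly_bound:
  assumes \<sigma>: "0 < \<sigma>" and c: "0 < c" and d: "0 < d" and \<eta>: "0 < \<eta>" and \<gamma>: "2 * t + \<eta> < 1"
    and \<kappa>: "(1 + \<eta>) / sqrt (1 - 2 * t - \<eta>) \<le> \<kappa>"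
  shows "prob (stopped_badly m (\<lambda>i j \<omega>. \<sigma> * X i j \<omega>) c d \<kappa>) \<le> 15 * b\<^sup>2 / (\<eta> * sqrt (real m)) + sqrt t / \<eta>"
proof -
  let ?\<xi> = "\<lambda>\<omega> i j. X i j \<omega>"
  define \<beta> where "\<beta> = 1 - 2 * t - \<eta>"
  have \<beta>: "0 < \<beta>"
    using \<gamma> by (simp add: \<beta>_def)
  \<comment> \<open>The number of repetitions that the criterion enforces when the standardised
    sample variance exceeds \<beta>; in terms of \<open>k\<close> below it is \<beta> / k.\<close>
  define r where "r = real m * \<beta> * \<sigma>\<^sup>2 / (c * d)\<^sup>2"
  define a where "a = max 2 (nat \<lceil>r\<rceil>)"
  have a: "1 \<le> a" "2 \<le> a" "r \<le> real a"
    using real_nat_ceiling_ge[of r] by (auto simp: a_def)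
  define k where "k = (c * d)\<^sup>2 / (real m * \<sigma>\<^sup>2)"
  have k: "0 < k"
    using c d m \<sigma> by (simp add: k_def)
  define E0 where "E0 = {\<omega> \<in> space M. \<forall>n\<ge>2. real n * k \<le> sample_var m n (?\<xi> \<omega>)}"
  define E1 where "E1 = {\<omega> \<in> space M. \<exists>n\<ge>2. sample_var m n (?\<xi> \<omega>) \<le> \<beta>}"
  define E2 where "E2 = {\<omega> \<in> space M. \<exists>n\<ge>a. (1 + \<eta>) * sqrt (real m / real a) \<le> mean_norm m n (?\<xi> \<omega>)}"
  note [measurable] = sample_var_measurable[OF X_measurable] mean_norm_measurable[OF X_measurable]
  have E [measurable]: "E0 \<in> events" "E1 \<in> events" "E2 \<in> events"
    unfolding E0_def E1_def E2_def by measurable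
  \<comment> \<open>In standardised variables the criterion compares the sample variance with a line
    of slope \<open>k\<close> in n.\<close>
  have crit: "real m * sample_var m n (\<lambda>i j. \<sigma> * X i j \<omega>) / (real n * c\<^sup>2) \<le> d\<^sup>2 \<longleftrightarrow> sample_var m n (?\<xi> \<omega>) \<le> real n * k"
    if "2 \<le> n" for n \<omega>
    using that c d m \<sigma> by (simp add: sample_var_scale k_def power_mult_distrib field_simps)
  have subset: "stopped_badly m (\<lambda>i j \<omega>. \<sigma> * X i j \<omega>) c d \<kappa> \<subseteq> E0 \<union> E1 \<union> E2"
  proof
    fix \<omega> assume bad: "\<omega> \<in> stopped_badly m (\<lambda>i j \<omega>. \<sigma> * X i j \<omega>) c d \<kappa>"
    show "\<omega> \<in> E0 \<union> E1 \<union> E2"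
    proof (rule ccontr)
      assume not: "\<omega> \<notin> E0 \<union> E1 \<union> E2"
      have \<omega>: "\<omega> \<in> space M"
        using bad by (simp add: stopped_badly_def)
      define n where "n = num_reps m c d (\<lambda>i j. \<sigma> * X i j \<omega>)"
      obtain n0 where "2 \<le> n0" "sample_var m n0 (?\<xi> \<omega>) \<le> real n0 * k"
        using not \<omega> unfolding E0_def by fastforce
      then have "2 \<le> n0 \<and> real m * sample_var m n0 (\<lambda>i j. \<sigma> * X i j \<omega>) / (real n0 * c\<^sup>2) \<le> d\<^sup>2"
        using crit by blast
      then have "2 \<le> n \<and> real m * sample_var m n (\<lambda>i j. \<sigma> * X i j \<omega>) / (real n * c\<^sup>2) \<le> d\<^sup>2"
        unfolding n_def num_reps_def by (rule LeastI)
      then have n: "2 \<le> n" "sample_var m n (?\<xi> \<omega>) \<le> real n * k"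
        using crit by blast+
      moreover have "\<beta> < sample_var m n (?\<xi> \<omega>)"
        using not \<omega> n(1) unfolding E1_def by fastforce
      ultimately have "\<beta> < real n * k"
        by linarith
      then have "r < real n"
        using c d m \<sigma> by (simp add: r_def k_def field_simps)
      then have "a \<le> n"
        using n(1) by (auto simp: a_def)
      then have "mean_norm m n (?\<xi> \<omega>) \<le> (1 + \<eta>) * sqrt (real m / real a)"
        using not \<omega> unfolding E2_def by fastforce
      then have "\<sigma> * mean_norm m n (?\<xi> \<omega>) \<le> \<sigma> * ((1 + \<eta>) * sqrt (real m / real a))"
        using \<sigma> by (intro mult_left_mono) auto
      also have "\<dots> = (1 + \<eta>) * sqrt (\<sigma>\<^sup>2 * real m / real a)"
        using \<sigma> by (simp add: real_sqrt_mult real_sqrt_divide)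
      also have "\<dots> \<le> (1 + \<eta>) * sqrt ((c * d)\<^sup>2 / \<beta>)"
      proof (intro mult_left_mono real_sqrt_le_mono)
        have "real m * \<beta> * \<sigma>\<^sup>2 \<le> real a * (c * d)\<^sup>2"
          using a(3) c d by (simp add: r_def field_simps)
        then show "\<sigma>\<^sup>2 * real m / real a \<le> (c * d)\<^sup>2 / \<beta>"
          using a(1) \<beta> by (simp add: field_simps)
      qed (use \<eta> in simp)
      also have "\<dots> = (1 + \<eta>) / sqrt \<beta> * (c * d)"
        using c d by (simp add: real_sqrt_divide)
      also have "\<dots> \<le> \<kappa> * (c * d)"
        using \<kappa> c d by (intro mult_right_mono) (auto simp: \<beta>_def)
      finally have "mean_norm m n (\<lambda>i j. \<sigma> * X i j \<omega>) \<le> \<kappa> * (c * d)"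
        by (simp only: mean_norm_scale[OF less_imp_le[OF \<sigma>]])
      then show False
        using bad n(1) unfolding stopped_badly_def mem_Collect_eq n_def[symmetric] by blast
    qed
  qed
  have "prob (stopped_badly m (\<lambda>i j \<omega>. \<sigma> * X i j \<omega>) c d \<kappa>) \<le> prob (E0 \<union> E1 \<union> E2)"
    by (intro finite_measure_mono subset) measurable
  also have "\<dots> \<le> prob E0 + prob E1 + prob E2"
    using measure_Un_le[OF sets.Un[OF E(1,2)] E(3)] measure_Un_le[OF E(1,2)] by linarith
  also have "\<dots> \<le> 0 + 8 * b\<^sup>2 / (\<eta> * sqrt (real m)) + (7 * b\<^sup>2 / sqrt (real m) + sqrt t) / \<eta>"
    using criterion_met[OF k] sample_var_lower_bound[OF \<eta>] mean_norm_upper_bound[OF a(1) \<eta>]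
    unfolding E0_def E1_def E2_def \<beta>_def by (intro add_mono) auto
  also have "\<dots> = 15 * b\<^sup>2 / (\<eta> * sqrt (real m)) + sqrt t / \<eta>"
    using \<eta> by (simp add: add_divide_distrib algebra_simps)
  finally show ?thesis .
qed

end

section \<open>Uniformity in the number of channels\<close>

context prob_space
begin

text \<open>Relative to the variance and with the level in units of the standard deviation, hence
  invariant under scaling; uniformly in m it says that the squares of the standardised errors are
  uniformly integrable. For errors vanishing almost surely both sides are 0.\<close>

definition tail_ratio_le :: "('a \<Rightarrow> real) \<Rightarrow> real \<Rightarrow> real \<Rightarrow> bool" where
  "tail_ratio_le X b t \<longleftrightarrow>
     expectation (\<lambda>\<omega>. (X \<omega>)\<^sup>2 * of_bool (b * sqrt (expectation (\<lambda>\<omega>. (X \<omega>)\<^sup>2)) < \<bar>X \<omega>\<bar>)) \<le> t * expectation (\<lambda>\<omega>. (X \<omega>)\<^sup>2)"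

lemma stopped_badly_le:
  assumes X: "iid M (\<lambda>(i, j). X i j) ({1..} \<times> {1..m})" and m: "1 \<le> m"
    and int2: "integrable M (\<lambda>\<omega>. (X 1 1 \<omega>)\<^sup>2)" and mean: "expectation (X 1 1) = 0"
    and b: "0 < b" and t: "0 \<le> t" and tail: "tail_ratio_le (X 1 1) b t"
    and c: "0 < c" and d: "0 < d" and \<eta>: "0 < \<eta>" and \<gamma>: "2 * t + \<eta> < 1"
    and \<kappa>: "(1 + \<eta>) / sqrt (1 - 2 * t - \<eta>) \<le> \<kappa>"
  shows "prob (stopped_badly m X c d \<kappa>) \<le> 15 * b\<^sup>2 / (\<eta> * sqrt (real m)) + sqrt t / \<eta>"
proof -
  define \<sigma> where "\<sigma> = sqrt (expectation (\<lambda>\<omega>. (X 1 1 \<omega>)\<^sup>2))"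
  have \<sigma>2: "\<sigma>\<^sup>2 = expectation (\<lambda>\<omega>. (X 1 1 \<omega>)\<^sup>2)" and \<sigma>0: "0 \<le> \<sigma>"
    by (simp_all add: \<sigma>_def)
  have rv: "X i j \<in> borel_measurable M" if "1 \<le> i" "j \<in> {1..m}" for i j
    using iid_random_variable[OF X, of "(i, j)"] that by simp
  show ?thesis
  proof (cases "\<sigma> = 0")
    case True
    \<comment> \<open>Errors of variance zero cannot be standardised. They vanish almost surely, the
      rule then stops at n = 2, and the mean is 0.\<close>
    have "AE \<omega> in M. X i j \<omega> = 0" if "1 \<le> i" "j \<in> {1..m}" for i j
    proof -
      have "expectation (\<lambda>\<omega>. (X i j \<omega>)\<^sup>2) = 0" "integrable M (\<lambda>\<omega>. (X i j \<omega>)\<^sup>2)"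
        using iid_expectation_eq[OF X, of "(i, j)" "(1, 1)" "\<lambda>x. x\<^sup>2"] iid_integrable_iff[OF X, of "(i, j)" "(1, 1)" "\<lambda>x. x\<^sup>2"]
          that m int2 True \<sigma>2 by simp_all
      then show ?thesis
        using integral_nonneg_eq_0_iff_AE[of M "\<lambda>\<omega>. (X i j \<omega>)\<^sup>2"] by simp
    qed
    then have "AE \<omega> in M. \<forall>i\<in>{1..}. \<forall>j\<in>{1..m}. X i j \<omega> = 0"
      by (intro AE_ball_countable') auto
    then have "AE \<omega> in M. \<omega> \<notin> stopped_badly m X c d \<kappa>"
    proof (rule AE_mp, intro AE_I2 impI)
      fix \<omega> assume z: "\<forall>i\<in>{1..}. \<forall>j\<in>{1..m}. X i j \<omega> = 0"
      have var: "sample_var m n (\<lambda>i j. X i j \<omega>) = 0" and mn: "mean_norm m n (\<lambda>i j. X i j \<omega>) = 0" for n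
        using sample_var_cong[of n m "\<lambda>i j. X i j \<omega>" "\<lambda>_ _. 0"] mean_norm_cong[of n m "\<lambda>i j. X i j \<omega>" "\<lambda>_ _. 0"] z
        by (simp_all add: sample_var_def sample_mean_def L2_set_def)
      have "0 \<le> \<kappa>"
        using \<kappa> \<eta> \<gamma> by (smt (verit) divide_nonneg_nonneg real_sqrt_ge_zero)
      moreover have "2 \<le> num_reps m c d (\<lambda>i j. X i j \<omega>)"
        unfolding num_reps_def var by (rule LeastI2[of _ 2]) auto
      ultimately show "\<omega> \<notin> stopped_badly m X c d \<kappa>"
        unfolding stopped_badly_def mem_Collect_eq mn using c d by simp
    qed
    then have "prob (stopped_badly m X c d \<kappa>) = 0"
      using stopped_badly_measurable[OF rv] by (subst prob_eq_0) auto
    then show ?thesis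
      using \<eta> t by simp
  next
    case False
    then have \<sigma>: "0 < \<sigma>"
      using \<sigma>0 by simp
    interpret S: standardised_array M "\<lambda>i j \<omega>. X i j \<omega> / \<sigma>" m b t
    proof (unfold_locales)
      have "(\<lambda>(i, j) \<omega>. X i j \<omega> / \<sigma>) = (\<lambda>p \<omega>. (\<lambda>(i, j). X i j) p \<omega> / \<sigma>)"
        by (auto simp: fun_eq_iff)
      then show "iid M (\<lambda>(i, j) \<omega>. X i j \<omega> / \<sigma>) ({1..} \<times> {1..m})"
        using iid_compose[OF X, of "\<lambda>x. x / \<sigma>"] by simp
      show "integrable M (\<lambda>\<omega>. (X 1 1 \<omega> / \<sigma>)\<^sup>2)" "expectation (\<lambda>\<omega>. X 1 1 \<omega> / \<sigma>) = 0"
        "expectation (\<lambda>\<omega>. (X 1 1 \<omega> / \<sigma>)\<^sup>2) = 1"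
        unfolding power_divide using int2 mean \<sigma>2[symmetric] \<sigma> by simp_all
      have "(X 1 1 \<omega> / \<sigma>)\<^sup>2 * of_bool (b < \<bar>X 1 1 \<omega> / \<sigma>\<bar>) = ((X 1 1 \<omega>)\<^sup>2 * of_bool (b * \<sigma> < \<bar>X 1 1 \<omega>\<bar>)) / \<sigma>\<^sup>2" for \<omega>
        using \<sigma> by (simp add: power_divide abs_divide pos_less_divide_eq)
      then have "expectation (\<lambda>\<omega>. (X 1 1 \<omega> / \<sigma>)\<^sup>2 * of_bool (b < \<bar>X 1 1 \<omega> / \<sigma>\<bar>))
          = expectation (\<lambda>\<omega>. (X 1 1 \<omega>)\<^sup>2 * of_bool (b * \<sigma> < \<bar>X 1 1 \<omega>\<bar>)) / \<sigma>\<^sup>2"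
        by simp
      also have "\<dots> \<le> (t * \<sigma>\<^sup>2) / \<sigma>\<^sup>2"
        using tail unfolding tail_ratio_le_def \<sigma>2[symmetric] real_sqrt_abs abs_of_nonneg[OF \<sigma>0] by (intro divide_right_mono) auto
      finally show "expectation (\<lambda>\<omega>. (X 1 1 \<omega> / \<sigma>)\<^sup>2 * of_bool (b < \<bar>X 1 1 \<omega> / \<sigma>\<bar>)) \<le> t"
        using \<sigma> by simp
    qed fact+
    have "(\<lambda>i j \<omega>. \<sigma> * (X i j \<omega> / \<sigma>)) = X"
      using \<sigma> by (auto simp: fun_eq_iff)
    with S.stopped_badly_bound[OF \<sigma> c d \<eta> \<gamma> \<kappa>] show ?thesis
      by simp
  qed
qed

text \<open>The constants are chosen in the order \<eta> from \<kappa>, t from \<eta> and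
  \<epsilon>, b from t by the uniform tail condition, and only then m large; b must not depend on
  m.\<close>

theorem stopped_badly_tendsto_0:
  fixes X :: "nat \<Rightarrow> nat \<Rightarrow> nat \<Rightarrow> 'a \<Rightarrow> real"
  assumes X: "\<And>m. 1 \<le> m \<Longrightarrow> iid M (\<lambda>(i, j). X m i j) ({1..} \<times> {1..m})"
    and int2: "\<And>m. 1 \<le> m \<Longrightarrow> integrable M (\<lambda>\<omega>. (X m 1 1 \<omega>)\<^sup>2)"
    and mean: "\<And>m. 1 \<le> m \<Longrightarrow> expectation (X m 1 1) = 0"
    and tail: "\<And>t. 0 < t \<Longrightarrow> \<exists>b>0. \<forall>m\<ge>1. tail_ratio_le (X m 1 1) b t"
    and c: "\<And>m. 1 \<le> m \<Longrightarrow> 0 < c m" and d: "\<And>m. 1 \<le> m \<Longrightarrow> 0 < d m" and \<kappa>: "1 < \<kappa>"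
  shows "(\<lambda>m. prob (stopped_badly m (X m) (c m) (d m) \<kappa>)) \<longlonglongrightarrow> 0"
proof (rule order_tendstoI)
  fix \<epsilon> :: real assume \<epsilon>: "0 < \<epsilon>"
  have "((\<lambda>\<eta>. (1 + \<eta>) / sqrt (1 - 2 * \<eta>)) \<longlongrightarrow> (1 + 0) / sqrt (1 - 2 * 0)) (at_right 0)"
    by (intro tendsto_intros) auto
  then have "\<forall>\<^sub>F \<eta> in at_right 0. (1 + \<eta>) / sqrt (1 - 2 * \<eta>) < \<kappa>"
    using \<kappa> by (intro order_tendstoD) auto
  moreover have "\<forall>\<^sub>F \<eta>::real in at_right 0. \<eta> < 1 / 4"
    by (rule order_tendstoD(2)[OF tendsto_ident_at]) simp
  ultimately have "\<forall>\<^sub>F \<eta>::real in at_right 0. (1 + \<eta>) / sqrt (1 - 2 * \<eta>) < \<kappa> \<and> \<eta> < 1 / 4 \<and> 0 < \<eta>"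
    using eventually_at_right_less[of "0::real"] by eventually_elim auto
  then obtain \<eta> :: real where \<eta>: "0 < \<eta>" "\<eta> < 1 / 4" "(1 + \<eta>) / sqrt (1 - 2 * \<eta>) < \<kappa>"
    using eventually_happens trivial_limit_at_right_real by blast
  \<comment> \<open>The first bound keeps 2 t + \<eta> at most 2 \<eta>, so the factor stays below
    \<kappa>; the second makes sqrt t / \<eta> at most \<epsilon> / 2.\<close>
  define t where "t = min (\<eta> / 2) ((\<epsilon> * \<eta> / 2)\<^sup>2)"
  have t: "0 < t" "t \<le> \<eta> / 2" "sqrt t \<le> \<epsilon> * \<eta> / 2"
  proof -
    show "0 < t" "t \<le> \<eta> / 2"
      using \<eta> \<epsilon> by (auto simp: t_def)
    have "sqrt t \<le> sqrt ((\<epsilon> * \<eta> / 2)\<^sup>2)"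
      unfolding t_def by (intro real_sqrt_le_mono) simp
    then show "sqrt t \<le> \<epsilon> * \<eta> / 2"
      using \<eta> \<epsilon> by simp
  qed
  obtain b where b: "0 < b" "\<And>m. 1 \<le> m \<Longrightarrow> tail_ratio_le (X m 1 1) b t"
    using tail[OF t(1)] by blast
  have "(1 + \<eta>) / sqrt (1 - 2 * t - \<eta>) \<le> (1 + \<eta>) / sqrt (1 - 2 * \<eta>)"
    using \<eta> t by (intro divide_left_mono real_sqrt_le_mono mult_pos_pos) auto
  then have \<kappa>': "(1 + \<eta>) / sqrt (1 - 2 * t - \<eta>) \<le> \<kappa>"
    using \<eta> by linarith
  have "(\<lambda>m. (15 * b\<^sup>2 / \<eta>) * (1 / sqrt (real m))) \<longlonglongrightarrow> (15 * b\<^sup>2 / \<eta>) * 0"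
    by (intro tendsto_mult tendsto_const tendsto_divide_0[OF tendsto_const]
        filterlim_at_top_imp_at_infinity filterlim_compose[OF sqrt_at_top] filterlim_real_sequentially)
  then have "\<forall>\<^sub>F m in sequentially. (15 * b\<^sup>2 / \<eta>) * (1 / sqrt (real m)) < \<epsilon> / 2"
    using \<epsilon> by (intro order_tendstoD) auto
  then show "\<forall>\<^sub>F m in sequentially. prob (stopped_badly m (X m) (c m) (d m) \<kappa>) < \<epsilon>"
    using eventually_ge_at_top[of 1]
  proof eventually_elim
    case (elim m)
    have "prob (stopped_badly m (X m) (c m) (d m) \<kappa>) \<le> 15 * b\<^sup>2 / (\<eta> * sqrt (real m)) + sqrt t / \<eta>"
      using elim \<eta> t b \<kappa>' by (intro stopped_badly_le X int2 mean c d) auto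
    also have "\<dots> < \<epsilon> / 2 + \<epsilon> / 2"
    proof (rule add_less_le_mono)
      show "15 * b\<^sup>2 / (\<eta> * sqrt (real m)) < \<epsilon> / 2"
        using elim by simp
      show "sqrt t / \<eta> \<le> \<epsilon> / 2"
        using t \<eta> by (simp add: field_simps)
    qed
    finally show ?case
      by simp
  qed
qed (auto intro!: always_eventually order_less_le_trans[OF _ measure_nonneg])

text \<open>For a single square-integrable variable the tail vanishes by dominated convergence; this
  covers the errors that share one law.\<close>

lemma tail_ratio_single:
  assumes int2: "integrable M (\<lambda>\<omega>. (X \<omega>)\<^sup>2)" and [measurable]: "X \<in> borel_measurable M" and t: "0 < t"
  shows "\<exists>b>0. tail_ratio_le X b t"
proof -
  define \<sigma> where "\<sigma> = sqrt (expectation (\<lambda>\<omega>. (X \<omega>)\<^sup>2))"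
  have \<sigma>2: "\<sigma>\<^sup>2 = expectation (\<lambda>\<omega>. (X \<omega>)\<^sup>2)" and \<sigma>0: "0 \<le> \<sigma>"
    by (simp_all add: \<sigma>_def)
  show ?thesis
  proof (cases "\<sigma> = 0")
    case True
    then have "AE \<omega> in M. (X \<omega>)\<^sup>2 = 0"
      using integral_nonneg_eq_0_iff_AE[OF int2] \<sigma>2 by simp
    then have "expectation (\<lambda>\<omega>. (X \<omega>)\<^sup>2 * of_bool (1 * \<sigma> < \<bar>X \<omega>\<bar>)) = 0"
      by (intro integral_eq_zero_AE) auto
    then show ?thesis
      using \<sigma>2 True by (intro exI[of _ 1]) (auto simp: tail_ratio_le_def simp flip: \<sigma>_def)
  next
    case False
    then have \<sigma>: "0 < \<sigma>"
      using \<sigma>0 by simp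
    have "(\<lambda>k. expectation (\<lambda>\<omega>. (X \<omega>)\<^sup>2 * of_bool (real k * \<sigma> < \<bar>X \<omega>\<bar>))) \<longlonglongrightarrow> expectation (\<lambda>\<omega>. 0)"
    proof (rule integral_dominated_convergence[OF _ _ int2])
      show "AE \<omega> in M. (\<lambda>k. (X \<omega>)\<^sup>2 * of_bool (real k * \<sigma> < \<bar>X \<omega>\<bar>)) \<longlonglongrightarrow> 0"
      proof (rule AE_I2, rule tendsto_eventually)
        fix \<omega>
        obtain k0 where k0: "\<bar>X \<omega>\<bar> / \<sigma> < real k0"
          using reals_Archimedean2 by blast
        have "\<not> real k * \<sigma> < \<bar>X \<omega>\<bar>" if "k0 \<le> k" for k
        proof -
          have "\<bar>X \<omega>\<bar> < real k0 * \<sigma>"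
            using k0 \<sigma> by (simp add: field_simps)
          also have "\<dots> \<le> real k * \<sigma>"
            using that \<sigma> by (intro mult_right_mono) auto
          finally show ?thesis
            by simp
        qed
        then show "\<forall>\<^sub>F k in sequentially. (X \<omega>)\<^sup>2 * of_bool (real k * \<sigma> < \<bar>X \<omega>\<bar>) = 0"
          unfolding eventually_sequentially by auto
      qed
    qed (auto simp: of_bool_def)
    moreover have "0 < t * \<sigma>\<^sup>2"
      using t \<sigma> by simp
    ultimately have "\<forall>\<^sub>F k in sequentially. expectation (\<lambda>\<omega>. (X \<omega>)\<^sup>2 * of_bool (real k * \<sigma> < \<bar>X \<omega>\<bar>)) < t * \<sigma>\<^sup>2"
      by (intro order_tendstoD) auto
    then have "\<forall>\<^sub>F k in sequentially. expectation (\<lambda>\<omega>. (X \<omega>)\<^sup>2 * of_bool (real k * \<sigma> < \<bar>X \<omega>\<bar>)) < t * \<sigma>\<^sup>2 \<and> 1 \<le> k"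
      using eventually_ge_at_top[of "1::nat"] by eventually_elim auto
    then obtain k :: nat where "expectation (\<lambda>\<omega>. (X \<omega>)\<^sup>2 * of_bool (real k * \<sigma> < \<bar>X \<omega>\<bar>)) < t * \<sigma>\<^sup>2" "1 \<le> k"
      using eventually_happens trivial_limit_sequentially by blast
    then show ?thesis
      unfolding tail_ratio_le_def \<sigma>2[symmetric] real_sqrt_abs abs_of_nonneg[OF \<sigma>0] by (intro exI[of _ "real k"]) auto
  qed
qed

text \<open>Beyond b \<sigma> the square is at most |X|^(2p) / (b \<sigma>)^(2p-2); the moment ratio
  turns this into D \<sigma>^2 / b^(2p-2), and 2p - 2 \<ge> 2.\<close>

lemma tail_ratio_moment:
  assumes int2: "integrable M (\<lambda>\<omega>. (X \<omega>)\<^sup>2)" and [measurable]: "X \<in> borel_measurable M"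
    and p: "2 \<le> p" and intp: "integrable M (\<lambda>\<omega>. \<bar>X \<omega>\<bar> powr (2 * p))"
    and moment: "expectation (\<lambda>\<omega>. \<bar>X \<omega>\<bar> powr (2 * p)) / expectation (\<lambda>\<omega>. (X \<omega>)\<^sup>2) powr p \<le> D"
    and b: "1 \<le> b" and D: "D \<le> t * b\<^sup>2" and t: "0 < t"
  shows "tail_ratio_le X b t"
proof -
  define \<sigma> where "\<sigma> = sqrt (expectation (\<lambda>\<omega>. (X \<omega>)\<^sup>2))"
  have \<sigma>2: "\<sigma>\<^sup>2 = expectation (\<lambda>\<omega>. (X \<omega>)\<^sup>2)" and \<sigma>0: "0 \<le> \<sigma>"
    by (simp_all add: \<sigma>_def)
  show ?thesis
  proof (cases "\<sigma> = 0")
    case True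
    then have "AE \<omega> in M. (X \<omega>)\<^sup>2 = 0"
      using integral_nonneg_eq_0_iff_AE[OF int2] \<sigma>2 by simp
    then have "expectation (\<lambda>\<omega>. (X \<omega>)\<^sup>2 * of_bool (b * \<sigma> < \<bar>X \<omega>\<bar>)) = 0"
      by (intro integral_eq_zero_AE) auto
    then show ?thesis
      using \<sigma>2 True by (auto simp: tail_ratio_le_def simp flip: \<sigma>_def)
  next
    case False
    then have \<sigma>: "0 < \<sigma>"
      using \<sigma>0 by simp
    define s where "s = (b * \<sigma>) powr (2 * p - 2)"
    have s: "0 < s"
      using b \<sigma> by (simp add: s_def)
    have int_tail: "integrable M (\<lambda>\<omega>. (X \<omega>)\<^sup>2 * of_bool (b * \<sigma> < \<bar>X \<omega>\<bar>))"
      by (rule Bochner_Integration.integrable_bound[OF int2]) (auto simp: of_bool_def)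
    have "expectation (\<lambda>\<omega>. (X \<omega>)\<^sup>2 * of_bool (b * \<sigma> < \<bar>X \<omega>\<bar>)) \<le> expectation (\<lambda>\<omega>. \<bar>X \<omega>\<bar> powr (2 * p) / s)"
    proof (intro integral_mono int_tail integrable_divide intp)
      fix \<omega>
      show "(X \<omega>)\<^sup>2 * of_bool (b * \<sigma> < \<bar>X \<omega>\<bar>) \<le> \<bar>X \<omega>\<bar> powr (2 * p) / s"
      proof (cases "b * \<sigma> < \<bar>X \<omega>\<bar>")
        case True
        then have pos: "0 < \<bar>X \<omega>\<bar>"
          using b \<sigma> by (smt (verit) mult_pos_pos)
        have "s \<le> \<bar>X \<omega>\<bar> powr (2 * p - 2)"
          unfolding s_def using True b \<sigma> p by (intro powr_mono2) auto
        then have "(X \<omega>)\<^sup>2 * s \<le> \<bar>X \<omega>\<bar> powr 2 * \<bar>X \<omega>\<bar> powr (2 * p - 2)"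
          using pos s by (intro mult_mono) auto
        also have "\<dots> = \<bar>X \<omega>\<bar> powr (2 * p)"
          unfolding powr_add[symmetric] by simp
        finally show ?thesis
          using True s by (simp add: field_simps)
      qed (use s in simp)
    qed
    also have "\<dots> = expectation (\<lambda>\<omega>. \<bar>X \<omega>\<bar> powr (2 * p)) / s"
      by simp
    also have "\<dots> \<le> D * \<sigma> powr (2 * p) / s"
    proof (intro divide_right_mono)
      have "(\<sigma>\<^sup>2) powr p = \<sigma> powr (2 * p)"
        using \<sigma> by (simp add: powr_powr flip: powr_numeral)
      then show "expectation (\<lambda>\<omega>. \<bar>X \<omega>\<bar> powr (2 * p)) \<le> D * \<sigma> powr (2 * p)"
        using moment \<sigma> unfolding \<sigma>2[symmetric] by (simp add: field_simps)
    qed (use s in simp)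
    also have "\<dots> = D * \<sigma>\<^sup>2 / b powr (2 * p - 2)"
      using \<sigma> b by (simp add: s_def powr_mult powr_diff powr_numeral field_simps)
    also have "\<dots> \<le> t * b\<^sup>2 * \<sigma>\<^sup>2 / b\<^sup>2"
    proof (rule frac_le)
      have "b powr 2 \<le> b powr (2 * p - 2)"
        using b p by (intro powr_mono) auto
      then show "b\<^sup>2 \<le> b powr (2 * p - 2)"
        using b by simp
      show "D * \<sigma>\<^sup>2 \<le> t * b\<^sup>2 * \<sigma>\<^sup>2"
        using D by (intro mult_right_mono) auto
    qed (use b t in auto)
    also have "\<dots> = t * \<sigma>\<^sup>2"
      using b by simp
    finally show ?thesis
      unfolding tail_ratio_le_def \<sigma>2[symmetric] real_sqrt_abs abs_of_nonneg[OF \<sigma>0] .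
  qed
qed

end

section \<open>Convergence of the discrepancy principle\<close>

context injective_compact_operator
begin

text \<open>A dense range has trivial orthogonal complement, so the domain of the pseudoinverse is
  the range of K, and by injectivity the pseudoinverse is the inverse.\<close>

lemma mp_inverse_solution:
  assumes "y \<in> mp_domain inner K"
  shows "K (mp_inverse inner K y) = y"
proof -
  obtain x v where y: "y = K x + v" and v: "\<And>z. v \<bullet> K z = 0"
    using assms by (auto simp: mp_domain_def)
  have "v \<bullet> v \<le> 0"
    by (rule le_on_closure_of_range[OF dense_range, of "\<lambda>y. v \<bullet> y" "\<lambda>_. 0"])
      (auto simp: v intro!: continuous_intros)
  then have "v = 0"
    by (metis inner_ge_zero inner_eq_zero_iff order_antisym)
  then have y: "y = K x"
    using y by simp
  have ker: "{z. K z = 0} = {0}"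
    using inj_K bounded_linear_K by (auto simp: linear_simps(3) dest: injD[of K _ 0])
  have "mp_inverse inner K y = x"
    unfolding mp_inverse_def ker
  proof (rule the_equality)
    fix x' assume "x' \<in> orthogonal_comp {0} \<and> (\<forall>z. (y - K x') \<bullet> K z = 0)"
    then have "(K x - K x') \<bullet> K (x - x') = 0"
      by (simp add: y)
    then have "K x = K x'"
      by (simp add: linear_simps[OF bounded_linear_K])
    then show "x' = x"
      using inj_K by (metis injD)
  qed (simp add: y)
  then show ?thesis
    by (simp add: y)
qed

end

text \<open>The space need not be separable, so sums of Borel maps into it are delicate. Expanding
  the inner product expresses the norm through the real coefficients alone.\<close>

lemma (in prob_space) norm_combination_measurable:
  fixes w :: "nat \<Rightarrow> 'c::real_inner"
  assumes [measurable]: "\<And>j. j \<in> J \<Longrightarrow> v j \<in> borel_measurable M"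
  shows "(\<lambda>\<omega>. norm ((\<Sum>j\<in>J. v j \<omega> *\<^sub>R w j) - w0)) \<in> borel_measurable M"
proof -
  have eq: "norm ((\<Sum>j\<in>J. v j \<omega> *\<^sub>R w j) - w0)
      = sqrt ((\<Sum>i\<in>J. \<Sum>j\<in>J. v i \<omega> * v j \<omega> * (w i \<bullet> w j)) - 2 * (\<Sum>j\<in>J. v j \<omega> * (w j \<bullet> w0)) + w0 \<bullet> w0)" for \<omega>
  proof -
    define s where "s = (\<Sum>j\<in>J. v j \<omega> *\<^sub>R w j)"
    have "s \<bullet> s = (\<Sum>i\<in>J. \<Sum>j\<in>J. v i \<omega> * v j \<omega> * (w i \<bullet> w j))"
      by (simp add: s_def inner_sum_left inner_sum_right sum_distrib_left mult_ac inner_commute)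
    moreover have "s \<bullet> w0 = (\<Sum>j\<in>J. v j \<omega> * (w j \<bullet> w0))"
      by (simp add: s_def inner_sum_left)
    moreover have "(s - w0) \<bullet> (s - w0) = s \<bullet> s - 2 * (s \<bullet> w0) + w0 \<bullet> w0"
      by (simp add: inner_diff_left inner_diff_right inner_commute)
    ultimately show ?thesis
      unfolding norm_eq_sqrt_inner s_def[symmetric] by simp
  qed
  show ?thesis
    unfolding eq by measurable
qed

lemma backproj_data_expansion:
  fixes l :: "nat \<Rightarrow> 'y::{real_inner, complete_space} \<Rightarrow> real"
  assumes "discretisation m l e"
  shows "backproj_data m l c d Y = (\<Sum>j=1..m. sample_mean m (num_reps m c d Y) Y j *\<^sub>R
    mp_inverse (dot m) (discr m l) (\<lambda>i. of_bool (i = j)))"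
  unfolding backproj_data_def
  by (rule discretisation.Pinv_expansion[OF assms]) (simp add: Rn_def sample_mean_def)

text \<open>Shifting each column leaves its sample variance unchanged, so the number of repetitions
  depends only on the errors and not on the exact values.\<close>

lemma num_reps_shift: "num_reps m c d (\<lambda>i j. a j + X i j) = num_reps m c d X"
proof -
  have "2 \<le> n \<and> real m * sample_var m n (\<lambda>i j. a j + X i j) / (real n * c\<^sup>2) \<le> d\<^sup>2 \<longleftrightarrow>
      2 \<le> n \<and> real m * sample_var m n X / (real n * c\<^sup>2) \<le> d\<^sup>2" for n
    using sample_var_shift[of n m a X] by auto
  then show ?thesis
    unfolding num_reps_def by presburger
qed

text \<open>The summand 1 is the discretisation error and \<kappa> the back-projected noise, where
  the norm bound 1 / c of the pseudoinverse cancels the factor c in the exceptional event.\<close>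

lemma (in prob_space) not_stopped_badlyD:
  fixes l :: "nat \<Rightarrow> 'y::{real_inner, complete_space} \<Rightarrow> real"
  assumes D: "discretisation m l e" and c: "0 < c"
    and sv: "\<And>\<sigma>. \<sigma> \<in> singular_values (dot m) (discr m l) \<Longrightarrow> c \<le> \<sigma>"
    and approx: "norm (y - mp_inverse (dot m) (discr m l) (discr m l y)) \<le> d"
    and \<omega>: "\<omega> \<in> space M" "\<omega> \<notin> stopped_badly m X c d \<kappa>"
  shows "norm (backproj_data m l c d (\<lambda>i j. l j y + X i j \<omega>) - y) \<le> (1 + \<kappa>) * d"
proof -
  interpret discretisation m l e
    by (rule D)
  define n where "n = num_reps m c d (\<lambda>i j. X i j \<omega>)"
  have n: "2 \<le> n" and mn: "mean_norm m n (\<lambda>i j. X i j \<omega>) \<le> \<kappa> * (c * d)"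
    using \<omega> unfolding stopped_badly_def mem_Collect_eq n_def by blast+
  have Rn: "P y \<in> Rn m" "sample_mean m n (\<lambda>i j. X i j \<omega>) \<in> Rn m"
    by (auto simp: Rn_def discr_def sample_mean_def)
  have "sample_mean m n (\<lambda>i j. l j y + X i j \<omega>) = P y + sample_mean m n (\<lambda>i j. X i j \<omega>)"
    using n by (auto simp: sample_mean_def discr_def fun_eq_iff sum.distrib field_simps)
  then have "backproj_data m l c d (\<lambda>i j. l j y + X i j \<omega>) = Pinv (P y) + Pinv (sample_mean m n (\<lambda>i j. X i j \<omega>))"
    unfolding backproj_data_def num_reps_shift n_def[symmetric] by (simp add: Pinv_add[OF Rn])
  then have "norm (backproj_data m l c d (\<lambda>i j. l j y + X i j \<omega>) - y)
      \<le> norm (y - Pinv (P y)) + norm (Pinv (sample_mean m n (\<lambda>i j. X i j \<omega>)))"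
    using norm_triangle_ineq4[of "Pinv (sample_mean m n (\<lambda>i j. X i j \<omega>))" "y - Pinv (P y)"]
    by (simp add: algebra_simps)
  also have "norm (Pinv (sample_mean m n (\<lambda>i j. X i j \<omega>))) \<le> mean_norm m n (\<lambda>i j. X i j \<omega>) / c"
    unfolding L2_set_def by (rule norm_Pinv_le[OF c sv Rn(2)])
  also have "\<dots> \<le> \<kappa> * (c * d) / c"
    using mn c by (intro divide_right_mono) auto
  also have "\<dots> = \<kappa> * d"
    using c by simp
  finally show ?thesis
    using approx by (simp add: algebra_simps)
qed

text \<open>Needed to bound the probability of the rate event from below. The two random indices,
  repetitions and stopping index, take countably many values, and for fixed values of them the error
  is the norm of a combination of fixed vectors.\<close>

lemma (in prob_space) discrepancy_error_measurable:
  fixes K :: "'x::{real_inner, complete_space} \<Rightarrow> 'y::{real_inner, complete_space}" and l :: "nat \<Rightarrow> 'y \<Rightarrow> real"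
  assumes D: "discretisation m l e" and K: "bounded_linear K"
    and R: "\<And>k. bounded_linear (regop K (F (q ^ k)))"
    and X: "\<And>i j. 1 \<le> i \<Longrightarrow> j \<in> {1..m} \<Longrightarrow> X i j \<in> borel_measurable M"
  shows "(\<lambda>\<omega>. norm (discrepancy_estimate K F q \<tau> d (backproj_data m l c d (\<lambda>i j. X i j \<omega>)) - x)) \<in> borel_measurable M"
proof -
  define g where "g j = mp_inverse (dot m) (discr m l) (\<lambda>i. of_bool (i = j))" for j
  define v where "v j \<omega> = sample_mean m (num_reps m c d (\<lambda>i j. X i j \<omega>)) (\<lambda>i j. X i j \<omega>) j" for j \<omega>
  define z where "z \<omega> = (\<Sum>j=1..m. v j \<omega> *\<^sub>R g j)" for \<omega>
  have z: "backproj_data m l c d (\<lambda>i j. X i j \<omega>) = z \<omega>" for \<omega>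
    unfolding z_def v_def g_def by (rule backproj_data_expansion[OF D])
  have v [measurable]: "v j \<in> borel_measurable M" for j
    unfolding v_def
    by (rule measurable_compose_countable[where g = "\<lambda>\<omega>. num_reps m c d (\<lambda>i j. X i j \<omega>)"
          and f = "\<lambda>n \<omega>. sample_mean m n (\<lambda>i j. X i j \<omega>) j"])
      (intro sample_mean_measurable num_reps_measurable X; assumption)+
  have R_z: "regop K (F (q ^ k)) (z \<omega>) = (\<Sum>j=1..m. v j \<omega> *\<^sub>R regop K (F (q ^ k)) (g j))" for k \<omega>
    unfolding z_def by (simp add: linear_sum[OF bounded_linear.linear[OF R]] linear_simps[OF R])
  have "K (regop K (F (q ^ k)) (z \<omega>)) - z \<omega> = (\<Sum>j=1..m. v j \<omega> *\<^sub>R (K (regop K (F (q ^ k)) (g j)) - g j)) - 0" for k \<omega>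
    unfolding R_z by (simp add: z_def linear_sum[OF bounded_linear.linear[OF K]] linear_simps[OF K] scaleR_diff_right sum_subtractf)
  then have [measurable]: "(\<lambda>\<omega>. norm (K (regop K (F (q ^ k)) (z \<omega>)) - z \<omega>)) \<in> borel_measurable M" for k
    by (simp only: norm_combination_measurable[OF v])
  have [measurable]: "(\<lambda>\<omega>. norm (regop K (F (q ^ k)) (z \<omega>) - x)) \<in> borel_measurable M" for k
    unfolding R_z by (rule norm_combination_measurable[OF v])
  have [measurable]: "(\<lambda>\<omega>. LEAST k. norm (K (regop K (F (q ^ k)) (z \<omega>)) - z \<omega>) \<le> 2 * \<tau> * d) \<in> measurable M (count_space UNIV)"
    by measurable
  have "(\<lambda>\<omega>. norm (regop K (F (q ^ (LEAST k. norm (K (regop K (F (q ^ k)) (z \<omega>)) - z \<omega>) \<le> 2 * \<tau> * d))) (z \<omega>) - x)) \<in> borel_measurable M"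
    by (rule measurable_compose_countable[where f = "\<lambda>k \<omega>. norm (regop K (F (q ^ k)) (z \<omega>) - x)"
          and g = "\<lambda>\<omega>. LEAST k. norm (K (regop K (F (q ^ k)) (z \<omega>)) - z \<omega>) \<le> 2 * \<tau> * d"]) measurable
  then show ?thesis
    by (simp only: z discrepancy_estimate_def discrepancy_param_def)
qed

lemma abs_powr_two_le: "2 \<le> r \<Longrightarrow> x\<^sup>2 \<le> 1 + \<bar>x\<bar> powr r" for x :: real
proof (cases "\<bar>x\<bar> \<le> 1")
  case True
  then have "x\<^sup>2 \<le> 1"
    by (simp add: abs_square_le_1)
  then show ?thesis
    by (simp add: add_increasing2)
next
  case False
  assume "2 \<le> r"
  then have "\<bar>x\<bar> powr 2 \<le> \<bar>x\<bar> powr r"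
    using False by (intro powr_mono) auto
  then show ?thesis
    using False by simp
qed

text \<open>Brings both error models to one form. In the first all errors have the law of a single
  variable, so its truncation level serves every m; in the second the moment ratio gives a level in
  terms of \<open>C\<^sub>d\<close> and t alone.\<close>

lemma (in prob_space) error_tail_ratio:
  fixes X :: "nat \<Rightarrow> nat \<Rightarrow> nat \<Rightarrow> 'a \<Rightarrow> real"
  assumes "(iid M (\<lambda>(m, i, j). X m i j) ({1..} \<times> {1..} \<times> {1..}) \<and>
          (\<forall>m\<ge>1. \<forall>i\<ge>1. \<forall>j\<ge>1. integrable M (X m i j) \<and> expectation (X m i j) = 0 \<and>
             integrable M (\<lambda>\<omega>. (X m i j \<omega>)\<^sup>2)))
       \<or> (\<exists>C\<^sub>d p::real. p \<ge> 2 \<and> (\<forall>m\<ge>1.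
          iid M (\<lambda>(i, j). X m i j) ({1..} \<times> {1..}) \<and>
          (\<forall>i\<ge>1. \<forall>j\<ge>1. integrable M (X m i j) \<and> expectation (X m i j) = 0 \<and>
             integrable M (\<lambda>\<omega>. \<bar>X m i j \<omega>\<bar> powr (2 * p)) \<and>
             expectation (\<lambda>\<omega>. \<bar>X m i j \<omega>\<bar> powr (2 * p)) / expectation (\<lambda>\<omega>. (X m i j \<omega>)\<^sup>2) powr p \<le> C\<^sub>d)))"
      (is "?A \<or> ?B")
  shows "\<And>m. 1 \<le> m \<Longrightarrow> iid M (\<lambda>(i, j). X m i j) ({1..} \<times> {1..m})"
    and "\<And>m. 1 \<le> m \<Longrightarrow> integrable M (\<lambda>\<omega>. (X m 1 1 \<omega>)\<^sup>2)"
    and "\<And>m. 1 \<le> m \<Longrightarrow> expectation (X m 1 1) = 0"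
    and "\<And>t. 0 < t \<Longrightarrow> \<exists>b>0. \<forall>m\<ge>1. tail_ratio_le (X m 1 1) b t"
proof -
  consider ?A | ?B
    using assms by blast
  then have "(\<forall>m\<ge>1. iid M (\<lambda>(i, j). X m i j) ({1..} \<times> {1..m})) \<and>
    (\<forall>m\<ge>1. integrable M (\<lambda>\<omega>. (X m 1 1 \<omega>)\<^sup>2)) \<and> (\<forall>m\<ge>1. expectation (X m 1 1) = 0) \<and>
    (\<forall>t>0. \<exists>b>0. \<forall>m\<ge>1. tail_ratio_le (X m 1 1) b t)"
  proof cases
    case 1
    let ?X = "\<lambda>(m, i, j). X m i j"
    have iid3: "iid M ?X ({1..} \<times> {1..} \<times> {1..})" and int: "integrable M (\<lambda>\<omega>. (X m 1 1 \<omega>)\<^sup>2)"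
      and mean: "expectation (X m 1 1) = 0" and int1: "integrable M (X m 1 1)" if "1 \<le> m" for m
      using 1 that by auto
    have row: "iid M (\<lambda>(i, j). X m i j) ({1..} \<times> {1..m})" if m: "1 \<le> m" for m
    proof -
      have "indep_vars (\<lambda>_. borel) (\<lambda>p. ?X (m, p)) ({1..} \<times> {1..m})"
        using m by (intro indep_vars_reindex[OF iid_indep_vars[OF iid3[OF m]], of "Pair m" "{1..} \<times> {1..m}"]) (auto simp: inj_on_def)
      moreover have "distr M borel (?X (m, p)) = distr M borel (?X (m, p'))"
        if "p \<in> {1..} \<times> {1..m}" "p' \<in> {1..} \<times> {1..m}" for p p'
        using m that by (intro iid_distr_eq[OF iid3[OF m]]) auto
      ultimately have "iid M (\<lambda>p. ?X (m, p)) ({1..} \<times> {1..m})"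
        unfolding iid_def by blast
      then show ?thesis
        by simp
    qed
    have "\<exists>b>0. \<forall>m\<ge>1. tail_ratio_le (X m 1 1) b t" if t: "0 < t" for t
    proof -
      obtain b where b: "0 < b" "tail_ratio_le (X 1 1 1) b t"
        using tail_ratio_single[OF int[of 1] _ t] int1[of 1] by auto
      have "tail_ratio_le (X m 1 1) b t" if m: "1 \<le> m" for m
      proof -
        have eq: "expectation (\<lambda>\<omega>. g (X m 1 1 \<omega>)) = expectation (\<lambda>\<omega>. g (X 1 1 1 \<omega>))"
          if "g \<in> borel_measurable borel" for g :: "real \<Rightarrow> real"
          using iid_expectation_eq[OF iid3[OF m], of "(m, 1, 1)" "(1, 1, 1)" g] m that by simp
        have sq: "expectation (\<lambda>\<omega>. (X m 1 1 \<omega>)\<^sup>2) = expectation (\<lambda>\<omega>. (X 1 1 1 \<omega>)\<^sup>2)"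
          by (rule eq) measurable
        define s where "s = b * sqrt (expectation (\<lambda>\<omega>. (X 1 1 1 \<omega>)\<^sup>2))"
        have "expectation (\<lambda>\<omega>. (X m 1 1 \<omega>)\<^sup>2 * of_bool (s < \<bar>X m 1 1 \<omega>\<bar>)) = expectation (\<lambda>\<omega>. (X 1 1 1 \<omega>)\<^sup>2 * of_bool (s < \<bar>X 1 1 1 \<omega>\<bar>))"
          by (rule eq) (simp add: of_bool_def)
        then show ?thesis
          using b(2) unfolding tail_ratio_le_def sq s_def by simp
      qed
      then show ?thesis
        using b(1) by blast
    qed
    then show ?thesis
      using row int mean by blast
  next
    case 2
    then obtain D p :: real where p: "2 \<le> p" and all: "\<forall>m\<ge>1.
          iid M (\<lambda>(i, j). X m i j) ({1..} \<times> {1..}) \<and>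
          (\<forall>i\<ge>1. \<forall>j\<ge>1. integrable M (X m i j) \<and> expectation (X m i j) = 0 \<and>
             integrable M (\<lambda>\<omega>. \<bar>X m i j \<omega>\<bar> powr (2 * p)) \<and>
             expectation (\<lambda>\<omega>. \<bar>X m i j \<omega>\<bar> powr (2 * p)) / expectation (\<lambda>\<omega>. (X m i j \<omega>)\<^sup>2) powr p \<le> D)"
      by blast
    then have iid2: "iid M (\<lambda>(i, j). X m i j) ({1..} \<times> {1..})"
      and int1: "integrable M (X m 1 1)" and mean: "expectation (X m 1 1) = 0"
      and intp: "integrable M (\<lambda>\<omega>. \<bar>X m 1 1 \<omega>\<bar> powr (2 * p))"
      and moment: "expectation (\<lambda>\<omega>. \<bar>X m 1 1 \<omega>\<bar> powr (2 * p)) / expectation (\<lambda>\<omega>. (X m 1 1 \<omega>)\<^sup>2) powr p \<le> D"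
      if "1 \<le> m" for m
      using that by auto
    have int2: "integrable M (\<lambda>\<omega>. (X m 1 1 \<omega>)\<^sup>2)" if m: "1 \<le> m" for m
    proof (rule Bochner_Integration.integrable_bound)
      show "integrable M (\<lambda>\<omega>. 1 + \<bar>X m 1 1 \<omega>\<bar> powr (2 * p))"
        using intp[OF m] by simp
      show "(\<lambda>\<omega>. (X m 1 1 \<omega>)\<^sup>2) \<in> borel_measurable M"
        using int1[OF m] by simp
      show "AE \<omega> in M. norm ((X m 1 1 \<omega>)\<^sup>2) \<le> norm (1 + \<bar>X m 1 1 \<omega>\<bar> powr (2 * p))"
        using abs_powr_two_le[of "2 * p"] p by (intro AE_I2) simp
    qed
    have "\<exists>b>0. \<forall>m\<ge>1. tail_ratio_le (X m 1 1) b t" if t: "0 < t" for t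
    proof -
      define b where "b = max 1 (\<bar>D\<bar> / t)"
      have b: "1 \<le> b" "D \<le> t * b\<^sup>2"
      proof -
        show "1 \<le> b"
          by (simp add: b_def)
        then have "b * 1 \<le> b * b"
          by (intro mult_left_mono) auto
        moreover have "D \<le> t * b"
          using t by (auto simp: b_def max_def field_simps)
        ultimately show "D \<le> t * b\<^sup>2"
          using t by (smt (verit) mult_left_mono mult_1_right power2_eq_square)
      qed
      have "tail_ratio_le (X m 1 1) b t" if m: "1 \<le> m" for m
        by (rule tail_ratio_moment[OF int2[OF m] borel_measurable_integrable[OF int1[OF m]] p intp[OF m] moment[OF m] b t])
      then show ?thesis
        using b(1) by (intro exI[of _ b]) auto
    qed
    moreover have "iid M (\<lambda>(i, j). X m i j) ({1..} \<times> {1..m})" if "1 \<le> m" for m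
      by (rule iid_subset[OF iid2[OF that]]) auto
    ultimately show ?thesis
      using int2 mean by blast
  qed
  then show "\<And>m. 1 \<le> m \<Longrightarrow> iid M (\<lambda>(i, j). X m i j) ({1..} \<times> {1..m})"
    and "\<And>m. 1 \<le> m \<Longrightarrow> integrable M (\<lambda>\<omega>. (X m 1 1 \<omega>)\<^sup>2)"
    and "\<And>m. 1 \<le> m \<Longrightarrow> expectation (X m 1 1) = 0"
    and "\<And>t. 0 < t \<Longrightarrow> \<exists>b>0. \<forall>m\<ge>1. tail_ratio_le (X m 1 1) b t"
    by blast+
qed

theorem theorem3p10:
  fixes K :: "'x::{real_inner, complete_space} \<Rightarrow> 'y::{real_inner, complete_space}"
    and yhat :: 'y
    and l :: "nat \<Rightarrow> nat \<Rightarrow> 'y \<Rightarrow> real"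
    and M :: "'w measure"
    and \<delta> :: "nat \<Rightarrow> nat \<Rightarrow> nat \<Rightarrow> 'w \<Rightarrow> real"
    and Y :: "nat \<Rightarrow> 'w \<Rightarrow> nat \<Rightarrow> nat \<Rightarrow> real"
    and d c C :: "nat \<Rightarrow> real"
    and F :: "real \<Rightarrow> real \<Rightarrow> real"
    and \<nu>0 :: ereal and C0 \<tau> q :: real
    and Z :: "nat \<Rightarrow> 'w \<Rightarrow> 'x"
  assumes "infinite_dimensional (UNIV :: 'x set)"
    and "infinite_dimensional (UNIV :: 'y set)"
    and "compact_operator K" and "inj K" and "closure (range K) = UNIV"
    and "yhat \<in> mp_domain inner K"
    and "\<And>m j. m \<ge> 1 \<Longrightarrow> j \<in> {1..m} \<Longrightarrow> bounded_linear (l m j)"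
    and "\<And>m j. m \<ge> 1 \<Longrightarrow> j \<in> {1..m} \<Longrightarrow> onorm (l m j) = onorm (l m 1)"
    and "\<And>m. m \<ge> 1 \<Longrightarrow>
           bij_betw (\<lambda>v. discr m (l m) (adjoint_ip (dot m) (discr m (l m)) v)) (Rn m) (Rn m)"
    and "\<And>m. m \<ge> 1 \<Longrightarrow> d m > 0" and "\<And>m. m \<ge> 1 \<Longrightarrow> c m > 0" and "\<And>m. m \<ge> 1 \<Longrightarrow> C m > 0"
    and "\<forall>\<^sub>F m in sequentially.
           norm (yhat - mp_inverse (dot m) (discr m (l m)) (discr m (l m) yhat)) \<le> d m"
    and "\<forall>\<^sub>F m in sequentially.
           \<forall>\<sigma>\<in>singular_values (dot m) (discr m (l m)). c m \<le> \<sigma> \<and> \<sigma> \<le> C m"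
    and "d \<longlonglongrightarrow> 0"
    and "limsup (\<lambda>m. ereal (C m / c m)) < \<infinity>"
    and "prob_space M"
    and "(iid M (\<lambda>(m, i, j). \<delta> m i j) ({1..} \<times> {1..} \<times> {1..}) \<and>
          (\<forall>m\<ge>1. \<forall>i\<ge>1. \<forall>j\<ge>1. integrable M (\<delta> m i j) \<and> (\<integral>\<omega>. \<delta> m i j \<omega> \<partial>M) = 0 \<and>
             integrable M (\<lambda>\<omega>. (\<delta> m i j \<omega>)\<^sup>2)))
       \<or> (\<exists>C\<^sub>d p::real. p \<ge> 2 \<and> (\<forall>m\<ge>1.
          iid M (\<lambda>(i, j). \<delta> m i j) ({1..} \<times> {1..}) \<and>
          (\<forall>i\<ge>1. \<forall>j\<ge>1. integrable M (\<delta> m i j) \<and> (\<integral>\<omega>. \<delta> m i j \<omega> \<partial>M) = 0 \<and>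
             integrable M (\<lambda>\<omega>. \<bar>\<delta> m i j \<omega>\<bar> powr (2 * p)) \<and>
             (\<integral>\<omega>. \<bar>\<delta> m i j \<omega>\<bar> powr (2 * p) \<partial>M) / (\<integral>\<omega>. (\<delta> m i j \<omega>)\<^sup>2 \<partial>M) powr p \<le> C\<^sub>d)))"
    and "\<And>m \<omega> i j. Y m \<omega> i j = l m j yhat + \<delta> m i j \<omega>"
    and "regularising_filter ((onorm K)\<^sup>2) F \<nu>0" and "\<nu>0 > 1"
    and "rate_const ((onorm K)\<^sup>2) F 0 C0" and "\<tau> > C0"
    and "0 < q" and "q < 1"
    and "\<And>m \<omega>. Z m \<omega> =
           discrepancy_estimate K F q \<tau> (d m) (backproj_data m (l m) (c m) (d m) (Y m \<omega>))"
  shows "(\<forall>\<epsilon>>0.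
            (\<lambda>m. measure M {\<omega> \<in> space M. norm (Z m \<omega> - mp_inverse inner K yhat) \<ge> \<epsilon>}) \<longlonglongrightarrow> 0) \<and>
         (\<forall>\<nu> \<rho> :: real. \<forall>w.
            0 < \<nu> \<and> ereal \<nu> \<le> \<nu>0 - 1 \<and> \<rho> > 0 \<and> norm w \<le> \<rho> \<and>
            mp_inverse inner K yhat = fun_calc (\<lambda>t. t powr (\<nu> / 2)) (adjoint K \<circ> K) w \<longrightarrow>
            (\<exists>L'. (\<lambda>m. measure M {\<omega> \<in> space M. norm (Z m \<omega> - mp_inverse inner K yhat)
                        \<le> L' * \<rho> powr (1 / (\<nu> + 1)) * d m powr (\<nu> / (\<nu> + 1))}) \<longlonglongrightarrow> 1))"
proof -
  note infinite_x = assms(1) and compact_K = assms(3) and inj_K = assms(4) and dense_K = assms(5)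
    and yhat = assms(6) and bl_l = assms(7) and bij_P = assms(9) and d_pos = assms(10) and c_pos = assms(11)
    and approx = assms(13) and sv = assms(14) and d_lim = assms(15) and prob_M = assms(17)
    and errors = assms(18) and Y_eq = assms(19) and filter = assms(20) and \<nu>0 = assms(21)
    and rate0 = assms(22) and \<tau> = assms(23) and q = assms(24,25) and Z_eq = assms(26)
  interpret prob_space M
    by (rule prob_M)
  interpret K: injective_compact_operator K
    by unfold_locales (rule compact_K inj_K dense_K)+
  define B where "B = (onorm K)\<^sup>2"
  \<comment> \<open>A nonzero vector makes the norm of K positive and the spectral interval
    nonempty; evaluating the filter bounds at its end point \<open>B\<close> shows that the
    constants are nonnegative.\<close>
  obtain x0 :: 'x where x0: "x0 \<noteq> 0"
  proof -
    have "\<not> (UNIV :: 'x set) \<subseteq> span {}"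
      using infinite_x unfolding infinite_dimensional_def by blast
    then show thesis
      using that by auto
  qed
  have B: "0 < B"
  proof -
    have "K x0 \<noteq> 0"
      using x0 inj_K K.bounded_linear_K by (metis injD linear_simps(3))
    then have "onorm K \<noteq> 0"
      using onorm_eq_0[OF K.bounded_linear_K] by auto
    then show ?thesis
      by (simp add: B_def)
  qed
  then have B_mem: "B \<in> {0<..B}"
    by simp
  have C0: "0 \<le> C0"
  proof -
    have "B powr (0 / 2) * \<bar>1 - F 1 B * B\<bar> \<le> C0 * 1 powr (0 / 2)"
      using rate0[unfolded rate_const_def, rule_format, of 1 B] B_mem by (simp add: B_def)
    then show ?thesis
      using B by simp
  qed
  obtain C\<^sub>R where C\<^sub>R: "\<And>\<alpha> t. 0 < \<alpha> \<Longrightarrow> t \<in> {0<..B} \<Longrightarrow> t * \<bar>F \<alpha> t\<bar> \<le> C\<^sub>R"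
    using filter unfolding regularising_filter_def B_def by blast
  obtain C\<^sub>F where C\<^sub>F: "\<And>\<alpha> t. 0 < \<alpha> \<Longrightarrow> t \<in> {0<..B} \<Longrightarrow> \<bar>F \<alpha> t\<bar> \<le> C\<^sub>F / \<alpha>"
    using filter unfolding regularising_filter_def B_def by blast
  have C\<^sub>R0: "0 \<le> C\<^sub>R" and C\<^sub>F0: "0 \<le> C\<^sub>F"
  proof -
    have "0 \<le> B * \<bar>F 1 B\<bar>" "0 \<le> \<bar>F 1 B\<bar>"
      using B by auto
    then show "0 \<le> C\<^sub>R" "0 \<le> C\<^sub>F"
      using C\<^sub>R[OF zero_less_one B_mem] C\<^sub>F[OF zero_less_one B_mem] by linarith+
  qed
  have rates: "\<exists>C. rate_const B F \<nu> C" if "0 \<le> \<nu>" "ereal \<nu> \<le> \<nu>0" for \<nu>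
    using filter that unfolding regularising_filter_def qualification_def rates_upto_def B_def by blast
  \<comment> \<open>Any \<kappa> above 1 with C0 (1 + \<kappa>) < 2 \<tau> would do; this one gives
    C0 (1 + \<kappa>) \<le> C0 + \<tau>. The denominator C0 + 1 allows C0 = 0.\<close>
  define \<kappa> where "\<kappa> = 1 + (\<tau> - C0) / (C0 + 1)"
  have \<kappa>: "1 < \<kappa>"
    using \<tau> C0 by (simp add: \<kappa>_def)
  have C0\<kappa>: "C0 * (1 + \<kappa>) < 2 * \<tau>"
  proof -
    have "C0 * ((\<tau> - C0) / (C0 + 1)) \<le> (\<tau> - C0) * 1"
      using \<tau> C0 by (simp add: field_simps)
    then show ?thesis
      using \<tau> by (simp add: \<kappa>_def algebra_simps)
  qed
  interpret R: discrepancy_regularisation K F C0 C\<^sub>R C\<^sub>F q \<tau> "1 + \<kappa>"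
    using rate0 C0 C\<^sub>R C\<^sub>F C\<^sub>R0 C\<^sub>F0 q \<kappa> C0\<kappa> by unfold_locales (auto simp: B_def)
  define x where "x = mp_inverse inner K yhat"
  have Kx: "K x = yhat"
    unfolding x_def by (rule K.mp_inverse_solution[OF yhat])
  have "\<exists>e. discretisation m (l m) e" if m: "1 \<le> m" for m
  proof -
    have "\<exists>e. \<forall>y. l m j y = y \<bullet> e" if "j \<in> {1..m}" for j
      using riesz_representation[OF bl_l[OF m that]] by metis
    then obtain e where "\<And>j y. j \<in> {1..m} \<Longrightarrow> l m j y = y \<bullet> e j"
      by metis
    then show ?thesis
      using bij_P[OF m] by (intro exI[of _ e] discretisation.intro)
  qed
  then obtain e where D: "\<And>m. 1 \<le> m \<Longrightarrow> discretisation m (l m) (e m)"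
    by metis
  note err = error_tail_ratio[OF errors]
  define bad where "bad m = stopped_badly m (\<delta> m) (c m) (d m) \<kappa>" for m
  have rv: "\<delta> m i j \<in> borel_measurable M" if "1 \<le> m" "1 \<le> i" "j \<in> {1..m}" for m i j
    using iid_random_variable[OF err(1)[OF that(1)], of "(i, j)"] that by simp
  have bad [measurable]: "bad m \<in> events" if "1 \<le> m" for m
    unfolding bad_def by (rule stopped_badly_measurable[OF rv[OF that]])
  have bad_lim: "(\<lambda>m. prob (bad m)) \<longlonglongrightarrow> 0"
    unfolding bad_def by (rule stopped_badly_tendsto_0[OF err]) (use c_pos d_pos \<kappa> in auto)
  define z where "z m \<omega> = backproj_data m (l m) (c m) (d m) (Y m \<omega>)" for m \<omega>
  have Y: "Y m \<omega> = (\<lambda>i j. l m j yhat + \<delta> m i j \<omega>)" for m \<omega>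
    by (intro ext Y_eq)
  have Z: "Z m \<omega> = R.est (d m) (z m \<omega>)" for m \<omega>
    by (simp add: Z_eq z_def)
  \<comment> \<open>Off the exceptional event the rest of the argument is deterministic.\<close>
  have good: "\<forall>\<^sub>F m in sequentially. 1 \<le> m \<and> (\<forall>\<omega>\<in>space M - bad m. norm (z m \<omega> - K x) \<le> (1 + \<kappa>) * d m)"
    using approx sv eventually_ge_at_top[of 1]
  proof eventually_elim
    case (elim m)
    have "norm (z m \<omega> - K x) \<le> (1 + \<kappa>) * d m" if "\<omega> \<in> space M - bad m" for \<omega>
      unfolding z_def Y Kx using elim that
      by (intro not_stopped_badlyD[OF D c_pos]) (auto simp: bad_def)
    then show ?case
      using elim by blast
  qed
  have "ereal 1 \<le> \<nu>0"
    using \<nu>0 by (simp add: one_ereal_def less_imp_le)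
  then obtain C1 where rate1: "rate_const B F 1 C1"
    using rates[of 1] by auto
  have conv: "(\<lambda>m. prob {\<omega> \<in> space M. norm (Z m \<omega> - x) \<ge> \<epsilon>}) \<longlonglongrightarrow> 0" if \<epsilon>: "0 < \<epsilon>" for \<epsilon>
  proof -
    \<comment> \<open>The qualification exceeds 1 strictly and may be infinite, so a finite exponent
      1 + \<nu> is picked above 1 and not beyond it.\<close>
    obtain \<nu> where \<nu>: "0 < \<nu>" "ereal (1 + \<nu>) \<le> \<nu>0"
    proof -
      obtain r where "1 < ereal r" "ereal r < \<nu>0"
        using ereal_dense2[OF \<nu>0] by auto
      then show thesis
        using that[of "r - 1"] by (simp add: one_ereal_def)
    qed
    obtain C2 where rate2: "rate_const B F (1 + \<nu>) C2"
      using rates[of "1 + \<nu>"] \<nu> by auto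
    obtain \<delta>0 where \<delta>0: "0 < \<delta>0"
      "\<And>\<delta> z. 0 < \<delta> \<Longrightarrow> \<delta> \<le> \<delta>0 \<Longrightarrow> norm (z - K x) \<le> (1 + \<kappa>) * \<delta> \<Longrightarrow> norm (R.est \<delta> z - x) < \<epsilon>"
      using R.discrepancy_convergence[OF rate1[unfolded B_def] rate2[unfolded B_def] \<nu>(1) \<epsilon>] by metis
    have "\<forall>\<^sub>F m in sequentially. d m < \<delta>0"
      using d_lim \<delta>0(1) by (rule order_tendstoD)
    with good have "\<forall>\<^sub>F m in sequentially. prob {\<omega> \<in> space M. norm (Z m \<omega> - x) \<ge> \<epsilon>} \<le> prob (bad m)"
    proof eventually_elim
      case (elim m)
      have "norm (Z m \<omega> - x) < \<epsilon>" if "\<omega> \<in> space M - bad m" for \<omega>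
        unfolding Z using elim that d_pos by (intro \<delta>0) auto
      \<comment> \<open>An upper bound for a probability asks for measurability of the larger set
        only.\<close>
      then have "{\<omega> \<in> space M. norm (Z m \<omega> - x) \<ge> \<epsilon>} \<subseteq> bad m"
        by force
      then show ?case
        using elim by (intro finite_measure_mono bad) auto
    qed
    then show ?thesis
      by (intro tendsto_sandwich[OF _ _ tendsto_const bad_lim]) auto
  qed
  have rate: "\<exists>L'. (\<lambda>m. prob {\<omega> \<in> space M. norm (Z m \<omega> - x)
                  \<le> L' * \<rho> powr (1 / (\<nu> + 1)) * d m powr (\<nu> / (\<nu> + 1))}) \<longlonglongrightarrow> 1"
    if \<nu>: "0 < \<nu>" "ereal \<nu> \<le> \<nu>0 - 1" and \<rho>: "0 < \<rho>" and w: "norm w \<le> \<rho>"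
      and x: "x = fun_calc (\<lambda>t. t powr (\<nu> / 2)) K.A w" for \<nu> \<rho> w
  proof -
    have "ereal (1 + \<nu>) \<le> \<nu>0"
      using \<nu>(2) \<nu>0 by (cases \<nu>0) (auto simp: one_ereal_def)
    then obtain C2 where rate2: "rate_const B F (1 + \<nu>) C2"
      using rates[of "1 + \<nu>"] \<nu> by auto
    obtain L where L: "\<And>\<delta> z. 0 < \<delta> \<Longrightarrow> \<delta> \<le> 1 \<Longrightarrow> norm (z - K x) \<le> (1 + \<kappa>) * \<delta> \<Longrightarrow>
        norm (R.est \<delta> z - x) \<le> L * \<rho> powr (1 / (\<nu> + 1)) * \<delta> powr (\<nu> / (\<nu> + 1))"
      using R.discrepancy_rate[OF rate1[unfolded B_def] rate2[unfolded B_def] \<nu>(1) \<rho> w x] by metis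
    define G where "G m = {\<omega> \<in> space M. norm (Z m \<omega> - x) \<le> L * \<rho> powr (1 / (\<nu> + 1)) * d m powr (\<nu> / (\<nu> + 1))}" for m
    have "\<forall>\<^sub>F m in sequentially. d m < 1"
      using d_lim by (rule order_tendstoD) simp
    with good have lower: "\<forall>\<^sub>F m in sequentially. 1 - prob (bad m) \<le> prob (G m)"
    proof eventually_elim
      case (elim m)
      have "norm (Z m \<omega> - x) \<le> L * \<rho> powr (1 / (\<nu> + 1)) * d m powr (\<nu> / (\<nu> + 1))" if "\<omega> \<in> space M - bad m" for \<omega>
        unfolding Z using elim that d_pos by (intro L) auto
      then have sub: "space M - bad m \<subseteq> G m"
        unfolding G_def by blast
      \<comment> \<open>A lower bound for the probability of \<open>G m\<close> does ask for its
        measurability, as \<open>measure\<close> is 0 on sets that are not measurable.\<close>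
      have "(\<lambda>\<omega>. norm (Z m \<omega> - x)) \<in> borel_measurable M"
        unfolding Z_eq Y using elim q
        by (intro discrepancy_error_measurable[OF D] K.bounded_linear_K R.bounded_linear_R borel_measurable_add
            borel_measurable_const rv) auto
      then have "G m \<in> events"
        unfolding G_def by measurable
      then have "prob (space M - bad m) \<le> prob (G m)"
        by (intro finite_measure_mono sub)
      then show ?case
        using elim prob_compl[OF bad] by simp
    qed
    have "(\<lambda>m. 1 - prob (bad m)) \<longlonglongrightarrow> 1 - 0"
      by (intro tendsto_diff tendsto_const bad_lim)
    then have "(\<lambda>m. 1 - prob (bad m)) \<longlonglongrightarrow> 1"
      by simp
    from tendsto_sandwich[OF lower _ this tendsto_const] have "(\<lambda>m. prob (G m)) \<longlonglongrightarrow> 1"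
      by simp
    then show ?thesis
      unfolding G_def by blast
  qed
  show ?thesis
    unfolding x_def[symmetric]
  proof (intro conjI allI impI, goal_cases)
    case (1 \<epsilon>)
    then show ?case
      by (rule conv)
  next
    case (2 \<nu> \<rho> w)
    then show ?case
      by (elim conjE) (rule rate)
  qed
qed

end
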